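(* Let $n\ge 2$ and let $A^{ij}=g^{ij}\frac{d}{dx}+b^{ij}_k u^k_x$ and $\tilde A^{ij}=\tilde g^{ij}\frac{d}{dx}+\tilde b^{ij}_k u^k_x$ be two compatible nondegenerate Hamiltonian operators of hydrodynamic type in $n$ dependent variables, such that the operator $r^i_j=\tilde g^{is}g_{sj}$ has simple spectrum. Let $R^1,\dots,R^n$ be diagonal coordinates for the pair, defined on a connected, simply connected open set $U\subset\mathbb{R}^n$, in which $g^{ij}=\mathrm{diag}(1/H_i^2)$ with $H_i>0$ and $\tilde g^{ij}=\mathrm{diag}(\eta_i/H_i^2)$ with each $\eta_i=\eta_i(R^i)$ depending only on $R^i$. Put $\beta_{ij}=\partial_iH_j/H_i$ for $i\neq j$, where $\partial_i=\partial/\partial R^i$. For every real $\lambda$ in an open interval $\Lambda$ on which all $\lambda+\eta_i>0$ on $U$, the metric $\tilde g^{ij}+\lambda g^{ij}$ (upper indices) is flat, i.e. the metric $$\sum_{i=1}^n\frac{H_i^2}{\lambda+\eta_i}\,(dR^i)^2$$ is flat. Let $\vec r_\lambda:U\to E^n$ be the corresponding $n$-orthogonal coordinate system in Euclidean space, i.e. $(\partial_i\vec r_\lambda,\partial_j\vec r_\lambda)=\frac{H_i^2}{\lambda+\eta_i}\delta_{ij}$, and let $\vec\varphi_i=\frac{\sqrt{\lambda+\eta_i}}{H_i}\,\partial_i\vec r_\lambda$ be the unit vectors along the coordinate lines. Then the family $\vec r_\lambda$, $\lambda\in\Lambda$, deforms in such a way that the shape operators of all coordinate hypersurfaces are preserved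 up to constant scaling factors. Precisely, for each $m\in\{1,\dots,n\}$ and each coordinate hypersurface $M^{n-1}_\lambda=\vec r_\lambda(\{R^m=\mathrm{const}\})$, with unit normal $\vec\varphi_m$: (1) the coordinates $R^i$, $i\ne m$, are curvature-line coordinates on $M^{n-1}_\lambda$ for every $\lambda$, and $$\partial_i\vec\varphi_m=k^i\,\partial_i\vec r_\lambda,\qquad k^i=\frac{\beta_{mi}}{H_i}\sqrt{\lambda+\eta_m},\qquad i\neq m,$$ so that $k^i$ are the principal curvatures of $M^{n-1}_\lambda$ and the dependence of the shape operator on $\lambda$ is only through the factor $\sqrt{\lambda+\eta_m}$, which is constant on $M^{n-1}_\lambda$; (2) consequently, applying to $M^{n-1}_\lambda$ the homothety of $E^n$ with factor $\sqrt{\lambda+\eta_m}$ yields a one-parameter (in $\lambda$) nontrivial deformation of the coordinate hypersurface which preserves the shape operator, i.e. preserves both the principal directions (the coordinates $R^i$, $i\ne m$) and the principal curvatures.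
   Context: Hamiltonian operators of hydrodynamic type: a nondegenerate operator $A^{ij}=g^{ij}(u)\frac{d}{dx}+b^{ij}_k(u)u^k_x$ with $\det g^{ij}\neq0$, $b^{ij}_k=-g^{is}\Gamma^j_{sk}$, is Hamiltonian if the bracket $\{F,G\}=\int\frac{\delta F}{\delta u^i}A^{ij}\frac{\delta G}{\delta u^j}\,dx$ is skew-symmetric and satisfies the Jacobi identity; this holds if and only if $g^{ij}$ (with upper indices) is a flat metric and $\Gamma^j_{sk}$ are the Christoffel symbols of its Levi-Civita connection. Similarly for $\tilde A^{ij}$ with the flat metric $\tilde g^{ij}$. Two such operators are compatible if all linear combinations $\tilde A^{ij}+\lambda A^{ij}$ are Hamiltonian; in particular $\tilde g^{ij}+\lambda g^{ij}$ is then flat for every $\lambda$ for which it is nondegenerate. Diagonal coordinates: $g_{ij}$ denotes the inverse of $g^{ij}$. Compatibility implies that the Nijenhuis tensor of $r^i_j=\tilde g^{is}g_{sj}$ vanishes, and when the spectrum of $r^i_j$ is simple this gives coordinates $R^1,\dots,R^n$ in which $r^i_j=\mathrm{diag}(\eta_i)$ with $\eta_i$ a function of $R^i$ only, $g^{ij}=\mathrm{diag}(g^{ii})$ and $\tilde g^{ij}=\mathrm{diag}(g^{ii}\eta_i)$. Simple spectrum means that the $\eta_i$ are pairwise distinct at each point. $H_i=\sqrt{g_{ii}}=1/\sqrt{g^{ii}}$ are the Lamé coefficients and $\beta_{ij}$ the rotation coefficients of $g$. No summation over repeated indices is implied in formulas written in the coordinates $R^i$. $E^n$ is Euclidean $n$-space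 with scalar product $(\cdot,\cdot)$; $\vec r_\lambda$ is determined by its metric up to a Euclidean isometry. The statement is local. The sign convention for principal curvatures is the one given by $\partial_i\vec\varphi_m=k^i\partial_i\vec r_\lambda$ (no minus sign). A deformation of a hypersurface, regarded as a family of immersions in the fixed coordinates $R^i$ ($i\neq m$), is nontrivial if hypersurfaces of the family with different values of $\lambda$ are not related by a rigid motion of $E^n$ respecting these coordinates. *)

theory Defs
  imports "HOL-Analysis.Analysis"
begin

section \<open>Smooth functions of finitely many variables\<close>

definition pd :: "'n::finite \<Rightarrow> (real^'n \<Rightarrow> 'b::real_normed_vector) \<Rightarrow> real^'n \<Rightarrow> 'b" where
  "pd i f x = frechet_derivative f (at x) (axis i 1)"

text \<open>Used for open sets only: there it says that all iterated partial derivatives exist and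
  are (Frechet) differentiable, which is the usual class of infinitely differentiable functions.\<close>

definition smooth_on :: "(real^'n::finite) set \<Rightarrow> (real^'n \<Rightarrow> 'b::real_normed_vector) \<Rightarrow> bool" where
  "smooth_on S f \<longleftrightarrow> (\<forall>is. foldr pd is f differentiable_on S)"

definition diffeo_on :: "(real^'n::finite) set \<Rightarrow> (real^'n) set \<Rightarrow> (real^'n \<Rightarrow> real^'n) \<Rightarrow> bool" where
  "diffeo_on S T f \<longleftrightarrow> open S \<and> open T \<and> bij_betw f S T \<and>
     smooth_on S f \<and> smooth_on T (inv_into S f)"

definition diag_mat :: "('n::finite \<Rightarrow> real) \<Rightarrow> real^'n^'n" where
  "diag_mat d = (\<chi> i j. if i = j then d i else 0)"


section \<open>Local functionals and Hamiltonian operators of hydrodynamic type\<close>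

text \<open>A point of jet space is a pair consisting of \<open>x\<close> and the sequence
  \<open>u, u_x, u_xx, \<dots>\<close>.  The differential functions on \<open>W\<close> are the smooth functions
  of \<open>x\<close>, of \<open>u \<in> W\<close> and of finitely many derivatives of \<open>u\<close>.  The coordinate \<open>None\<close>
  is \<open>x\<close>, the coordinate \<open>Some (k, i)\<close> is the \<open>i\<close>-th component of the \<open>k\<close>-th derivative.\<close>

type_synonym 'n jet = "real \<times> (nat \<Rightarrow> real^'n)"

definition jets :: "(real^'n::finite) set \<Rightarrow> 'n jet set" where
  "jets W = {z. snd z 0 \<in> W}"

fun jet_shift :: "(nat \<times> 'n::finite) option \<Rightarrow> real \<Rightarrow> 'n jet \<Rightarrow> 'n jet" where
  "jet_shift None t (x, j) = (x + t, j)"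
| "jet_shift (Some (k, i)) t (x, j) = (x, j(k := j k + t *\<^sub>R axis i 1))"

definition jet_pd :: "(nat \<times> 'n::finite) option \<Rightarrow> ('n jet \<Rightarrow> real) \<Rightarrow> 'n jet \<Rightarrow> real" where
  "jet_pd v f z = deriv (\<lambda>t. f (jet_shift v t z)) 0"

text \<open>Continuity below refers to the product topology on jet space, which for functions
  of finite order is the ordinary notion.\<close>

definition diff_fun :: "(real^'n::finite) set \<Rightarrow> ('n jet \<Rightarrow> real) \<Rightarrow> bool" where
  "diff_fun W f \<longleftrightarrow>
     (\<exists>N. \<forall>z\<in>jets W. \<forall>z'\<in>jets W.
        fst z = fst z' \<and> (\<forall>k\<le>N. snd z k = snd z' k) \<longrightarrow> f z = f z') \<and>
     (\<forall>vs. continuous_on (jets W) (foldr jet_pd vs f) \<and>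
        (\<forall>v. \<forall>z\<in>jets W. (\<lambda>t. foldr jet_pd vs f (jet_shift v t z)) differentiable (at 0)))"

text \<open>The series in the next two definitions have only finitely many nonzero terms when
  \<open>f\<close> is a differential function.\<close>

definition total_D :: "('n::finite jet \<Rightarrow> real) \<Rightarrow> 'n jet \<Rightarrow> real" where
  "total_D f z = jet_pd None f z +
     (\<Sum>k. \<Sum>i\<in>UNIV. snd z (Suc k) $ i * jet_pd (Some (k, i)) f z)"

text \<open>The variational derivative of \<open>\<integral> f dx\<close> with respect to \<open>u\<^sup>i\<close>.\<close>

definition var_deriv :: "'n::finite \<Rightarrow> ('n jet \<Rightarrow> real) \<Rightarrow> 'n jet \<Rightarrow> real" where
  "var_deriv i f z = (\<Sum>k. (-1)^k * (total_D ^^ k) (jet_pd (Some (k, i)) f) z)"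

text \<open>A local functional \<open>\<integral> f dx\<close> is the class of its density \<open>f\<close> modulo total derivatives.\<close>

definition zero_functional :: "(real^'n::finite) set \<Rightarrow> ('n jet \<Rightarrow> real) \<Rightarrow> bool" where
  "zero_functional W f \<longleftrightarrow> (\<exists>K. diff_fun W K \<and> (\<forall>z\<in>jets W. f z = total_D K z))"

text \<open>The operator \<open>A\<^sup>i\<^sup>j = g\<^sup>i\<^sup>j(u) d/dx + b\<^sup>i\<^sup>j\<^sub>k(u) u\<^sup>k\<^sub>x\<close>; \<open>b u i j k\<close> stands for
  \<open>b\<^sup>i\<^sup>j\<^sub>k(u)\<close>.\<close>

definition hyd_op ::
  "(real^'n::finite \<Rightarrow> real^'n^'n) \<Rightarrow> (real^'n \<Rightarrow> 'n \<Rightarrow> 'n \<Rightarrow> 'n \<Rightarrow> real) \<Rightarrow>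
   ('n \<Rightarrow> 'n jet \<Rightarrow> real) \<Rightarrow> 'n \<Rightarrow> 'n jet \<Rightarrow> real" where
  "hyd_op g b q i z =
     (\<Sum>j\<in>UNIV. g (snd z 0) $ i $ j * total_D (q j) z +
        (\<Sum>k\<in>UNIV. b (snd z 0) i j k * snd z 1 $ k) * q j z)"

text \<open>Density of the bracket of the functionals with densities \<open>f\<close> and \<open>h\<close>.\<close>

definition bracket ::
  "(real^'n::finite \<Rightarrow> real^'n^'n) \<Rightarrow> (real^'n \<Rightarrow> 'n \<Rightarrow> 'n \<Rightarrow> 'n \<Rightarrow> real) \<Rightarrow>
   ('n jet \<Rightarrow> real) \<Rightarrow> ('n jet \<Rightarrow> real) \<Rightarrow> 'n jet \<Rightarrow> real" where
  "bracket g b f h z = (\<Sum>i\<in>UNIV. var_deriv i f z * hyd_op g b (\<lambda>j. var_deriv j h) i z)"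

definition hamiltonian ::
  "(real^'n::finite) set \<Rightarrow> (real^'n \<Rightarrow> real^'n^'n) \<Rightarrow>
   (real^'n \<Rightarrow> 'n \<Rightarrow> 'n \<Rightarrow> 'n \<Rightarrow> real) \<Rightarrow> bool" where
  "hamiltonian W g b \<longleftrightarrow>
     (\<forall>f h. diff_fun W f \<and> diff_fun W h \<longrightarrow>
        zero_functional W (\<lambda>z. bracket g b f h z + bracket g b h f z)) \<and>
     (\<forall>f h l. diff_fun W f \<and> diff_fun W h \<and> diff_fun W l \<longrightarrow>
        zero_functional W (\<lambda>z. bracket g b (bracket g b f h) l z
                              + bracket g b (bracket g b h l) f z
                              + bracket g b (bracket g b l f) h z))"

definition nondegenerate_hyd_op ::
  "(real^'n::finite) set \<Rightarrow> (real^'n \<Rightarrow> real^'n^'n) \<Rightarrow>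
   (real^'n \<Rightarrow> 'n \<Rightarrow> 'n \<Rightarrow> 'n \<Rightarrow> real) \<Rightarrow> bool" where
  "nondegenerate_hyd_op W g b \<longleftrightarrow>
     smooth_on W g \<and> (\<forall>i j k. smooth_on W (\<lambda>u. b u i j k)) \<and> (\<forall>u\<in>W. det (g u) \<noteq> 0)"

text \<open>Compatibility of the operators given by \<open>(g', b')\<close> and \<open>(g, b)\<close>.\<close>

definition compatible ::
  "(real^'n::finite) set \<Rightarrow> (real^'n \<Rightarrow> real^'n^'n) \<Rightarrow>
   (real^'n \<Rightarrow> 'n \<Rightarrow> 'n \<Rightarrow> 'n \<Rightarrow> real) \<Rightarrow> (real^'n \<Rightarrow> real^'n^'n) \<Rightarrow>
   (real^'n \<Rightarrow> 'n \<Rightarrow> 'n \<Rightarrow> 'n \<Rightarrow> real) \<Rightarrow> bool" where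
  "compatible W g' b' g b \<longleftrightarrow>
     (\<forall>\<mu>. hamiltonian W (\<lambda>u. g' u + \<mu> *\<^sub>R g u) (\<lambda>u i j k. b' u i j k + \<mu> * b u i j k))"

text \<open>Components, in the coordinates \<open>R\<close>, of the contravariant tensor with components \<open>g\<close>
  in the coordinates \<open>u\<close>; the result is a function of \<open>u\<close>.\<close>

definition contra_transform ::
  "(real^'n::finite \<Rightarrow> real^'n) \<Rightarrow> (real^'n \<Rightarrow> real^'n^'n) \<Rightarrow> real^'n \<Rightarrow> real^'n^'n" where
  "contra_transform R g u = jacobian R (at u) ** g u ** transpose (jacobian R (at u))"


section \<open>Flat metrics\<close>

text \<open>Here metrics are given by their covariant components.\<close>

definition christoffel ::
  "(real^'n::finite \<Rightarrow> real^'n^'n) \<Rightarrow> 'n \<Rightarrow> 'n \<Rightarrow> 'n \<Rightarrow> real^'n \<Rightarrow> real" where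
  "christoffel G k i j x =
     (\<Sum>l\<in>UNIV. matrix_inv (G x) $ k $ l *
        (pd i (\<lambda>y. G y $ j $ l) x + pd j (\<lambda>y. G y $ i $ l) x - pd l (\<lambda>y. G y $ i $ j) x)) / 2"

definition riemann ::
  "(real^'n::finite \<Rightarrow> real^'n^'n) \<Rightarrow> 'n \<Rightarrow> 'n \<Rightarrow> 'n \<Rightarrow> 'n \<Rightarrow> real^'n \<Rightarrow> real" where
  "riemann G l k i j x =
     pd i (christoffel G l j k) x - pd j (christoffel G l i k) x +
     (\<Sum>s\<in>UNIV. christoffel G l i s x * christoffel G s j k x
              - christoffel G l j s x * christoffel G s i k x)"

definition flat_metric_on :: "(real^'n::finite) set \<Rightarrow> (real^'n \<Rightarrow> real^'n^'n) \<Rightarrow> bool" where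
  "flat_metric_on S G \<longleftrightarrow> smooth_on S G \<and>
     (\<forall>x\<in>S. transpose (G x) = G x \<and> det (G x) \<noteq> 0 \<and> (\<forall>l k i j. riemann G l k i j x = 0))"


section \<open>Coordinate hypersurfaces\<close>

text \<open>In this section the hypersurface is the restriction of a map \<open>f\<close> to a level set of the
  \<open>m\<close>-th coordinate; its parameters are the coordinates other than the \<open>m\<close>-th, so that its
  tangent vectors at \<open>x\<close> are the images under the derivative of \<open>f\<close> of the parameter vectors
  \<open>\<xi>\<close> with \<open>\<xi> $ m = 0\<close>.\<close>

definition coord_slice :: "(real^'n::finite) set \<Rightarrow> 'n \<Rightarrow> real \<Rightarrow> (real^'n) set" where
  "coord_slice U m c = {x \<in> U. x $ m = c}"

definition immersed_at :: "'n::finite \<Rightarrow> (real^'n \<Rightarrow> real^'n) \<Rightarrow> real^'n \<Rightarrow> bool" where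
  "immersed_at m f x \<longleftrightarrow>
     (\<forall>\<xi>. \<xi> $ m = 0 \<and> frechet_derivative f (at x) \<xi> = 0 \<longrightarrow> \<xi> = 0)"

definition unit_normal_at ::
  "'n::finite \<Rightarrow> (real^'n \<Rightarrow> real^'n) \<Rightarrow> (real^'n \<Rightarrow> real^'n) \<Rightarrow> real^'n \<Rightarrow> bool" where
  "unit_normal_at m f N x \<longleftrightarrow> norm (N x) = 1 \<and> (\<forall>i. i \<noteq> m \<longrightarrow> N x \<bullet> pd i f x = 0)"

text \<open>\<open>S\<close> is the shape operator, written in terms of parameter vectors.  The sign convention is
  \<open>dN = df \<circ> S\<close>, without a minus sign.\<close>

definition is_shape_operator ::
  "'n::finite \<Rightarrow> (real^'n \<Rightarrow> real^'n) \<Rightarrow> (real^'n \<Rightarrow> real^'n) \<Rightarrow> real^'n \<Rightarrow>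
   (real^'n \<Rightarrow> real^'n) \<Rightarrow> bool" where
  "is_shape_operator m f N x S \<longleftrightarrow>
     (\<forall>\<xi>. \<xi> $ m = 0 \<longrightarrow> S \<xi> $ m = 0 \<and>
        frechet_derivative N (at x) \<xi> = frechet_derivative f (at x) (S \<xi>))"

text \<open>\<open>k\<close> is a principal curvature and \<open>\<xi>\<close> a corresponding principal direction.\<close>

definition is_principal ::
  "'n::finite \<Rightarrow> (real^'n \<Rightarrow> real^'n) \<Rightarrow> (real^'n \<Rightarrow> real^'n) \<Rightarrow> real^'n \<Rightarrow>
   real \<Rightarrow> real^'n \<Rightarrow> bool" where
  "is_principal m f N x k \<xi> \<longleftrightarrow> \<xi> \<noteq> 0 \<and> \<xi> $ m = 0 \<and>
     frechet_derivative N (at x) \<xi> = k *\<^sub>R frechet_derivative f (at x) \<xi>"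

definition curvature_line_coords_at ::
  "'n::finite \<Rightarrow> (real^'n \<Rightarrow> real^'n) \<Rightarrow> (real^'n \<Rightarrow> real^'n) \<Rightarrow> real^'n \<Rightarrow> bool" where
  "curvature_line_coords_at m f N x \<longleftrightarrow>
     (\<forall>i j. i \<noteq> m \<and> j \<noteq> m \<and> i \<noteq> j \<longrightarrow> pd i f x \<bullet> pd j f x = 0) \<and>
     (\<forall>i. i \<noteq> m \<longrightarrow> (\<exists>k. is_principal m f N x k (axis i 1)))"

definition rigid_motion :: "(real^'n::finite \<Rightarrow> real^'n) \<Rightarrow> bool" where
  "rigid_motion T \<longleftrightarrow> (\<exists>Q a. orthogonal_transformation Q \<and> (\<forall>p. T p = Q p + a))"

text \<open>Nontriviality of the family of the immersions \<open>\<rho> \<mu>\<close> restricted to \<open>D\<close>.\<close>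

definition nontrivial_deformation ::
  "real set \<Rightarrow> (real^'n::finite) set \<Rightarrow> (real \<Rightarrow> real^'n \<Rightarrow> real^'n) \<Rightarrow> bool" where
  "nontrivial_deformation \<Lambda> D \<rho> \<longleftrightarrow>
     (\<forall>\<mu>\<in>\<Lambda>. \<forall>\<nu>\<in>\<Lambda>. \<mu> \<noteq> \<nu> \<longrightarrow>
        \<not> (\<exists>T. rigid_motion T \<and> (\<forall>x\<in>D. \<rho> \<nu> x = T (\<rho> \<mu> x))))"


section \<open>The family of orthogonal coordinate systems\<close>

text \<open>The covariant components of the pencil metric in the coordinates \<open>R\<^sup>i\<close>.\<close>

definition pencil_metric ::
  "('n::finite \<Rightarrow> real^'n \<Rightarrow> real) \<Rightarrow> ('n \<Rightarrow> real \<Rightarrow> real) \<Rightarrow> real \<Rightarrow> real^'n \<Rightarrow> real^'n^'n" where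
  "pencil_metric H \<eta> \<mu> x = diag_mat (\<lambda>i. (H i x)\<^sup>2 / (\<mu> + \<eta> i (x $ i)))"

definition rot_coeff :: "('n::finite \<Rightarrow> real^'n \<Rightarrow> real) \<Rightarrow> 'n \<Rightarrow> 'n \<Rightarrow> real^'n \<Rightarrow> real" where
  "rot_coeff H i j x = pd i (H j) x / H i x"

text \<open>\<open>r\<close> has the metric \<open>G\<close> as its first fundamental form.\<close>

definition realizes_metric ::
  "(real^'n::finite) set \<Rightarrow> (real^'n \<Rightarrow> real^'n^'n) \<Rightarrow> (real^'n \<Rightarrow> real^'n) \<Rightarrow> bool" where
  "realizes_metric U G r \<longleftrightarrow> smooth_on U r \<and>
     (\<forall>x\<in>U. \<forall>i j. pd i r x \<bullet> pd j r x = G x $ i $ j)"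

definition unit_tangent ::
  "('n::finite \<Rightarrow> real^'n \<Rightarrow> real) \<Rightarrow> ('n \<Rightarrow> real \<Rightarrow> real) \<Rightarrow> (real \<Rightarrow> real^'n \<Rightarrow> real^'n) \<Rightarrow>
   real \<Rightarrow> 'n \<Rightarrow> real^'n \<Rightarrow> real^'n" where
  "unit_tangent H \<eta> r \<mu> i x = (sqrt (\<mu> + \<eta> i (x $ i)) / H i x) *\<^sub>R pd i (r \<mu>) x"

end

theory Submission
  imports Defs
begin

text \<open>The statement has two halves: the metrics of the pencil are flat, and Euclidean coordinate
  systems with these metrics have coordinate hypersurfaces with proportional shape operators.

  \<^bold>\<open>Flatness.\<close> For each \<open>\<mu>\<close> the operator with leading coefficient \<open>G = g' + \<mu> g\<close> is Hamiltonian, so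
  this half is one direction of the Dubrovin-Novikov theorem.  It needs no other functionals than
  \<open>\<integral> x\<^sup>n p(u) dx\<close>.  Write \<open>g(p,q)\<close> for the pairing of differentials by \<open>G\<close>; the operator applied to
  \<open>dq\<close> and paired with \<open>dp\<close> is a one-form \<open>\<beta>(p,q)\<close>, contracted with \<open>u\<^sub>x\<close>.  The brackets of such functionals
  are explicit densities of first order (\<open>bracket_order0\<close>, \<open>double_bracket_order0\<close>).  A density of first
  order that is a total derivative has a primitive depending on \<open>x\<close> and \<open>u\<close> only (\<open>primitive_order0\<close>); hence
  it is affine in \<open>u\<^sub>x\<close>, and it vanishes identically as soon as it vanishes for \<open>u\<^sub>x = 0\<close> and for \<open>x = 0\<close>
  (\<open>zero_functional_vanishes\<close>).  With this, skew-symmetry for \<open>\<integral> p\<close> and \<open>\<integral> x q\<close> yields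
  \<open>dg(p,q) = \<beta>(p,q) + \<beta>(q,p)\<close> (\<open>pd_pairing\<close>), which says that the connection is metric, and the Jacobi
  identity for \<open>\<integral> p\<close>, \<open>\<integral> q\<close>, \<open>\<integral> x\<^sup>2 s\<close> yields one pointwise identity (\<open>jacobi_identity\<close>).  This identity is
  not a derivation in \<open>p\<close>; its defect, obtained by inserting \<open>p\<^sup>2\<close>, is the torsion
  (\<open>torsion_free\<close>), and for coordinate functions the identity itself is the vanishing of the curvature.
  As \<open>p\<close>, \<open>q\<close>, \<open>s\<close> are arbitrary, the coordinate functions of any coordinate system may be inserted.  So flatness
  is obtained in the coordinates \<open>u\<close> and in the coordinates \<open>R\<close> by one argument (\<open>flat_in_coordinates\<close>),
  and no transformation law of the curvature tensor enters.

  \<^bold>\<open>Hypersurfaces.\<close> For an orthogonal coordinate system with Lame coefficients \<open>h\<^sub>i\<close> and unit tangents \<open>\<phi>\<^sub>i\<close>,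
  one has \<open>\<partial>\<^sub>i\<phi>\<^sub>m = (\<partial>\<^sub>mh\<^sub>i / (h\<^sub>i h\<^sub>m)) \<partial>\<^sub>ir\<close> for \<open>i \<noteq> m\<close> (\<open>weingarten\<close>).  Here \<open>h\<^sub>i = H\<^sub>i / sqrt (\<mu> + \<eta>\<^sub>i)\<close>, and
  since \<open>\<eta>\<^sub>i\<close> depends on the \<open>i\<close>-th coordinate only, \<open>\<partial>\<^sub>m\<close> does not see the root in \<open>h\<^sub>i\<close>; it cancels and only
  the factor \<open>sqrt (\<mu> + \<eta>\<^sub>m)\<close> from \<open>h\<^sub>m\<close> survives.  That factor is constant on the hypersurface, so the homothety
  by it makes the shape operator independent of \<open>\<mu>\<close>.  The homothety turns the \<open>i\<close>-th coefficient of the first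
  fundamental form into \<open>H\<^sub>i\<^sup>2 (\<mu> + \<eta>\<^sub>m) / (\<mu> + \<eta>\<^sub>i)\<close>, which is injective in \<open>\<mu>\<close> because \<open>\<eta>\<^sub>i \<noteq> \<eta>\<^sub>m\<close>; so the
  deformation is nontrivial (\<open>rigidly_equivalent_imp_eq\<close>).\<close>

section \<open>Partial derivatives and smooth functions\<close>

lemma pd_eqI: "(f has_derivative f') (at x) \<Longrightarrow> pd i f x = f' (axis i 1)"
  unfolding pd_def by (metis frechet_derivative_at)

lemma pd_cong:
  assumes "open S" "x \<in> S" "\<And>y. y \<in> S \<Longrightarrow> f y = g y"
  shows "pd i f x = pd i g x"
proof -
  have "(f has_derivative D) (at x) \<longleftrightarrow> (g has_derivative D) (at x)" for D
    by (auto elim!: has_derivative_transform_within_open[OF _ assms(1,2)] simp: assms(3))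
  then show ?thesis unfolding pd_def frechet_derivative_def by simp
qed

lemma differentiable_cong_open:
  assumes "open S" "\<And>y. y \<in> S \<Longrightarrow> f y = g y"
  shows "f differentiable_on S \<longleftrightarrow> g differentiable_on S"
  using assms unfolding differentiable_on_def
  by (auto elim!: differentiable_transform_within[OF _ zero_less_one])

lemma frechet_expand:
  fixes f :: "real^'n::finite \<Rightarrow> 'b::real_normed_vector"
  assumes "f differentiable (at x)"
  shows "frechet_derivative f (at x) h = (\<Sum>i\<in>UNIV. h $ i *\<^sub>R pd i f x)"
proof -
  have lin: "linear (frechet_derivative f (at x))"
    by (rule linear_frechet_derivative[OF assms])
  have "h = (\<Sum>i\<in>UNIV. h $ i *\<^sub>R axis i 1)"
    by (simp add: vec_eq_iff axis_def if_distrib cong: if_cong)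
  then have "frechet_derivative f (at x) h = frechet_derivative f (at x) (\<Sum>i\<in>UNIV. h $ i *\<^sub>R axis i 1)"
    by simp
  also have "\<dots> = (\<Sum>i\<in>UNIV. h $ i *\<^sub>R pd i f x)"
    by (simp add: linear_sum[OF lin] linear_scale[OF lin] pd_def)
  finally show ?thesis .
qed

lemma has_derivative_pd:
  fixes f :: "real^'n::finite \<Rightarrow> 'b::real_normed_vector"
  assumes "f differentiable (at x)"
  shows "(f has_derivative (\<lambda>h. \<Sum>i\<in>UNIV. h $ i *\<^sub>R pd i f x)) (at x)"
proof -
  have "frechet_derivative f (at x) = (\<lambda>h. \<Sum>i\<in>UNIV. h $ i *\<^sub>R pd i f x)"
    using frechet_expand[OF assms] by (rule ext)
  then show ?thesis using assms frechet_derivative_works by metis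
qed

lemma sum_axis [simp]: "(\<Sum>j\<in>UNIV. axis i (1::real) $ j *\<^sub>R v j) = (v (i::'n::finite) :: 'b::real_normed_vector)"
proof -
  have "(\<Sum>j\<in>UNIV. axis i (1::real) $ j *\<^sub>R v j) = (\<Sum>j\<in>UNIV. if j = i then v j else 0)"
    by (intro sum.cong) (auto simp: axis_def)
  then show ?thesis by simp
qed

lemma sum_axis_real [simp]: "(\<Sum>j\<in>UNIV. axis i (1::real) $ j * v j) = v (i::'n::finite)"
  using sum_axis[of i v] by simp

lemma smooth_on_differentiable:
  assumes "smooth_on S f" "open S" "x \<in> S"
  shows "f differentiable (at x)"
  using assms unfolding smooth_on_def
  by (auto simp: differentiable_on_eq_differentiable_at dest: spec[where x = "[]"])

lemma smooth_on_pd: "smooth_on S f \<Longrightarrow> smooth_on S (pd i f)"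
  unfolding smooth_on_def
proof
  fix "is" assume *: "\<forall>is. foldr pd is f differentiable_on S"
  have "foldr pd is (pd i f) = foldr pd (is @ [i]) f" by simp
  then show "foldr pd is (pd i f) differentiable_on S" using * by metis
qed

text \<open>Smoothness can be certified without writing down higher derivatives: it is enough that a function
  belongs to some class of differentiable functions that is stable under partial derivatives.\<close>

lemma smooth_on_class:
  fixes f :: "real^'n::finite \<Rightarrow> 'b::real_normed_vector"
  assumes "open S"
    and "\<And>f x. f \<in> F \<Longrightarrow> x \<in> S \<Longrightarrow> f differentiable (at x)"
    and "\<And>f i. f \<in> F \<Longrightarrow> \<exists>h\<in>F. \<forall>x\<in>S. pd i f x = h x"
    and "f \<in> F"
  shows "smooth_on S f"
proof -
  have "\<exists>h\<in>F. \<forall>x\<in>S. foldr pd is f x = h x" for "is"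
  proof (induction "is")
    case Nil
    then show ?case using assms by auto
  next
    case (Cons i "is")
    then obtain h where h: "h \<in> F" "\<forall>x\<in>S. foldr pd is f x = h x" by auto
    obtain k where k: "k \<in> F" "\<forall>x\<in>S. pd i h x = k x" using assms(3)[OF h(1)] by auto
    have "pd i (foldr pd is f) x = pd i h x" if "x \<in> S" for x
      using pd_cong[OF assms(1) that, of "foldr pd is f" h] h(2) by blast
    then show ?case using k by auto
  qed
  moreover have "h differentiable_on S" if "h \<in> F" for h
    using assms(1,2) that by (simp add: differentiable_on_eq_differentiable_at)
  ultimately show ?thesis unfolding smooth_on_def
    using differentiable_cong_open[OF assms(1)] by blast
qed

lemma smooth_on_cong:
  assumes "open S" "\<And>x. x \<in> S \<Longrightarrow> f x = g x" "smooth_on S f"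
  shows "smooth_on S g"
proof -
  have "\<forall>x\<in>S. foldr pd is f x = foldr pd is g x" for "is"
    by (induction "is") (auto simp: assms intro!: pd_cong[OF assms(1)])
  then show ?thesis using assms(3) differentiable_cong_open[OF assms(1)]
    unfolding smooth_on_def by blast
qed

lemma pd_const [simp]: "pd i (\<lambda>x. c) x = 0"
  by (rule pd_eqI[OF has_derivative_const])

lemma smooth_on_const [simp]:
  fixes c :: "'b::real_normed_vector" and S :: "(real^'n::finite) set"
  assumes "open S" shows "smooth_on S (\<lambda>x. c)"
proof (rule smooth_on_class[OF assms, where F = "{f. \<exists>c. f = (\<lambda>x. c)}"])
  fix f :: "real^'n \<Rightarrow> 'b" and i assume "f \<in> {f. \<exists>c. f = (\<lambda>x. c)}"
  then have "\<forall>x\<in>S. pd i f x = (\<lambda>x. 0) x" by auto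
  then show "\<exists>h\<in>{f. \<exists>c. f = (\<lambda>x. c)}. \<forall>x\<in>S. pd i f x = h x"
    by (intro bexI[where x = "\<lambda>x. 0"]) auto
next
  fix f :: "real^'n \<Rightarrow> 'b" and x assume "f \<in> {f. \<exists>c. f = (\<lambda>x. c)}"
  then show "f differentiable (at x)" by (elim CollectE exE) simp
next
  show "(\<lambda>x. c) \<in> {f. \<exists>c. f = (\<lambda>x. c)}" by (intro CollectI exI) (rule refl)
qed

lemma pd_linear:
  assumes "bounded_linear L" "f differentiable (at x)"
  shows "pd i (\<lambda>y. L (f y)) x = L (pd i f x)"
    "(\<lambda>y. L (f y)) differentiable (at x)"
proof -
  have d: "((\<lambda>y. L (f y)) has_derivative (\<lambda>h. L (frechet_derivative f (at x) h))) (at x)"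
    by (rule bounded_linear.has_derivative[OF assms(1) assms(2)[unfolded frechet_derivative_works]])
  show "pd i (\<lambda>y. L (f y)) x = L (pd i f x)"
    using pd_eqI[OF d] by (simp add: pd_def)
  show "(\<lambda>y. L (f y)) differentiable (at x)" by (rule differentiableI[OF d])
qed

lemma smooth_on_linear:
  assumes "open S" "bounded_linear L" "smooth_on S f"
  shows "smooth_on S (\<lambda>x. L (f x))"
proof (rule smooth_on_class[OF assms(1), where F = "(\<lambda>f x. L (f x)) ` {f. smooth_on S f}"])
  fix h i assume "h \<in> (\<lambda>f x. L (f x)) ` {f. smooth_on S f}"
  then obtain f where "h = (\<lambda>x. L (f x))" "smooth_on S f" by auto
  then have "\<forall>x\<in>S. pd i h x = L (pd i f x)" "smooth_on S (pd i f)"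
    by (simp_all add: smooth_on_pd smooth_on_differentiable[OF _ assms(1)] pd_linear(1)[OF assms(2)])
  then show "\<exists>k\<in>(\<lambda>f x. L (f x)) ` {f. smooth_on S f}. \<forall>x\<in>S. pd i h x = k x"
    by (intro bexI[where x = "\<lambda>x. L (pd i f x)"]) auto
next
  fix h x assume "h \<in> (\<lambda>f x. L (f x)) ` {f. smooth_on S f}" "x \<in> S"
  then show "h differentiable (at x)"
    using pd_linear(2)[OF assms(2) smooth_on_differentiable[OF _ assms(1)]] by blast
qed (use assms(3) in blast)

lemma smooth_on_nth: "open S \<Longrightarrow> smooth_on S f \<Longrightarrow> smooth_on S (\<lambda>x. f x $ i)"
  by (rule smooth_on_linear[OF _ bounded_linear_vec_nth])

lemma pd_nth: "f differentiable (at x) \<Longrightarrow> pd i (\<lambda>y. f y $ j) x = pd i f x $ j"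
  by (rule pd_linear[OF bounded_linear_vec_nth])

lemma pd_add:
  assumes "f differentiable (at x)" "g differentiable (at x)"
  shows "pd i (\<lambda>y. f y + g y) x = pd i f x + pd i g x"
  using pd_eqI[OF has_derivative_add[OF has_derivative_pd has_derivative_pd, OF assms]]
  by simp

lemma pd_mult:
  fixes f g :: "real^'n::finite \<Rightarrow> real"
  assumes "f differentiable (at x)" "g differentiable (at x)"
  shows "pd i (\<lambda>y. f y * g y) x = pd i f x * g x + f x * pd i g x"
  using pd_eqI[OF has_derivative_mult[OF has_derivative_pd has_derivative_pd, OF assms]]
  by simp

lemma pd_inner:
  assumes "f differentiable (at x)" "g differentiable (at x)"
  shows "pd i (\<lambda>y. f y \<bullet> g y) x = pd i f x \<bullet> g x + f x \<bullet> pd i g x"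
  using pd_eqI[OF has_derivative_inner[OF has_derivative_pd has_derivative_pd, OF assms]]
  by simp

lemma pd_cmult:
  fixes f :: "real^'n::finite \<Rightarrow> real"
  assumes "f differentiable (at x)"
  shows "pd i (\<lambda>y. c * f y) x = c * pd i f x"
  using pd_mult[of "\<lambda>_. c" x f] assms by simp

lemma pd_sum:
  assumes "\<And>a. a \<in> A \<Longrightarrow> f a differentiable (at x)"
  shows "pd i (\<lambda>y. \<Sum>a\<in>A. f a y) x = (\<Sum>a\<in>A. pd i (f a) x)"
  using pd_eqI[OF has_derivative_sum[of A f, OF has_derivative_pd], OF assms]
  by simp

lemma smooth_on_add:
  assumes "open S" "smooth_on S f" "smooth_on S g"
  shows "smooth_on S (\<lambda>x. f x + g x)"
proof (rule smooth_on_class[OF assms(1), where F = "{(\<lambda>x. f x + g x) |f g. smooth_on S f \<and> smooth_on S g}"])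
  fix h i assume "h \<in> {(\<lambda>x. f x + g x) |f g. smooth_on S f \<and> smooth_on S g}"
  then obtain f g where "h = (\<lambda>x. f x + g x)" and s: "smooth_on S f" "smooth_on S g" by auto
  then show "\<exists>h'\<in>{(\<lambda>x. f x + g x) |f g. smooth_on S f \<and> smooth_on S g}. \<forall>x\<in>S. pd i h x = h' x"
    using s assms(1) smooth_on_pd[of S f i] smooth_on_pd[of S g i]
    by (intro bexI[where x = "\<lambda>x. pd i f x + pd i g x"])
      (auto simp: pd_add smooth_on_differentiable)
next
  fix h x assume "h \<in> {(\<lambda>x. f x + g x) |f g. smooth_on S f \<and> smooth_on S g}" and x: "x \<in> S"
  then obtain f g where h: "h = (\<lambda>x. f x + g x)" "smooth_on S f" "smooth_on S g" by auto
  show "h differentiable (at x)"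
    unfolding h(1) using h(2,3)[THEN smooth_on_differentiable, OF assms(1) x]
    by (rule differentiable_add)
qed (use assms in auto)

lemma smooth_on_sum:
  assumes "open S" "\<And>a. a \<in> A \<Longrightarrow> smooth_on S (f a)"
  shows "smooth_on S (\<lambda>x. \<Sum>a\<in>A. f a x)"
  using assms(2)
  by (induction A rule: infinite_finite_induct) (auto intro: smooth_on_add assms(1) simp: assms(1))

text \<open>The class to which the previous criterion is applied for products and reciprocals: the derivative of
  \<open>1/f\<close> involves \<open>1/f\<close> again, so the extra generators \<open>X\<close> are those functions whose derivatives are
  polynomials in themselves with smooth coefficients.\<close>

inductive_set smooth_alg :: "(real^'n::finite) set \<Rightarrow> (real^'n \<Rightarrow> real) set \<Rightarrow> (real^'n \<Rightarrow> real) set"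
  for S X where
  smooth: "smooth_on S f \<Longrightarrow> f \<in> smooth_alg S X"
| gen: "f \<in> X \<Longrightarrow> f \<in> smooth_alg S X"
| add: "f \<in> smooth_alg S X \<Longrightarrow> g \<in> smooth_alg S X \<Longrightarrow> (\<lambda>x. f x + g x) \<in> smooth_alg S X"
| mult: "f \<in> smooth_alg S X \<Longrightarrow> g \<in> smooth_alg S X \<Longrightarrow> (\<lambda>x. f x * g x) \<in> smooth_alg S X"

lemma smooth_on_alg:
  assumes S: "open S" and dX: "\<And>f x. f \<in> X \<Longrightarrow> x \<in> S \<Longrightarrow> f differentiable (at x)"
    and pX: "\<And>f i. f \<in> X \<Longrightarrow> \<exists>h\<in>smooth_alg S X. \<forall>x\<in>S. pd i f x = h x"
    and f: "f \<in> smooth_alg S X"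
  shows "smooth_on S f"
proof -
  have d: "f \<in> smooth_alg S X \<Longrightarrow> \<forall>x\<in>S. f differentiable (at x)" for f
    by (induction rule: smooth_alg.induct) (auto simp: dX smooth_on_differentiable S)
  have "f \<in> smooth_alg S X \<Longrightarrow> \<exists>h\<in>smooth_alg S X. \<forall>x\<in>S. pd i f x = h x" for f i
  proof (induction rule: smooth_alg.induct)
    case (smooth f)
    then show ?case using smooth_on_pd smooth_alg.smooth by blast
  next
    case (gen f)
    then show ?case using pX by blast
  next
    case (add f g)
    then obtain f' g' where
      fg: "f' \<in> smooth_alg S X" "g' \<in> smooth_alg S X" "\<forall>x\<in>S. pd i f x = f' x" "\<forall>x\<in>S. pd i g x = g' x"
      by auto
    show ?case using add fg d
      by (intro bexI[where x = "\<lambda>x. f' x + g' x"]) (auto simp: pd_add intro: smooth_alg.intros)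
  next
    case (mult f g)
    then obtain f' g' where
      fg: "f' \<in> smooth_alg S X" "g' \<in> smooth_alg S X" "\<forall>x\<in>S. pd i f x = f' x" "\<forall>x\<in>S. pd i g x = g' x"
      by auto
    show ?case using mult fg d
      by (intro bexI[where x = "\<lambda>x. f' x * g x + f x * g' x"]) (auto simp: pd_mult intro: smooth_alg.intros)
  qed
  then show ?thesis using smooth_on_class[OF S, where F = "smooth_alg S X"] d f by blast
qed

lemma smooth_on_mult:
  assumes "open S" "smooth_on S f" "smooth_on S g"
  shows "smooth_on S (\<lambda>x. f x * g x :: real)"
  by (rule smooth_on_alg[OF assms(1), where X = "{}"]) (auto intro: smooth_alg.intros assms)

lemma smooth_on_prod:
  assumes "open S" "\<And>a. a \<in> A \<Longrightarrow> smooth_on S (f a)"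
  shows "smooth_on S (\<lambda>x. \<Prod>a\<in>A. f a x :: real)"
  using assms(2)
  by (induction A rule: infinite_finite_induct) (auto intro: smooth_on_mult assms(1) simp: assms(1))

lemma pd_inverse:
  fixes f :: "real^'n::finite \<Rightarrow> real"
  assumes "f differentiable (at x)" "f x \<noteq> 0"
  shows "pd i (\<lambda>y. inverse (f y)) x = - (pd i f x * inverse (f x) * inverse (f x))"
  using pd_eqI[OF Deriv.has_derivative_inverse[OF assms(2) has_derivative_pd[OF assms(1)]]]
  by simp

lemma smooth_on_inverse:
  assumes "open S" "smooth_on S f" "\<And>x. x \<in> S \<Longrightarrow> f x \<noteq> 0"
  shows "smooth_on S (\<lambda>x. inverse (f x) :: real)"
proof (rule smooth_on_alg[OF assms(1), where X = "{\<lambda>x. inverse (f x)}"])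
  fix h i assume "h \<in> {\<lambda>x. inverse (f x)}"
  then have h: "h = (\<lambda>x. inverse (f x))" by simp
  show "\<exists>k\<in>smooth_alg S {\<lambda>x. inverse (f x)}. \<forall>x\<in>S. pd i h x = k x"
    unfolding h
  proof (intro bexI ballI)
    show "pd i (\<lambda>x. inverse (f x)) x = - 1 * pd i f x * inverse (f x) * inverse (f x)" if "x \<in> S" for x
      using that assms by (simp add: pd_inverse smooth_on_differentiable)
    show "(\<lambda>x. - 1 * pd i f x * inverse (f x) * inverse (f x)) \<in> smooth_alg S {\<lambda>x. inverse (f x)}"
      by (intro smooth_alg.mult smooth_alg.smooth smooth_on_mult smooth_on_const smooth_on_pd assms
          smooth_alg.gen) auto
  qed
next
  fix h x assume h: "h \<in> {\<lambda>x. inverse (f x)}" and x: "x \<in> S"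
  then show "h differentiable (at x)"
    using smooth_on_differentiable[OF assms(2,1) x] assms(3)[OF x]
    by (auto intro: differentiable_inverse)
qed (auto intro: smooth_alg.gen)

lemma smooth_on_divide:
  assumes "open S" "smooth_on S f" "smooth_on S g" "\<And>x. x \<in> S \<Longrightarrow> g x \<noteq> 0"
  shows "smooth_on S (\<lambda>x. f x / g x :: real)"
  unfolding divide_inverse by (intro smooth_on_mult smooth_on_inverse assms)

lemma bounded_linear_axis: "bounded_linear (axis i :: 'b::euclidean_space \<Rightarrow> 'b^'m::finite)"
  unfolding linear_conv_bounded_linear[symmetric]
  by (rule linearI) (auto simp: axis_def vec_eq_iff)

lemma sum_axis_nth: "(\<Sum>i\<in>UNIV. axis i (v $ i)) = (v :: 'b::euclidean_space^'m::finite)"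
  by (simp add: vec_eq_iff axis_def if_distrib cong: if_cong)

lemma smooth_on_vecI:
  fixes f :: "real^'n::finite \<Rightarrow> 'b::euclidean_space ^'m::finite"
  assumes "open S" "\<And>i. smooth_on S (\<lambda>x. f x $ i)"
  shows "smooth_on S f"
proof -
  have "smooth_on S (\<lambda>x. \<Sum>i\<in>UNIV. axis i (f x $ i))"
    by (intro smooth_on_sum assms(1) smooth_on_linear[OF assms(1) bounded_linear_axis] assms(2))
  then show ?thesis by (simp add: sum_axis_nth)
qed

lemma differentiable_vecI:
  fixes f :: "real^'n::finite \<Rightarrow> 'b::euclidean_space ^'m::finite"
  assumes "\<And>i. (\<lambda>x. f x $ i) differentiable (at x)"
  shows "f differentiable (at x)"
proof -
  have "(\<lambda>x. \<Sum>i\<in>UNIV. axis i (f x $ i)) differentiable (at x)"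
    by (intro differentiable_sum finite ballI pd_linear(2)[OF bounded_linear_axis] assms)
  then show ?thesis by (simp add: sum_axis_nth)
qed

lemma smooth_on_det:
  assumes "open S" "\<And>i j. smooth_on S (\<lambda>x. M x $ i $ j)"
  shows "smooth_on S (\<lambda>x. det (M x :: real^'n^'n))"
  unfolding det_def
  by (intro smooth_on_sum smooth_on_mult smooth_on_prod smooth_on_const assms)

lemma matrix_inv_unique:
  assumes "A ** B = mat 1" "B ** A = mat (1::real)"
  shows "matrix_inv A = B"
proof -
  have "A ** matrix_inv A = mat 1 \<and> matrix_inv A ** A = mat 1"
    unfolding matrix_inv_def by (rule someI[of _ B]) (use assms in auto)
  then show ?thesis using assms by (metis matrix_mul_assoc matrix_mul_lid matrix_mul_rid)
qed

lemma matrix_inv_inverse: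
  fixes A :: "real^'n^'n"
  assumes "det A \<noteq> 0"
  shows "A ** matrix_inv A = mat 1" "matrix_inv A ** A = mat 1"
proof -
  obtain B where "A ** B = mat 1" "B ** A = mat 1"
    using assms invertible_det_nz invertible_def by metis
  then show "A ** matrix_inv A = mat 1" "matrix_inv A ** A = mat 1"
    using matrix_inv_unique by metis+
qed

lemma matrix_inv_cramer:
  fixes A :: "real^'n^'n"
  assumes "det A \<noteq> 0"
  shows "matrix_inv A $ k $ l = det (\<chi> i j. if j = k then axis l 1 $ i else A $ i $ j) / det A"
proof -
  have "A *v (matrix_inv A *v axis l 1) = axis l 1"
    using matrix_inv_inverse(1)[OF assms] by (simp add: matrix_vector_mul_assoc)
  then have "matrix_inv A *v axis l 1 = (\<chi> k. det (\<chi> i j. if j = k then axis l 1 $ i else A $ i $ j) / det A)"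
    using cramer[OF assms] by blast
  then have "(matrix_inv A *v axis l 1) $ k = det (\<chi> i j. if j = k then axis l 1 $ i else A $ i $ j) / det A"
    by simp
  then show ?thesis
    by (simp add: matrix_vector_mult_basis column_def)
qed

text \<open>By Cramer's rule the entries of the inverse are quotients of determinants, hence rational
  in the entries.\<close>

lemma smooth_on_matrix_inv:
  fixes M :: "real^'n::finite \<Rightarrow> real^'n^'n"
  assumes S: "open S" and M: "smooth_on S M" and nz: "\<And>x. x \<in> S \<Longrightarrow> det (M x) \<noteq> 0"
  shows "smooth_on S (\<lambda>x. matrix_inv (M x))"
proof (intro smooth_on_vecI[OF S])
  fix k l
  have e: "smooth_on S (\<lambda>x. M x $ i $ j)" for i j
    by (intro smooth_on_nth S M)
  have "smooth_on S (\<lambda>x. (\<chi> i j. if j = k then axis l 1 $ i else M x $ i $ j) $ i $ j)" for i j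
    by (cases "j = k") (use e S in auto)
  then have "smooth_on S (\<lambda>x. det (\<chi> i j. if j = k then axis l 1 $ i else M x $ i $ j) / det (M x))"
    by (intro smooth_on_divide smooth_on_det S nz e)
  then show "smooth_on S (\<lambda>x. matrix_inv (M x) $ k $ l)"
    by (rule smooth_on_cong[OF S, rotated]) (simp add: nz matrix_inv_cramer)
qed

lemma pd_line:
  assumes "p differentiable (at u)"
  shows "((\<lambda>t. p (u + t *\<^sub>R axis i 1)) has_vector_derivative pd i p u) (at 0)"
proof -
  have 1: "((\<lambda>t::real. u + t *\<^sub>R axis i 1) has_derivative (\<lambda>t. t *\<^sub>R axis i 1)) (at 0)"
    by (auto intro!: derivative_eq_intros)
  have "(p has_derivative (\<lambda>h. \<Sum>j\<in>UNIV. h $ j *\<^sub>R pd j p u)) (at (u + 0 *\<^sub>R axis i 1))"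
    using has_derivative_pd[OF assms] by simp
  from has_derivative_compose[OF 1 this] show ?thesis
    unfolding has_vector_derivative_def
    by (simp only: vector_scaleR_component real_scaleR_def scaleR_scaleR[symmetric]
        scaleR_sum_right[symmetric] sum_axis)
qed

lemma pd_line_real:
  fixes p :: "real^'n::finite \<Rightarrow> real"
  assumes "p differentiable (at u)"
  shows "((\<lambda>t. p (u + t *\<^sub>R axis i 1)) has_real_derivative pd i p u) (at 0)"
  using pd_line[OF assms] by (simp add: has_real_derivative_iff_has_vector_derivative)

lemma eventually_line_in:
  fixes u :: "real^'n::finite"
  assumes "open W" "u \<in> W"
  shows "\<forall>\<^sub>F t in nhds (0::real). u + t *\<^sub>R axis i 1 \<in> W"
proof -
  have "((\<lambda>t. u + t *\<^sub>R axis i 1) \<longlongrightarrow> u + 0 *\<^sub>R axis i 1) (nhds (0::real))"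
    by (intro tendsto_intros filterlim_ident)
  then show ?thesis by (rule topological_tendstoD) (use assms in auto)
qed

section \<open>Symmetry of second derivatives and the chain rule\<close>

lemma pd_line_at:
  fixes f :: "real^'n::finite \<Rightarrow> real"
  assumes "f differentiable (at (c + t *\<^sub>R axis i 1))"
  shows "((\<lambda>s. f (c + s *\<^sub>R axis i 1)) has_real_derivative pd i f (c + t *\<^sub>R axis i 1)) (at t)"
proof -
  have "((\<lambda>s. f (c + (s + t) *\<^sub>R axis i 1)) has_real_derivative pd i f (c + t *\<^sub>R axis i 1)) (at 0)"
    using pd_line_real[OF assms, of i] by (simp add: scaleR_add_left algebra_simps)
  then show ?thesis
    using DERIV_at_within_shift[of "\<lambda>s. f (c + s *\<^sub>R axis i 1)" "pd i f (c + t *\<^sub>R axis i 1)" t 0 UNIV]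
    by (simp add: add.commute)
qed

text \<open>The mean value theorem, applied in each of the two directions, represents the mixed second
  difference over a small square by a mixed derivative at a nearby point.  The left-hand side is symmetric
  in \<open>i\<close> and \<open>j\<close>, which is the source of the symmetry of second derivatives.\<close>

lemma second_difference:
  fixes f :: "real^'n::finite \<Rightarrow> real"
  assumes S: "open S" and f: "smooth_on S f" and ball: "ball x r \<subseteq> S" and h: "0 < h" "2 * h < r"
  shows "\<exists>y\<in>ball x r. f (x + h *\<^sub>R axis i 1 + h *\<^sub>R axis j 1) - f (x + h *\<^sub>R axis i 1)
      - f (x + h *\<^sub>R axis j 1) + f x = h * h * pd j (pd i f) y"
proof -
  have pt: "x + s *\<^sub>R axis i 1 + t *\<^sub>R axis j 1 \<in> ball x r" if "0 \<le> s" "s \<le> h" "0 \<le> t" "t \<le> h" for s t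
  proof -
    have "norm (s *\<^sub>R axis i (1::real) + t *\<^sub>R axis j 1 :: real^'n) \<le> s + t"
      using norm_triangle_ineq[of "s *\<^sub>R axis i (1::real)" "t *\<^sub>R axis j 1 :: real^'n"] that by simp
    moreover have "dist x (x + s *\<^sub>R axis i 1 + t *\<^sub>R axis j 1) = norm (s *\<^sub>R axis i (1::real) + t *\<^sub>R axis j 1 :: real^'n)"
      by (simp add: dist_norm norm_minus_commute algebra_simps)
    ultimately show ?thesis using that h by simp
  qed
  have d: "f differentiable (at y)" "pd i f differentiable (at y)" if "y \<in> ball x r" for y
    using smooth_on_differentiable[OF f S] smooth_on_differentiable[OF smooth_on_pd[OF f] S] that ball by auto
  define \<phi> where "\<phi> s = f (x + h *\<^sub>R axis j 1 + s *\<^sub>R axis i 1) - f (x + s *\<^sub>R axis i 1)" for s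
  have "\<exists>\<xi>. 0 < \<xi> \<and> \<xi> < h \<and> \<phi> h - \<phi> 0 = (h - 0) * (pd i f (x + h *\<^sub>R axis j 1 + \<xi> *\<^sub>R axis i 1) - pd i f (x + \<xi> *\<^sub>R axis i 1))"
  proof (rule MVT2[OF h(1)])
    fix s assume s: "0 \<le> s" "s \<le> h"
    have "x + h *\<^sub>R axis j 1 + s *\<^sub>R axis i 1 \<in> ball x r" "x + s *\<^sub>R axis i 1 \<in> ball x r"
      using pt[of s h] pt[of s 0] s h by (simp_all add: algebra_simps)
    then show "(\<phi> has_real_derivative pd i f (x + h *\<^sub>R axis j 1 + s *\<^sub>R axis i 1) - pd i f (x + s *\<^sub>R axis i 1)) (at s)"
      unfolding \<phi>_def [abs_def] by (intro DERIV_diff pd_line_at d(1))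
  qed
  then obtain \<xi> where \<xi>: "0 < \<xi>" "\<xi> < h"
    "\<phi> h - \<phi> 0 = h * (pd i f (x + h *\<^sub>R axis j 1 + \<xi> *\<^sub>R axis i 1) - pd i f (x + \<xi> *\<^sub>R axis i 1))" by auto
  let ?c = "x + \<xi> *\<^sub>R axis i 1"
  have "\<exists>\<tau>. 0 < \<tau> \<and> \<tau> < h \<and> pd i f (?c + h *\<^sub>R axis j 1) - pd i f (?c + 0 *\<^sub>R axis j 1)
      = (h - 0) * pd j (pd i f) (?c + \<tau> *\<^sub>R axis j 1)"
    by (rule MVT2[OF h(1)], rule pd_line_at, rule d(2), rule pt) (use \<xi> in auto)
  then obtain \<tau> where \<tau>: "0 < \<tau>" "\<tau> < h"
    "pd i f (?c + h *\<^sub>R axis j 1) - pd i f ?c = h * pd j (pd i f) (?c + \<tau> *\<^sub>R axis j 1)" by auto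
  have "?c + h *\<^sub>R axis j 1 = x + h *\<^sub>R axis j 1 + \<xi> *\<^sub>R axis i 1" by simp
  then have "\<phi> h - \<phi> 0 = h * (h * pd j (pd i f) (?c + \<tau> *\<^sub>R axis j 1))"
    using \<xi>(3) \<tau>(3) by (simp only:)
  moreover have "?c + \<tau> *\<^sub>R axis j 1 \<in> ball x r" using pt \<xi> \<tau> by simp
  ultimately show ?thesis unfolding \<phi>_def
    by (intro bexI[where x = "?c + \<tau> *\<^sub>R axis j 1"]) (simp_all add: algebra_simps)
qed

lemma pd_commute_real:
  fixes f :: "real^'n::finite \<Rightarrow> real"
  assumes S: "open S" and f: "smooth_on S f" and x: "x \<in> S"
  shows "pd i (pd j f) x = pd j (pd i f) x"
proof (rule ccontr)
  let ?A = "pd i (pd j f)" and ?B = "pd j (pd i f)"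
  assume ne: "?A x \<noteq> ?B x"
  define e where "e = \<bar>?A x - ?B x\<bar> / 2"
  have e: "e > 0" using ne by (simp add: e_def)
  have cont: "isCont (pd k (pd l f)) x" for k l
    using smooth_on_differentiable[OF smooth_on_pd[OF smooth_on_pd[OF f]] S x]
    by (rule differentiable_imp_continuous_within)
  obtain r1 where r1: "r1 > 0" "\<And>y. dist y x < r1 \<Longrightarrow> dist (?A y) (?A x) < e"
    using cont[of i j] e unfolding continuous_at_eps_delta by metis
  obtain r2 where r2: "r2 > 0" "\<And>y. dist y x < r2 \<Longrightarrow> dist (?B y) (?B x) < e"
    using cont[of j i] e unfolding continuous_at_eps_delta by metis
  obtain r3 where r3: "r3 > 0" "ball x r3 \<subseteq> S" using S x openE by blast
  define r where "r = min r3 (min r1 r2)"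
  have r: "r > 0" "ball x r \<subseteq> S" using r1(1) r2(1) r3 by (auto simp: r_def)
  have h: "0 < r / 4" "2 * (r / 4) < r" using r by auto
  obtain y1 where y1: "y1 \<in> ball x r"
    "f (x + (r/4) *\<^sub>R axis i 1 + (r/4) *\<^sub>R axis j 1) - f (x + (r/4) *\<^sub>R axis i 1)
      - f (x + (r/4) *\<^sub>R axis j 1) + f x = (r/4) * (r/4) * ?B y1"
    using second_difference[OF S f r(2) h] by blast
  obtain y2 where y2: "y2 \<in> ball x r"
    "f (x + (r/4) *\<^sub>R axis j 1 + (r/4) *\<^sub>R axis i 1) - f (x + (r/4) *\<^sub>R axis j 1)
      - f (x + (r/4) *\<^sub>R axis i 1) + f x = (r/4) * (r/4) * ?A y2"
    using second_difference[OF S f r(2) h] by blast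
  have comm: "x + (r/4) *\<^sub>R axis j 1 + (r/4) *\<^sub>R axis i 1 = x + (r/4) *\<^sub>R axis i 1 + (r/4) *\<^sub>R axis j 1"
    by simp
  have "(r/4) * (r/4) * ?B y1 = (r/4) * (r/4) * ?A y2" using y1(2) y2(2) unfolding comm by linarith
  then have "?B y1 = ?A y2" using r(1) by simp
  moreover have "dist (?A y2) (?A x) < e" "dist (?B y1) (?B x) < e"
    using y1(1) y2(1) r1(2)[of y2] r2(2)[of y1] by (auto simp: r_def dist_commute[of x])
  ultimately show False unfolding e_def dist_real_def by (simp add: abs_if split: if_splits)
qed

lemma pd_commute:
  fixes f :: "real^'n::finite \<Rightarrow> real^'m::finite"
  assumes S: "open S" and f: "smooth_on S f" and x: "x \<in> S"
  shows "pd i (pd j f) x = pd j (pd i f) x"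
proof -
  have c: "pd i (pd j f) x $ a = pd i (pd j (\<lambda>y. f y $ a)) x" for a i j
  proof -
    have "pd i (pd j (\<lambda>y. f y $ a)) x = pd i (\<lambda>y. pd j f y $ a) x"
      by (rule pd_cong[OF S x]) (rule pd_nth[OF smooth_on_differentiable[OF f S]])
    then show ?thesis by (simp add: pd_nth[OF smooth_on_differentiable[OF smooth_on_pd[OF f] S x]])
  qed
  show ?thesis unfolding vec_eq_iff c
    using pd_commute_real[OF S smooth_on_nth[OF S f] x] by blast
qed

lemma pd_compose:
  fixes R :: "real^'n::finite \<Rightarrow> real^'m::finite" and f :: "real^'m \<Rightarrow> real"
  assumes f: "f differentiable (at (R u))" and R: "R differentiable (at u)"
  shows "pd k (\<lambda>u. f (R u)) u = (\<Sum>a\<in>UNIV. pd a f (R u) * pd k (\<lambda>u. R u $ a) u)"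
    "(\<lambda>u. f (R u)) differentiable (at u)"
proof -
  note d = has_derivative_compose[OF has_derivative_pd[OF R] has_derivative_pd[OF f]]
  show "pd k (\<lambda>u. f (R u)) u = (\<Sum>a\<in>UNIV. pd a f (R u) * pd k (\<lambda>u. R u $ a) u)"
    unfolding pd_eqI[OF d] sum_axis pd_nth[OF R] by (simp add: mult.commute)
  show "(\<lambda>u. f (R u)) differentiable (at u)" by (rule differentiableI[OF d])
qed

section \<open>Matrices of functions\<close>

lemma bounded_bilinear_matrix_mult:
  "bounded_bilinear ((**) :: real^'n::finite^'m::finite \<Rightarrow> real^'k::finite^'n \<Rightarrow> real^'k^'m)"
proof -
  have "bilinear ((**) :: real^'n^'m \<Rightarrow> real^'k^'n \<Rightarrow> real^'k^'m)"
    unfolding bilinear_def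
    by (auto intro!: linearI simp: matrix_matrix_mult_def vec_eq_iff sum.distrib algebra_simps
        sum_distrib_left)
  then show ?thesis by (simp add: bilinear_conv_bounded_bilinear)
qed

lemmas matrix_distrib =
  bounded_bilinear.add_left[OF bounded_bilinear_matrix_mult]
  bounded_bilinear.add_right[OF bounded_bilinear_matrix_mult]
  bounded_bilinear.diff_left[OF bounded_bilinear_matrix_mult]
  bounded_bilinear.diff_right[OF bounded_bilinear_matrix_mult]
  bounded_bilinear.minus_left[OF bounded_bilinear_matrix_mult]
  bounded_bilinear.minus_right[OF bounded_bilinear_matrix_mult]
  bounded_bilinear.scaleR_left[OF bounded_bilinear_matrix_mult]
  bounded_bilinear.scaleR_right[OF bounded_bilinear_matrix_mult]

lemma pd_matrix_mult:
  fixes A B :: "real^'n::finite \<Rightarrow> real^'n^'n"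
  assumes "A differentiable (at x)" "B differentiable (at x)"
  shows "pd i (\<lambda>y. A y ** B y) x = pd i A x ** B x + A x ** pd i B x"
  using pd_eqI[OF bounded_bilinear.FDERIV[OF bounded_bilinear_matrix_mult has_derivative_pd has_derivative_pd, OF assms]]
  by (simp add: add.commute)

lemma pd_matrix_nth:
  fixes A :: "real^'n::finite \<Rightarrow> real^'n^'n"
  assumes "A differentiable (at x)"
  shows "pd i (\<lambda>y. A y $ a $ b) x = pd i A x $ a $ b"
proof -
  have d: "(\<lambda>y. A y $ a) differentiable (at x)"
    by (rule pd_linear(2)[OF bounded_linear_vec_nth assms])
  show ?thesis unfolding pd_nth[OF d] pd_nth[OF assms] ..
qed

lemma transpose_uminus: "transpose (- A :: real^'n^'m) = - transpose A"
  by (simp add: transpose_def vec_eq_iff)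

lemma transpose_nth [simp]: "transpose A $ i $ j = A $ j $ i"
  by (simp add: transpose_def)

lemma transpose_matrix_inv:
  fixes A :: "real^'n::finite^'n"
  assumes "det A \<noteq> 0" "transpose A = A"
  shows "transpose (matrix_inv A) = matrix_inv A"
  by (rule matrix_inv_unique[symmetric])
    (metis assms matrix_inv_inverse matrix_transpose_mul transpose_mat)+

lemma matrix_inv_inv:
  fixes A :: "real^'n::finite^'n"
  assumes "det A \<noteq> 0"
  shows "matrix_inv (matrix_inv A) = A"
  by (rule matrix_inv_unique) (simp_all add: matrix_inv_inverse assms)

lemma det_matrix_inv:
  fixes A :: "real^'n::finite^'n"
  assumes "det A \<noteq> 0"
  shows "det (matrix_inv A) \<noteq> 0"
  using det_mul[of A "matrix_inv A"] matrix_inv_inverse(1)[OF assms] by auto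

lemma matrix_nth: "(A ** B) $ i $ j = (\<Sum>k\<in>UNIV. A $ i $ k * B $ k $ j)"
  by (simp add: matrix_matrix_mult_def)

section \<open>Differential functions of low order\<close>

lemma jet_shift_0 [simp]: "jet_shift v 0 z = z"
  by (cases "(v, 0::real, z)" rule: jet_shift.cases) auto

lemma jet_pdI:
  "((\<lambda>t. f (jet_shift v t z)) has_real_derivative D) (at 0) \<Longrightarrow> jet_pd v f z = D"
  unfolding jet_pd_def by (rule DERIV_imp_deriv)

lemma jet_shift_in_jets:
  assumes "open W" "z \<in> jets W"
  shows "\<forall>\<^sub>F t in nhds 0. jet_shift v t z \<in> jets W"
proof (cases "\<exists>i. v = Some (0, i)")
  case True
  then obtain i where v: "v = Some (0, i)" by auto
  have "\<forall>\<^sub>F t in nhds (0::real). snd z 0 + t *\<^sub>R axis i 1 \<in> W"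
    using eventually_line_in assms by (auto simp: jets_def)
  then show ?thesis unfolding v jets_def by (cases z) simp
next
  case False
  then have "snd (jet_shift v t z) 0 = snd z 0" for t
    by (cases "(v, t, z)" rule: jet_shift.cases) auto
  then show ?thesis using assms by (simp add: jets_def)
qed

lemma jet_pd_cong:
  assumes "open W" "z \<in> jets W" "\<And>z. z \<in> jets W \<Longrightarrow> f z = g z"
  shows "jet_pd v f z = jet_pd v g z"
  unfolding jet_pd_def
proof (rule deriv_cong_ev)
  show "\<forall>\<^sub>F t in nhds 0. f (jet_shift v t z) = g (jet_shift v t z)"
    by (rule eventually_mono[OF jet_shift_in_jets[OF assms(1,2)]]) (rule assms(3))
qed (rule refl)

lemma total_D_cong:
  assumes "open W" "z \<in> jets W" "\<And>z. z \<in> jets W \<Longrightarrow> f z = g z"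
  shows "total_D f z = total_D g z"
  unfolding total_D_def using jet_pd_cong[OF assms] by simp

lemma total_D_pow_cong:
  assumes "open W" "z \<in> jets W" "\<And>z. z \<in> jets W \<Longrightarrow> f z = g z"
  shows "(total_D ^^ k) f z = (total_D ^^ k) g z"
  using assms(2)
  by (induction k arbitrary: z) (auto simp: assms(3) intro!: total_D_cong[OF assms(1)])

lemma var_deriv_cong:
  assumes "open W" "z \<in> jets W" "\<And>z. z \<in> jets W \<Longrightarrow> f z = g z"
  shows "var_deriv l f z = var_deriv l g z"
  unfolding var_deriv_def
  using total_D_pow_cong[OF assms(1,2) jet_pd_cong[OF assms(1) _ assms(3)]] by simp

lemma jet_pd_const [simp]: "jet_pd v (\<lambda>z. c) z = 0"
  by (rule jet_pdI) simp

lemma total_D_pow_zero: "(total_D ^^ k) (\<lambda>z. 0) = (\<lambda>z. 0)"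
  by (induction k) (auto simp: total_D_def)

text \<open>Reduces the series of the total derivative to a finite sum, which is possible because
  a differential function has finite order.\<close>

lemma total_D_finite:
  assumes "\<And>k i. k > N \<Longrightarrow> jet_pd (Some (k, i)) f z = 0"
  shows "total_D f z = jet_pd None f z +
     (\<Sum>k\<le>N. \<Sum>i\<in>UNIV. snd z (Suc k) $ i * jet_pd (Some (k, i)) f z)"
  unfolding total_D_def
  by (subst suminf_finite[where N = "{..N}"]) (auto simp: assms)

text \<open>The densities \<open>x\<^sup>a f(u)\<close> and \<open>x\<^sup>b \<alpha>\<^sub>k(u) u\<^sup>k\<^sub>x\<close>.  All brackets below are sums of these, and every
  test functional is of the first kind.\<close>

definition order0 :: "nat \<Rightarrow> (real^'n::finite \<Rightarrow> real) \<Rightarrow> 'n jet \<Rightarrow> real" where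
  "order0 a f z = fst z ^ a * f (snd z 0)"

definition order1 :: "nat \<Rightarrow> ('n \<Rightarrow> real^'n::finite \<Rightarrow> real) \<Rightarrow> 'n jet \<Rightarrow> real" where
  "order1 b \<alpha> z = fst z ^ b * (\<Sum>k\<in>UNIV. \<alpha> k (snd z 0) * snd z 1 $ k)"

lemma order0_jet_derivative:
  assumes "f differentiable (at (snd z 0))"
  shows "((\<lambda>t. order0 a f (jet_shift None t z)) has_real_derivative order0 (a - 1) (\<lambda>u. a * f u) z) (at 0)"
    "((\<lambda>t. order0 a f (jet_shift (Some (0, i)) t z)) has_real_derivative order0 a (pd i f) z) (at 0)"
    "((\<lambda>t. order0 a f (jet_shift (Some (Suc k, i)) t z)) has_real_derivative 0) (at 0)"
  by (cases z; use assms in \<open>auto simp: order0_def intro!: derivative_eq_intros pd_line_real\<close>)+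

lemma jet_pd_order0:
  assumes "f differentiable (at (snd z 0))"
  shows "jet_pd None (order0 a f) z = order0 (a - 1) (\<lambda>u. a * f u) z"
    "jet_pd (Some (0, i)) (order0 a f) z = order0 a (pd i f) z"
    "jet_pd (Some (Suc k, i)) (order0 a f) z = 0"
  by (rule jet_pdI, rule order0_jet_derivative[OF assms])+

lemma total_D_order0:
  assumes "f differentiable (at (snd z 0))"
  shows "total_D (order0 a f) z = order0 (a - 1) (\<lambda>u. a * f u) z + order1 a (\<lambda>k. pd k f) z"
proof -
  have "jet_pd (Some (k, i)) (order0 a f) z = 0" if "k > 0" for k i
    using jet_pd_order0(3)[OF assms] that by (cases k) auto
  then show ?thesis
    by (subst total_D_finite[where N = 0])
      (auto simp: jet_pd_order0[OF assms] order0_def order1_def sum_distrib_left mult_ac)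
qed

lemma jet_pd_order1:
  assumes f: "f differentiable (at (snd z 0))" and \<alpha>: "\<And>k. \<alpha> k differentiable (at (snd z 0))"
  shows "jet_pd (Some (0, i)) (\<lambda>z. order0 a f z + order1 b \<alpha> z) z
        = order0 a (pd i f) z + order1 b (\<lambda>k. pd i (\<alpha> k)) z"
    "jet_pd (Some (Suc 0, i)) (\<lambda>z. order0 a f z + order1 b \<alpha> z) z = order0 b (\<alpha> i) z"
    "jet_pd (Some (Suc (Suc k), i)) (\<lambda>z. order0 a f z + order1 b \<alpha> z) z = 0"
proof -
  obtain x j where z: "z = (x, j)" by fastforce
  note d = pd_line_real[OF f] pd_line_real[OF \<alpha>]
  show "jet_pd (Some (0, i)) (\<lambda>z. order0 a f z + order1 b \<alpha> z) z
        = order0 a (pd i f) z + order1 b (\<lambda>k. pd i (\<alpha> k)) z"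
    using d by (intro jet_pdI)
      (auto simp: z order0_def order1_def intro!: derivative_eq_intros)
  have *: "(\<Sum>k\<in>UNIV. \<alpha> k (j 0) * (j 1 + t *\<^sub>R axis i 1) $ k)
      = (\<Sum>k\<in>UNIV. \<alpha> k (j 0) * j 1 $ k) + t * \<alpha> i (j 0)" for t
  proof -
    have "(\<Sum>k\<in>UNIV. \<alpha> k (j 0) * (j 1 + t *\<^sub>R axis i 1) $ k)
      = (\<Sum>k\<in>UNIV. \<alpha> k (j 0) * j 1 $ k) + (\<Sum>k\<in>UNIV. axis i 1 $ k * (t * \<alpha> k (j 0)))"
      by (simp add: sum.distrib[symmetric] algebra_simps)
    then show ?thesis by simp
  qed
  show "jet_pd (Some (Suc 0, i)) (\<lambda>z. order0 a f z + order1 b \<alpha> z) z = order0 b (\<alpha> i) z"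
    by (rule jet_pdI)
      (auto simp: z order0_def order1_def *[simplified] intro!: derivative_eq_intros)
  show "jet_pd (Some (Suc (Suc k), i)) (\<lambda>z. order0 a f z + order1 b \<alpha> z) z = 0"
    by (rule jet_pdI) (auto simp: z order0_def order1_def)
qed

text \<open>The Euler operator sees the one-form \<open>\<alpha>\<close> through its exterior derivative; the last term comes from
  the explicit dependence on \<open>x\<close>.\<close>

lemma var_deriv_order1:
  fixes W :: "(real^'n::finite) set"
  assumes W: "open W" and z: "z \<in> jets W"
    and f: "\<And>u. u \<in> W \<Longrightarrow> f differentiable (at u)"
    and \<alpha>: "\<And>u k. u \<in> W \<Longrightarrow> \<alpha> k differentiable (at u)"
  shows "var_deriv l (\<lambda>z. order0 a f z + order1 b \<alpha> z) z
      = order0 a (pd l f) z + order1 b (\<lambda>k u. pd l (\<alpha> k) u - pd k (\<alpha> l) u) z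
        - order0 (b - 1) (\<lambda>u. b * \<alpha> l u) z"
proof -
  let ?P = "\<lambda>z. order0 a f z + order1 b \<alpha> z"
  let ?t = "\<lambda>k. (-1) ^ k * (total_D ^^ k) (jet_pd (Some (k, l)) ?P) z"
  have d: "f differentiable (at (snd z 0))" "\<And>k. \<alpha> k differentiable (at (snd z 0))"
    if "z \<in> jets W" for z using that f \<alpha> by (auto simp: jets_def)
  have "?t (Suc (Suc k)) = 0" for k
    using total_D_pow_cong[OF W z, of "jet_pd (Some (Suc (Suc k), l)) ?P" "\<lambda>z. 0" "Suc (Suc k)"]
      jet_pd_order1(3)[OF d] by (simp add: total_D_pow_zero del: funpow.simps)
  then have "?t k = 0" if "k \<notin> {0, 1}" for k
    using that by (cases k rule: nat.exhaust; cases "k - 1") auto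
  then have "var_deriv l ?P z = ?t 0 + ?t 1"
    unfolding var_deriv_def by (subst suminf_finite[where N = "{0, 1}"]) auto
  also have "?t 0 = order0 a (pd l f) z + order1 b (\<lambda>k. pd l (\<alpha> k)) z"
    using jet_pd_order1(1)[OF d[OF z]] by simp
  also have "?t 1 = - total_D (order0 b (\<alpha> l)) z"
    using total_D_cong[OF W z, of "jet_pd (Some (1, l)) ?P" "order0 b (\<alpha> l)"]
      jet_pd_order1(2)[OF d] by simp
  also have "\<dots> = - (order0 (b - 1) (\<lambda>u. b * \<alpha> l u) z + order1 b (\<lambda>k. pd k (\<alpha> l)) z)"
    by (simp add: total_D_order0[OF d(2)[OF z]])
  finally show ?thesis
    by (simp add: order1_def algebra_simps sum_subtractf)
qed

lemma var_deriv_order0: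
  fixes W :: "(real^'n::finite) set"
  assumes W: "open W" and z: "z \<in> jets W"
    and f: "\<And>u. u \<in> W \<Longrightarrow> f differentiable (at u)"
  shows "var_deriv l (order0 a f) z = order0 a (pd l f) z"
proof -
  have "order0 a f = (\<lambda>z. order0 a f z + order1 0 (\<lambda>k u. 0) z)" by (simp add: order1_def)
  then have "var_deriv l (order0 a f) z
      = var_deriv l (\<lambda>z. order0 a f z + order1 0 (\<lambda>k u. 0) z) z" by simp
  also have "\<dots> = order0 a (pd l f) z"
    by (subst var_deriv_order1[OF W z f]) (auto simp: order1_def order0_def)
  finally show ?thesis .
qed

lemma jets_projection: "z \<in> jets W \<Longrightarrow> snd z 0 \<in> W"
  by (simp add: jets_def)

text \<open>On \<open>jets W\<close> the densities \<open>x\<^sup>a f(u)\<close> with smooth \<open>f\<close> are stable under all jet derivatives, so all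
  iterated derivatives of the test densities are controlled at once.\<close>

lemma diff_fun_order0:
  fixes W :: "(real^'n::finite) set"
  assumes W: "open W" and p: "smooth_on W p"
  shows "diff_fun W (order0 a p)"
proof -
  have *: "\<exists>a p'. smooth_on W p' \<and> (\<forall>z\<in>jets W. foldr jet_pd vs (order0 a0 p) z = order0 a p' z)" for vs a0
  proof (induction vs)
    case Nil
    then show ?case using p by auto
  next
    case (Cons v vs)
    then obtain a p' where p': "smooth_on W p'"
      and eq: "\<And>z. z \<in> jets W \<Longrightarrow> foldr jet_pd vs (order0 a0 p) z = order0 a p' z" by blast
    have d: "p' differentiable (at (snd z 0))" if "z \<in> jets W" for z
      using smooth_on_differentiable[OF p' W jets_projection[OF that]] .
    have eq': "foldr jet_pd (v # vs) (order0 a0 p) z = jet_pd v (order0 a p') z" if "z \<in> jets W" for z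
      using jet_pd_cong[OF W that eq] by simp
    consider "v = None" | i where "v = Some (0, i)" | k i where "v = Some (Suc k, i)"
      by (metis not0_implies_Suc option.exhaust surj_pair)
    then show ?case
    proof cases
      case 1
      then show ?thesis using eq' jet_pd_order0(1)[OF d]
        by (intro exI[of _ "a - 1"] exI[of _ "\<lambda>u. a * p' u"]) (simp add: smooth_on_mult[OF W] p' W)
    next
      case 2
      then show ?thesis using eq' jet_pd_order0(2)[OF d] smooth_on_pd[OF p']
        by (intro exI[of _ a] exI[of _ "pd i p'"]) simp
    next
      case 3
      have zero: "foldr jet_pd (v # vs) (order0 a0 p) z = order0 0 (\<lambda>u. 0) z" if "z \<in> jets W" for z
        unfolding eq'[OF that] unfolding 3 jet_pd_order0(3)[OF d[OF that]] by (simp add: order0_def)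
      show ?thesis
      proof (rule exI[where x = 0], rule exI[where x = "\<lambda>u. 0"], rule conjI)
        show "smooth_on W (\<lambda>u. 0::real)" by (rule smooth_on_const[OF W])
        show "\<forall>z\<in>jets W. foldr jet_pd (v # vs) (order0 a0 p) z = order0 0 (\<lambda>u. 0) z"
          by (rule ballI) (rule zero)
      qed
    qed
  qed
  have cont: "continuous_on (jets W) (foldr jet_pd vs (order0 a p))" for vs
  proof -
    obtain a' p' where p': "smooth_on W p'" "\<forall>z\<in>jets W. foldr jet_pd vs (order0 a p) z = order0 a' p' z"
      using * by blast
    have W': "continuous_on W p'"
      using p'(1) W by (intro differentiable_imp_continuous_on)
        (auto simp: differentiable_on_eq_differentiable_at intro: smooth_on_differentiable)
    have "continuous_on UNIV (\<lambda>j :: nat \<Rightarrow> real^'n. j 0)" by (rule continuous_on_product_coordinates)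
    then have "continuous_on (jets W) (\<lambda>z :: 'n jet. snd z 0)"
      by (rule continuous_on_compose2) (auto intro: continuous_on_snd continuous_on_id)
    from continuous_on_compose2[OF W' this] have "continuous_on (jets W) (\<lambda>z. p' (snd z 0))"
      by (auto simp: jets_def)
    then have "continuous_on (jets W) (order0 a' p')"
      unfolding order0_def by (intro continuous_on_mult continuous_on_power continuous_on_fst continuous_on_id)
    then show ?thesis using p'(2) by (subst continuous_on_cong[OF refl, of _ _ "order0 a' p'"]) auto
  qed
  have diff: "(\<lambda>t. foldr jet_pd vs (order0 a p) (jet_shift v t z)) differentiable (at 0)"
    if z: "z \<in> jets W" for vs v z
  proof -
    obtain a' p' where p': "smooth_on W p'" "\<And>z. z \<in> jets W \<Longrightarrow> foldr jet_pd vs (order0 a p) z = order0 a' p' z"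
      using * by blast
    have d: "p' differentiable (at (snd z 0))"
      using smooth_on_differentiable[OF p'(1) W jets_projection[OF z]] .
    consider "v = None" | i where "v = Some (0, i)" | k i where "v = Some (Suc k, i)"
      by (metis not0_implies_Suc option.exhaust surj_pair)
    then obtain D where "((\<lambda>t. order0 a' p' (jet_shift v t z)) has_real_derivative D) (at 0)"
      by cases (use order0_jet_derivative[OF d, of a'] in blast)+
    moreover have "\<forall>\<^sub>F t in nhds 0. order0 a' p' (jet_shift v t z) = foldr jet_pd vs (order0 a p) (jet_shift v t z)"
      by (rule eventually_mono[OF jet_shift_in_jets[OF W z, of v]]) (simp add: p'(2))
    ultimately have "((\<lambda>t. foldr jet_pd vs (order0 a p) (jet_shift v t z)) has_real_derivative D) (at 0)"
      by (rule DERIV_cong_ev[OF refl _ refl, THEN iffD1, rotated])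
    then show ?thesis using real_differentiable_def by blast
  qed
  have fin: "order0 a p z = order0 a p z'" if "fst z = fst z'" "\<forall>k\<le>0. snd z k = snd z' k" for z z'
    using that by (simp add: order0_def)
  show ?thesis unfolding diff_fun_def
  proof (intro conjI allI ballI exI[of _ 0] impI)
    show "order0 a p z = order0 a p z'" if "fst z = fst z' \<and> (\<forall>k\<le>0. snd z k = snd z' k)" for z z'
      using fin that by blast
  qed (rule cont, erule diff)
qed

section \<open>Densities that are total derivatives\<close>

definition order_le :: "(real^'n::finite) set \<Rightarrow> nat \<Rightarrow> ('n jet \<Rightarrow> real) \<Rightarrow> bool" where
  "order_le W N K \<longleftrightarrow> (\<forall>z\<in>jets W. \<forall>z'\<in>jets W.
     fst z = fst z' \<and> (\<forall>k\<le>N. snd z k = snd z' k) \<longrightarrow> K z = K z')"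

lemma order_leD:
  "order_le W N K \<Longrightarrow> z \<in> jets W \<Longrightarrow> z' \<in> jets W \<Longrightarrow> fst z = fst z' \<Longrightarrow>
   (\<And>k. k \<le> N \<Longrightarrow> snd z k = snd z' k) \<Longrightarrow> K z = K z'"
  unfolding order_le_def by blast

lemma jet_shift_agree:
  assumes "fst z = fst z'" "\<forall>k\<le>N. snd z k = snd z' k"
  shows "fst (jet_shift v t z) = fst (jet_shift v t z')"
    "k \<le> N \<Longrightarrow> snd (jet_shift v t z) k = snd (jet_shift v t z') k"
  by (cases z; cases z'; use assms in \<open>cases "(v, t, z)" rule: jet_shift.cases; auto\<close>)+

lemma order_le_jet_pd_eq:
  assumes W: "open W" and K: "order_le W N K" and z: "z \<in> jets W" "z' \<in> jets W"
    and "fst z = fst z'" "\<forall>k\<le>N. snd z k = snd z' k"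
  shows "jet_pd v K z = jet_pd v K z'"
  unfolding jet_pd_def
proof (rule deriv_cong_ev)
  show "\<forall>\<^sub>F t in nhds 0. K (jet_shift v t z) = K (jet_shift v t z')"
    using jet_shift_in_jets[OF W z(1), of v] jet_shift_in_jets[OF W z(2), of v]
    by eventually_elim (rule order_leD[OF K]; use jet_shift_agree[OF assms(5,6)] in simp)
qed (rule refl)

lemma order_le_jet_pd_zero:
  assumes W: "open W" and K: "order_le W N K" and z: "z \<in> jets W" and "k > N"
  shows "jet_pd (Some (k, i)) K z = 0"
proof (rule jet_pdI)
  have "K (jet_shift (Some (k, i)) t z) = K z" for t
    by (rule order_leD[OF K]; cases z) (use z \<open>k > N\<close> in \<open>auto simp: jets_def\<close>)
  then show "((\<lambda>t. K (jet_shift (Some (k, i)) t z)) has_real_derivative 0) (at 0)" by simp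
qed

lemma total_D_order_le:
  assumes "open W" "order_le W N K" "z \<in> jets W"
  shows "total_D K z = jet_pd None K z +
     (\<Sum>k\<le>N. \<Sum>i\<in>UNIV. snd z (Suc k) $ i * jet_pd (Some (k, i)) K z)"
  by (rule total_D_finite) (rule order_le_jet_pd_zero[OF assms])

lemma jet_shift_add: "jet_shift v s (jet_shift v t z) = jet_shift v (t + s) z"
  by (cases "(v, t, z)" rule: jet_shift.cases) (auto simp: algebra_simps fun_eq_iff)

lemma diff_fun_jet_derivative:
  assumes "diff_fun W K" "z \<in> jets W"
  shows "((\<lambda>t. K (jet_shift v t z)) has_real_derivative jet_pd v K z) (at 0)"
proof -
  have "(\<lambda>t. foldr jet_pd [] K (jet_shift v t z)) differentiable (at 0)"
    using assms unfolding diff_fun_def by blast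
  then show ?thesis unfolding jet_pd_def
    by (simp add: DERIV_deriv_iff_real_differentiable)
qed

text \<open>If \<open>K\<close> has order \<open>N + 1\<close>, then its total derivative is affine in the derivatives of order \<open>N + 2\<close>,
  with the derivatives of \<open>K\<close> by the top variables as slopes.  When the total derivative has order one,
  these slopes must vanish, and \<open>K\<close> does not depend on its top variables, because these range over
  a whole vector space.\<close>

lemma order_le_drop:
  fixes W :: "(real^'n::finite) set"
  assumes W: "open W" and K: "diff_fun W K" and ord: "order_le W (Suc N) K"
    and T: "order_le W 1 (total_D K)"
  shows "order_le W N K"
proof -
  have zero: "jet_pd (Some (Suc N, i)) K z = 0" if z: "z \<in> jets W" for z i
  proof -
    \<comment> \<open>A unit shift in order \<open>N + 2\<close> changes nothing in \<open>total_D K\<close> except for one slope.\<close>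
    define z' where "z' = jet_shift (Some (Suc (Suc N), i)) 1 z"
    have z': "z' \<in> jets W" "fst z = fst z'" and low: "\<forall>k\<le>Suc N. snd z k = snd z' k"
      and top: "snd z' (Suc (Suc N)) = snd z (Suc (Suc N)) + axis i 1"
      using z by (cases z; simp add: z'_def jets_def)+
    note same = order_le_jet_pd_eq[OF W ord z z'(1,2) low]
    have "total_D K z = total_D K z'"
      using order_leD[OF T z z'] low by simp
    then have "(\<Sum>i\<in>UNIV. snd z (Suc (Suc N)) $ i * jet_pd (Some (Suc N, i)) K z)
       = (\<Sum>i\<in>UNIV. snd z' (Suc (Suc N)) $ i * jet_pd (Some (Suc N, i)) K z)"
      unfolding total_D_order_le[OF W ord z] total_D_order_le[OF W ord z'(1)] same[symmetric]
      using low by simp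
    then have "(\<Sum>l\<in>UNIV. axis i (1::real) $ l * jet_pd (Some (Suc N, l)) K z) = 0"
      unfolding top by (simp add: algebra_simps sum.distrib)
    then show ?thesis by simp
  qed
  have shift: "K (jet_shift (Some (Suc N, i)) t z) = K z" if z: "z \<in> jets W" for z i t
  proof -
    let ?v = "Some (Suc N, i)"
    have in': "jet_shift ?v t z \<in> jets W" for t using z by (cases z) (simp add: jets_def)
    have "((\<lambda>t. K (jet_shift ?v t z)) has_real_derivative 0) (at t)" for t
    proof -
      have "((\<lambda>s. K (jet_shift ?v (t + s) z)) has_real_derivative 0) (at 0)"
        using diff_fun_jet_derivative[OF K in', of ?v t] zero[OF in'] by (simp add: jet_shift_add)
      then show ?thesis using DERIV_at_within_shift[of "\<lambda>t. K (jet_shift ?v t z)" 0 t 0 UNIV]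
        by (simp add: add.commute)
    qed
    then have "K (jet_shift ?v t z) = K (jet_shift ?v 0 z)" by (intro DERIV_isconst_all allI)
    then show ?thesis by simp
  qed
  have partial: "K (x, j(Suc N := j (Suc N) + (\<Sum>i\<in>A. c i *\<^sub>R axis i 1))) = K (x, j)"
    if "(x, j) \<in> jets W" for x j c and A :: "'n set"
  proof (induction A rule: infinite_finite_induct)
    case (insert i A)
    let ?z = "(x, j(Suc N := j (Suc N) + (\<Sum>i\<in>A. c i *\<^sub>R axis i 1)))"
    have zin: "?z \<in> jets W" using that by (simp add: jets_def)
    have js: "jet_shift (Some (Suc N, i)) (c i) ?z
        = (x, j(Suc N := j (Suc N) + (\<Sum>i\<in>insert i A. c i *\<^sub>R axis i 1)))"
      using insert by (simp add: algebra_simps)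
    show ?case using shift[OF zin, of i "c i"] insert.IH by (simp only: js)
  qed (auto simp: that)
  show ?thesis unfolding order_le_def
  proof safe
    fix x j x' j' assume z: "(x, j) \<in> jets W" "(x', j') \<in> jets W"
      and eq: "fst (x, j) = fst (x', j')" "\<forall>k\<le>N. snd (x, j) k = snd (x', j') k"
    let ?c = "\<lambda>i. (j' (Suc N) - j (Suc N)) $ i"
    have "(\<Sum>i\<in>UNIV. ?c i *\<^sub>R axis i 1) = j' (Suc N) - j (Suc N)"
      by (simp add: vec_eq_iff axis_def if_distrib cong: if_cong)
    then have "K (x, j(Suc N := j' (Suc N))) = K (x, j)"
      using partial[OF z(1), of ?c UNIV] by simp
    moreover have "K (x, j(Suc N := j' (Suc N))) = K (x', j')"
      by (rule order_leD[OF ord]) (use z eq in \<open>auto simp: jets_def le_Suc_eq\<close>)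
    ultimately show "K (x, j) = K (x', j')" by simp
  qed
qed

lemma primitive_order0:
  fixes W :: "(real^'n::finite) set"
  assumes W: "open W" and K: "diff_fun W K" and T: "order_le W 1 (total_D K)"
  shows "order_le W 0 K"
proof -
  obtain N where "order_le W N K"
    using K unfolding diff_fun_def order_le_def by blast
  then show ?thesis
  proof (induction N)
    case (Suc N)
    show ?case by (rule Suc.IH) (rule order_le_drop[OF W K Suc.prems T])
  qed
qed

definition one_jet :: "real \<Rightarrow> real^'n \<Rightarrow> real^'n \<Rightarrow> 'n::finite jet" where
  "one_jet x u v = (x, \<lambda>k. if k = 0 then u else if k = 1 then v else 0)"

lemma one_jet_simps [simp]:
  "fst (one_jet x u v) = x" "snd (one_jet x u v) 0 = u" "snd (one_jet x u v) (Suc 0) = v"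
  "one_jet x u v \<in> jets W \<longleftrightarrow> u \<in> W"
  by (auto simp: one_jet_def jets_def)

text \<open>A first-order density that is a total derivative is \<open>\<kappa>\<^sub>x + u\<^sup>i\<^sub>x \<kappa>\<^sub>i\<close> with a function \<open>\<kappa>(x,u)\<close>; here \<open>D i\<close>
  is the derivative \<open>\<kappa>\<^sub>i\<close>.\<close>

lemma zero_functional_primitive:
  fixes W :: "(real^'n::finite) set"
  assumes W: "open W" and T: "zero_functional W T" and ord: "order_le W 1 T"
  shows "\<exists>(\<kappa> :: real \<Rightarrow> real^'n \<Rightarrow> real) (D :: 'n \<Rightarrow> real \<Rightarrow> real^'n \<Rightarrow> real).
    (\<forall>x. \<forall>u\<in>W. ((\<lambda>x. \<kappa> x u) has_real_derivative T (one_jet x u 0)) (at x)) \<and>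
    (\<forall>x i. \<forall>u\<in>W. ((\<lambda>t. \<kappa> x (u + t *\<^sub>R axis i 1)) has_real_derivative D i x u) (at 0)) \<and>
    (\<forall>x v. \<forall>u\<in>W. T (one_jet x u v) = T (one_jet x u 0) + (\<Sum>i\<in>UNIV. v $ i * D i x u))"
proof -
  obtain K where K: "diff_fun W K" "\<forall>z\<in>jets W. T z = total_D K z"
    using T unfolding zero_functional_def by blast
  have "order_le W 1 (total_D K)"
    unfolding order_le_def
  proof (intro ballI impI)
    fix z z' assume z: "z \<in> jets W" "z' \<in> jets W"
      and "fst z = fst z' \<and> (\<forall>k\<le>1. snd z k = snd z' k)"
    then have "T z = T z'" by (intro order_leD[OF ord]) auto
    then show "total_D K z = total_D K z'" using K(2) z by simp
  qed
  then have o: "order_le W 0 K" by (rule primitive_order0[OF W K(1)])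
  have TK: "T (one_jet x u v) = jet_pd None K (one_jet x u 0)
      + (\<Sum>i\<in>UNIV. v $ i * jet_pd (Some (0, i)) K (one_jet x u 0))" if "u \<in> W" for x u v
    using that order_le_jet_pd_eq[OF W o, of "one_jet x u v" "one_jet x u 0"]
    by (simp add: K(2) total_D_order_le[OF W o])
  show ?thesis
  proof (rule exI[where x = "\<lambda>x u. K (one_jet x u 0)"],
      rule exI[where x = "\<lambda>i x u. jet_pd (Some (0, i)) K (one_jet x u 0)"], intro conjI allI ballI)
    fix x and u :: "real^'n" assume u: "u \<in> W"
    have "((\<lambda>t. K (jet_shift None t (one_jet x u 0))) has_real_derivative T (one_jet x u 0)) (at 0)"
      using diff_fun_jet_derivative[OF K(1), of "one_jet x u 0" None] u TK[OF u, of x 0] by simp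
    moreover have "jet_shift None t (one_jet x u 0) = one_jet (x + t) u 0" for t
      by (simp add: one_jet_def)
    ultimately show "((\<lambda>x. K (one_jet x u 0)) has_real_derivative T (one_jet x u 0)) (at x)"
      using DERIV_at_within_shift[of "\<lambda>x. K (one_jet x u 0)" "T (one_jet x u 0)" x 0 UNIV]
      by (simp add: add.commute)
  next
    fix x i and u :: "real^'n" assume u: "u \<in> W"
    have "jet_shift (Some (0, i)) t (one_jet x u 0) = one_jet x (u + t *\<^sub>R axis i 1) 0" for t
      by (auto simp: one_jet_def)
    then show "((\<lambda>t. K (one_jet x (u + t *\<^sub>R axis i 1) 0)) has_real_derivative
        jet_pd (Some (0, i)) K (one_jet x u 0)) (at 0)"
      using diff_fun_jet_derivative[OF K(1), of "one_jet x u 0" "Some (0, i)"] u by simp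
  next
    fix x and u v :: "real^'n" assume u: "u \<in> W"
    show "T (one_jet x u v) = T (one_jet x u 0) + (\<Sum>i\<in>UNIV. v $ i * jet_pd (Some (0, i)) K (one_jet x u 0))"
      unfolding TK[OF u, of x v] TK[OF u, of x 0] by simp
  qed
qed

text \<open>Vanishing for \<open>u\<^sub>x = 0\<close> says that \<open>\<kappa>\<^sub>x = 0\<close>.  Then \<open>\<kappa>\<close>, and with it the whole density \<open>u\<^sup>i\<^sub>x \<kappa>\<^sub>i\<close>, is independent
  of \<open>x\<close>, and it is zero at \<open>x = 0\<close>.\<close>

lemma zero_functional_vanishes:
  assumes W: "open W" and T: "zero_functional W T" and ord: "order_le W 1 T"
    and v0: "\<And>x u. u \<in> W \<Longrightarrow> T (one_jet x u 0) = 0"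
    and x0: "\<And>u v. u \<in> W \<Longrightarrow> T (one_jet 0 u v) = 0"
    and u: "u \<in> W"
  shows "T (one_jet x u v) = 0"
proof -
  obtain \<kappa> D where 1: "\<forall>x. \<forall>u\<in>W. ((\<lambda>x. \<kappa> x u) has_real_derivative T (one_jet x u 0)) (at x)"
    and 2: "\<forall>x i. \<forall>u\<in>W. ((\<lambda>t. \<kappa> x (u + t *\<^sub>R axis i 1)) has_real_derivative D i x u) (at 0)"
    and 3: "\<forall>x v. \<forall>u\<in>W. T (one_jet x u v) = T (one_jet x u 0) + (\<Sum>i\<in>UNIV. v $ i * D i x u)"
    using zero_functional_primitive[OF W T ord] by (elim exE conjE) (rule that)
  note 1 = 1[rule_format] and 2 = 2[rule_format] and 3 = 3[rule_format]
  have k: "\<kappa> x u = \<kappa> 0 u" if "u \<in> W" for x u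
    using 1[OF that] unfolding v0[OF that] by (intro DERIV_isconst_all allI)
  have "D i x u = D i 0 u" for i
  proof -
    have "\<forall>\<^sub>F t in nhds 0. \<kappa> x (u + t *\<^sub>R axis i 1) = \<kappa> 0 (u + t *\<^sub>R axis i 1)"
      by (rule eventually_mono[OF eventually_line_in[OF W u]]) (rule k)
    from DERIV_cong_ev[OF refl this refl, THEN iffD1, OF 2[OF u]] 2[OF u] show ?thesis
      by (rule DERIV_unique)
  qed
  then have "T (one_jet x u v) = T (one_jet 0 u v)"
    using 3[OF u] v0[OF u] by simp
  then show ?thesis using x0[OF u] by simp
qed

text \<open>The primitive is \<open>x f(u)\<close> up to a constant: \<open>\<kappa>\<^sub>x = f\<close> gives \<open>\<kappa>(1,u) - \<kappa>(0,u) = f(u)\<close>, while the terms linear in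
  \<open>u\<^sub>x\<close> give \<open>\<kappa>\<^sub>i = x c\<^sub>i\<close> at \<open>x = 0\<close> and \<open>x = 1\<close>.\<close>

lemma zero_functional_linear:
  assumes W: "open W" and T: "zero_functional W T"
    and eq: "\<And>z. z \<in> jets W \<Longrightarrow> T z = order0 0 f z + order1 1 c z"
    and f: "f differentiable (at u)" and u: "u \<in> W"
  shows "pd i f u = c i u"
proof -
  have ord: "order_le W 1 T"
    unfolding order_le_def
  proof (intro ballI impI)
    fix z z' assume "z \<in> jets W" "z' \<in> jets W" "fst z = fst z' \<and> (\<forall>k\<le>1. snd z k = snd z' k)"
    then show "T z = T z'" unfolding eq[OF \<open>z \<in> jets W\<close>] eq[OF \<open>z' \<in> jets W\<close>] order0_def order1_def
      by simp
  qed
  obtain \<kappa> D where 1: "\<forall>x. \<forall>u\<in>W. ((\<lambda>x. \<kappa> x u) has_real_derivative T (one_jet x u 0)) (at x)"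
    and 2: "\<forall>x i. \<forall>u\<in>W. ((\<lambda>t. \<kappa> x (u + t *\<^sub>R axis i 1)) has_real_derivative D i x u) (at 0)"
    and 3: "\<forall>x v. \<forall>u\<in>W. T (one_jet x u v) = T (one_jet x u 0) + (\<Sum>i\<in>UNIV. v $ i * D i x u)"
    using zero_functional_primitive[OF W T ord] by (elim exE conjE) (rule that)
  note 1 = 1[rule_format] and 2 = 2[rule_format] and 3 = 3[rule_format]
  have Tm: "T (one_jet x u v) = f u + x * (\<Sum>k\<in>UNIV. c k u * v $ k)" if "u \<in> W" for x u v
    using that by (simp add: eq order0_def order1_def)
  have k: "\<kappa> 1 u - f u = \<kappa> 0 u" if "u \<in> W" for u
  proof -
    have "((\<lambda>x. \<kappa> x u - x * f u) has_real_derivative 0) (at x)" for x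
      using 1[OF that, of x] unfolding Tm[OF that] by (auto intro!: derivative_eq_intros)
    then have "\<kappa> 1 u - 1 * f u = \<kappa> 0 u - 0 * f u" by (intro DERIV_isconst_all allI)
    then show ?thesis by simp
  qed
  have D: "x * c i u = D i x u" for x
  proof -
    have "(\<Sum>k\<in>UNIV. axis i 1 $ k * (x * c k u)) = (\<Sum>k\<in>UNIV. axis i 1 $ k * D k x u)"
      using 3[OF u, of x "axis i 1"] unfolding Tm[OF u] by (simp add: sum_distrib_left mult_ac)
    then show ?thesis by simp
  qed
  have "((\<lambda>t. \<kappa> 1 (u + t *\<^sub>R axis i 1) - f (u + t *\<^sub>R axis i 1)) has_real_derivative D i 1 u - pd i f u) (at 0)"
    by (intro DERIV_diff 2[OF u] pd_line_real[OF f])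
  moreover have "\<forall>\<^sub>F t in nhds 0. \<kappa> 1 (u + t *\<^sub>R axis i 1) - f (u + t *\<^sub>R axis i 1) = \<kappa> 0 (u + t *\<^sub>R axis i 1)"
    by (rule eventually_mono[OF eventually_line_in[OF W u]]) (rule k)
  ultimately have "((\<lambda>t. \<kappa> 0 (u + t *\<^sub>R axis i 1)) has_real_derivative D i 1 u - pd i f u) (at 0)"
    by (rule DERIV_cong_ev[OF refl _ refl, THEN iffD1, rotated])
  from this 2[OF u] have "D i 1 u - pd i f u = D i 0 u" by (rule DERIV_unique)
  then show ?thesis using D[of 0] D[of 1] by simp
qed

section \<open>Brackets of functionals of order zero\<close>

text \<open>The operator applied to the variational derivative of \<open>\<integral> s(u) dx\<close> has the components
  \<open>ham_con G B s i k u u\<^sup>k\<^sub>x\<close>.  When the density carries an explicit function of \<open>x\<close>, the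
  derivative of that function multiplies \<open>ham_vec G s\<close>, the gradient of \<open>s\<close>.  For a flat metric with its Levi-Civita connection, \<open>ham_con\<close> is the
  covariant derivative of this gradient, and \<open>bform G B p q\<close> is its pairing with \<open>dp\<close>.\<close>

definition ham_vec :: "(real^'n::finite \<Rightarrow> real^'n^'n) \<Rightarrow> (real^'n \<Rightarrow> real) \<Rightarrow> 'n \<Rightarrow> real^'n \<Rightarrow> real" where
  "ham_vec G s i u = (\<Sum>j\<in>UNIV. G u $ i $ j * pd j s u)"

definition ham_con :: "(real^'n::finite \<Rightarrow> real^'n^'n) \<Rightarrow> (real^'n \<Rightarrow> 'n \<Rightarrow> 'n \<Rightarrow> 'n \<Rightarrow> real) \<Rightarrow>
    (real^'n \<Rightarrow> real) \<Rightarrow> 'n \<Rightarrow> 'n \<Rightarrow> real^'n \<Rightarrow> real" where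
  "ham_con G B s i k u = (\<Sum>j\<in>UNIV. G u $ i $ j * pd k (pd j s) u + B u i j k * pd j s u)"

definition pairing :: "(real^'n::finite \<Rightarrow> real^'n^'n) \<Rightarrow> (real^'n \<Rightarrow> real) \<Rightarrow> (real^'n \<Rightarrow> real) \<Rightarrow> real^'n \<Rightarrow> real" where
  "pairing G p q u = (\<Sum>i\<in>UNIV. pd i p u * ham_vec G q i u)"

definition bform :: "(real^'n::finite \<Rightarrow> real^'n^'n) \<Rightarrow> (real^'n \<Rightarrow> 'n \<Rightarrow> 'n \<Rightarrow> 'n \<Rightarrow> real) \<Rightarrow>
    (real^'n \<Rightarrow> real) \<Rightarrow> (real^'n \<Rightarrow> real) \<Rightarrow> 'n \<Rightarrow> real^'n \<Rightarrow> real" where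
  "bform G B p q k u = (\<Sum>i\<in>UNIV. pd i p u * ham_con G B q i k u)"

lemma hyd_op_order0:
  assumes W: "open W" and z: "z \<in> jets W" and s: "smooth_on W s"
  shows "hyd_op G B (\<lambda>j. var_deriv j (order0 c s)) i z
    = order0 (c - 1) (\<lambda>u. c * ham_vec G s i u) z + order1 c (ham_con G B s i) z"
proof -
  have u: "snd z 0 \<in> W" using z by (simp add: jets_def)
  have v: "var_deriv j (order0 c s) z = order0 c (pd j s) z" if "z \<in> jets W" for j z
    by (rule var_deriv_order0[OF W that]) (rule smooth_on_differentiable[OF s W])
  have t: "total_D (var_deriv j (order0 c s)) z
      = order0 (c - 1) (\<lambda>u. c * pd j s u) z + order1 c (\<lambda>k. pd k (pd j s)) z" for j
    by (subst total_D_cong[OF W z v], assumption)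
      (rule total_D_order0[OF smooth_on_differentiable[OF smooth_on_pd[OF s] W u]])
  let ?x = "fst z" and ?u = "snd z 0" and ?v = "snd z 1"
  have "hyd_op G B (\<lambda>j. var_deriv j (order0 c s)) i z =
     (\<Sum>j\<in>UNIV. ?x ^ (c-1) * (c * (G ?u $ i $ j * pd j s ?u))
       + ?x ^ c * (\<Sum>k\<in>UNIV. (G ?u $ i $ j * pd k (pd j s) ?u + B ?u i j k * pd j s ?u) * ?v $ k))"
    unfolding hyd_op_def t v[OF z] order0_def order1_def
    by (intro sum.cong refl) (simp add: algebra_simps sum_distrib_left sum_distrib_right sum.distrib)
  also have "\<dots> = ?x ^ (c-1) * (c * ham_vec G s i ?u) + ?x ^ c * (\<Sum>k\<in>UNIV. ham_con G B s i k ?u * ?v $ k)"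
  proof -
    have "(\<Sum>j\<in>UNIV. \<Sum>k\<in>UNIV. (G ?u $ i $ j * pd k (pd j s) ?u + B ?u i j k * pd j s ?u) * ?v $ k)
        = (\<Sum>k\<in>UNIV. ham_con G B s i k ?u * ?v $ k)"
      by (subst sum.swap) (simp add: ham_con_def sum_distrib_right)
    then show ?thesis
      by (simp add: sum.distrib flip: sum_distrib_left ham_vec_def)
  qed
  finally show ?thesis by (simp add: order0_def order1_def)
qed

lemma bracket_order0:
  assumes W: "open W" and z: "z \<in> jets W" and p: "smooth_on W p" and q: "smooth_on W q"
  shows "bracket G B (order0 a p) (order0 c q) z
    = order0 (a + c - 1) (\<lambda>u. c * pairing G p q u) z + order1 (a + c) (bform G B p q) z"
proof -
  let ?x = "fst z" and ?u = "snd z 0" and ?v = "snd z 1"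
  have v: "var_deriv i (order0 a p) z = order0 a (pd i p) z" for i
    by (rule var_deriv_order0[OF W z]) (rule smooth_on_differentiable[OF p W])
  have x: "?x ^ a * (?x ^ (c - 1) * c) = ?x ^ (a + c - 1) * c"
    by (cases c) (auto simp: power_add)
  have "bracket G B (order0 a p) (order0 c q) z
     = (\<Sum>i\<in>UNIV. ?x ^ a * (?x ^ (c - 1) * c) * (pd i p ?u * ham_vec G q i ?u)
         + ?x ^ (a + c) * (\<Sum>k\<in>UNIV. pd i p ?u * ham_con G B q i k ?u * ?v $ k))"
    unfolding bracket_def v hyd_op_order0[OF W z q] order0_def order1_def
    by (intro sum.cong refl) (simp add: algebra_simps sum_distrib_left power_add)
  also have "\<dots> = ?x ^ (a + c - 1) * c * pairing G p q ?u
     + ?x ^ (a + c) * (\<Sum>i\<in>UNIV. \<Sum>k\<in>UNIV. pd i p ?u * ham_con G B q i k ?u * ?v $ k)"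
    unfolding x by (simp add: sum.distrib pairing_def flip: sum_distrib_left)
  also have "(\<Sum>i\<in>UNIV. \<Sum>k\<in>UNIV. pd i p ?u * ham_con G B q i k ?u * ?v $ k)
     = (\<Sum>k\<in>UNIV. bform G B p q k ?u * ?v $ k)"
    by (subst sum.swap) (simp add: bform_def sum_distrib_right)
  finally show ?thesis unfolding order0_def[of _ _ z] order1_def[of _ _ z] by (simp add: mult_ac)
qed

lemma sum_axis_right [simp]:
  "(\<Sum>j\<in>UNIV. v j * axis i (1::real) $ j) = (v (i::'n::finite) :: real)"
  using sum_axis_real[of i v] by (simp add: mult.commute)

locale hydro_operator =
  fixes W :: "(real^'n::finite) set" and G :: "real^'n \<Rightarrow> real^'n^'n"
    and B :: "real^'n \<Rightarrow> 'n \<Rightarrow> 'n \<Rightarrow> 'n \<Rightarrow> real"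
  assumes W: "open W"
    and G_smooth: "\<And>i j. smooth_on W (\<lambda>u. G u $ i $ j)"
    and B_smooth: "\<And>i j k. smooth_on W (\<lambda>u. B u i j k)"
begin

abbreviation "X \<equiv> ham_vec G"
abbreviation "\<omega> \<equiv> ham_con G B"
abbreviation "g \<equiv> pairing G"
abbreviation "\<beta> \<equiv> bform G B"

lemma ham_vec_smooth: "smooth_on W s \<Longrightarrow> smooth_on W (X s i)"
  unfolding ham_vec_def [abs_def]
  by (intro smooth_on_sum smooth_on_mult W G_smooth smooth_on_pd)

lemma ham_con_smooth: "smooth_on W s \<Longrightarrow> smooth_on W (\<omega> s i k)"
  unfolding ham_con_def [abs_def]
  by (intro smooth_on_sum smooth_on_add smooth_on_mult W G_smooth B_smooth smooth_on_pd)

lemma pairing_smooth: "smooth_on W p \<Longrightarrow> smooth_on W q \<Longrightarrow> smooth_on W (g p q)"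
  unfolding pairing_def [abs_def]
  by (intro smooth_on_sum smooth_on_mult W ham_vec_smooth smooth_on_pd)

lemma bform_smooth: "smooth_on W p \<Longrightarrow> smooth_on W q \<Longrightarrow> smooth_on W (\<beta> p q k)"
  unfolding bform_def [abs_def]
  by (intro smooth_on_sum smooth_on_mult W ham_con_smooth smooth_on_pd)

lemma smooth_diff: "smooth_on W f \<Longrightarrow> u \<in> W \<Longrightarrow> f differentiable (at u)"
  by (rule smooth_on_differentiable[OF _ W])

definition curl :: "(real^'n \<Rightarrow> real) \<Rightarrow> (real^'n \<Rightarrow> real) \<Rightarrow> 'n \<Rightarrow> 'n \<Rightarrow> real^'n \<Rightarrow> real" where
  "curl p q l k u = pd l (\<beta> p q k) u - pd k (\<beta> p q l) u"

text \<open>Only the outer argument \<open>s\<close> is hit by the operator, so no second-order densities appear and the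
  result is at most quadratic in \<open>u\<^sub>x\<close>.\<close>

lemma double_bracket_order0:
  assumes z: "z \<in> jets W" and p: "smooth_on W p" and q: "smooth_on W q" and s: "smooth_on W s"
  shows "bracket G B (bracket G B (order0 a p) (order0 c q)) (order0 d s) z
    = (\<Sum>l\<in>UNIV. (order0 (a + c - 1) (\<lambda>u. c * pd l (g p q) u) z
          + order1 (a + c) (curl p q l) z
          - order0 (a + c - 1) (\<lambda>u. real (a + c) * \<beta> p q l u) z) *
        (order0 (d - 1) (\<lambda>u. d * X s l u) z + order1 d (\<omega> s l) z))"
proof -
  have u: "snd z 0 \<in> W" by (rule jets_projection[OF z])
  let ?P = "\<lambda>z. order0 (a + c - 1) (\<lambda>u. c * g p q u) z + order1 (a + c) (\<beta> p q) z"
  have "var_deriv l (bracket G B (order0 a p) (order0 c q)) z = var_deriv l ?P z" for l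
    by (rule var_deriv_cong[OF W z]) (rule bracket_order0[OF W _ p q])
  also have "var_deriv l ?P z = order0 (a + c - 1) (\<lambda>u. c * pd l (g p q) u) z
          + order1 (a + c) (curl p q l) z
          - order0 (a + c - 1) (\<lambda>u. real (a + c) * \<beta> p q l u) z" for l
  proof -
    have f: "(\<lambda>u. c * g p q u) differentiable (at u)" if "u \<in> W" for u
      by (rule smooth_diff[OF _ that]) (intro smooth_on_mult smooth_on_const W pairing_smooth p q)
    have pf: "pd l (\<lambda>u. c * g p q u) (snd z 0) = c * pd l (g p q) (snd z 0)"
      by (rule pd_cmult[OF smooth_diff[OF pairing_smooth[OF p q] u]])
    have "var_deriv l ?P z = order0 (a + c - 1) (pd l (\<lambda>u. c * g p q u)) z
        + order1 (a + c) (\<lambda>k u. pd l (\<beta> p q k) u - pd k (\<beta> p q l) u) z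
        - order0 (a + c - 1) (\<lambda>u. real (a + c) * \<beta> p q l u) z"
      by (rule var_deriv_order1[OF W z f smooth_diff[OF bform_smooth[OF p q]]])
    then show ?thesis unfolding order0_def pf curl_def .
  qed
  finally have v: "var_deriv l (bracket G B (order0 a p) (order0 c q)) z
      = order0 (a + c - 1) (\<lambda>u. c * pd l (g p q) u) z + order1 (a + c) (curl p q l) z
          - order0 (a + c - 1) (\<lambda>u. real (a + c) * \<beta> p q l u) z" for l .
  show ?thesis
    unfolding bracket_def[of G B "bracket G B (order0 a p) (order0 c q)"] v hyd_op_order0[OF W z s] ..
qed

end

locale hamiltonian_operator = hydro_operator W G B
  for W :: "(real^'n::finite) set" and G B +
  assumes ham: "hamiltonian W G B"
begin

text \<open>From skew-symmetry for \<open>\<integral> p\<close> and \<open>\<integral> x q\<close>: the sum of the two brackets is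
  \<open>g(p,q) + x (\<beta>(p,q) + \<beta>(q,p)) u\<^sub>x\<close>.\<close>

lemma pd_pairing:
  assumes p: "smooth_on W p" and q: "smooth_on W q" and u: "u \<in> W"
  shows "pd k (g p q) u = \<beta> p q k u + \<beta> q p k u"
proof -
  let ?T = "\<lambda>z. bracket G B (order0 0 p) (order0 1 q) z + bracket G B (order0 1 q) (order0 0 p) z"
  have Z: "zero_functional W ?T"
    using ham diff_fun_order0[OF W p, of 0] diff_fun_order0[OF W q, of 1]
    unfolding hamiltonian_def by blast
  have eq: "?T z = order0 0 (g p q) z + order1 1 (\<lambda>k u. \<beta> p q k u + \<beta> q p k u) z"
    if "z \<in> jets W" for z
    unfolding bracket_order0[OF W that p q] bracket_order0[OF W that q p]
    by (simp add: order0_def order1_def algebra_simps sum.distrib)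
  show ?thesis
    by (rule zero_functional_linear[OF W Z eq smooth_diff[OF pairing_smooth[OF p q] u] u])
qed

text \<open>The Jacobi identity for \<open>\<integral> p\<close>, \<open>\<integral> q\<close>, \<open>\<integral> x\<^sup>2 s\<close>.  The weight \<open>x\<^sup>2\<close> is chosen so that every term of the density
  contains both \<open>x\<close> and \<open>u\<^sub>x\<close>; hence the density is zero, and the claim is its part odd in \<open>x\<close>.\<close>

lemma jacobi_identity:
  assumes p: "smooth_on W p" and q: "smooth_on W q" and s: "smooth_on W s" and u: "u \<in> W"
  shows "(\<Sum>l\<in>UNIV. curl p q l k u * X s l u + \<beta> s q l u * \<omega> p l k u - \<beta> s p l u * \<omega> q l k u) = 0"
proof -
  let ?F = "order0 0 p" and ?H = "order0 0 q" and ?L = "order0 2 s"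
  define T where "T z = bracket G B (bracket G B ?F ?H) ?L z + bracket G B (bracket G B ?H ?L) ?F z
      + bracket G B (bracket G B ?L ?F) ?H z" for z
  have Z: "zero_functional W T"
    using ham diff_fun_order0[OF W p, of 0] diff_fun_order0[OF W q, of 0] diff_fun_order0[OF W s, of 2]
    unfolding hamiltonian_def T_def [abs_def] by blast
  define c where "c p q l z = (\<Sum>k\<in>UNIV. curl p q l k (snd z 0) * snd z 1 $ k)" for p q l and z :: "'n jet"
  define V where "V s l z = (\<Sum>k\<in>UNIV. \<omega> s l k (snd z 0) * snd z 1 $ k)" for s l and z :: "'n jet"
  have T: "T z = (\<Sum>l\<in>UNIV. c p q l z * (2 * fst z * X s l (snd z 0) + (fst z)\<^sup>2 * V s l z)
      + (2 * fst z * \<beta> s q l (snd z 0) + (fst z)\<^sup>2 * c q s l z) * V p l z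
      + ((fst z)\<^sup>2 * c s p l z - 2 * fst z * \<beta> s p l (snd z 0)) * V q l z)" if z: "z \<in> jets W" for z
    unfolding T_def double_bracket_order0[OF z p q s] double_bracket_order0[OF z q s p]
      double_bracket_order0[OF z s p q] sum.distrib[symmetric]
    by (intro sum.cong refl)
      (simp add: order0_def order1_def c_def V_def pd_pairing[OF q s jets_projection[OF z]] algebra_simps
        power2_eq_square)
  have "order_le W 1 T"
    unfolding order_le_def
  proof (intro ballI impI)
    fix z z' assume z: "z \<in> jets W" "z' \<in> jets W" and e: "fst z = fst z' \<and> (\<forall>k\<le>1. snd z k = snd z' k)"
    have "snd z 0 = snd z' 0" "snd z 1 = snd z' 1" using e by auto
    then show "T z = T z'" unfolding T[OF z(1)] T[OF z(2)] c_def V_def by (simp add: e)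
  qed
  then have van: "T (one_jet x u v) = 0" for x v
    by (rule zero_functional_vanishes[OF W Z _ _ _ u])
      (simp_all add: T c_def V_def)
  let ?v = "axis k 1"
  \<comment> \<open>The terms quadratic in \<open>u\<^sub>x\<close> carry the factor \<open>x\<^sup>2\<close> and drop out of this difference.\<close>
  have "T (one_jet 1 u ?v) - T (one_jet (-1) u ?v) = 0" by (simp add: van)
  moreover have "T (one_jet 1 u ?v) - T (one_jet (-1) u ?v)
    = 4 * (\<Sum>l\<in>UNIV. curl p q l k u * X s l u + \<beta> s q l u * \<omega> p l k u - \<beta> s p l u * \<omega> q l k u)"
    using u unfolding sum_distrib_left
    by (simp add: T c_def V_def sum_subtractf[symmetric] algebra_simps)
  ultimately show ?thesis by simp
qed

end

section \<open>Flat connections\<close>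

text \<open>The conditions of Dubrovin and Novikov on the coefficients in one coordinate system: \<open>\<gamma>\<close> is the metric
  with upper indices and \<open>\<theta> k y $ i $ j\<close> is the coefficient \<open>b\<^sup>i\<^sup>j\<^sub>k\<close>.  In the matrix notation used here \<open>h\<close> is the metric with
  lower indices and \<open>N k y $ s $ j\<close> is the Christoffel symbol \<open>\<Gamma>\<^sup>j\<^sub>s\<^sub>k\<close>.\<close>

locale flat_connection =
  fixes U :: "(real^'n::finite) set" and \<gamma> :: "real^'n \<Rightarrow> real^'n^'n" and \<theta> :: "'n \<Rightarrow> real^'n \<Rightarrow> real^'n^'n"
  assumes U: "open U"
    and \<gamma>_smooth: "smooth_on U \<gamma>"
    and \<gamma>_det: "\<And>y. y \<in> U \<Longrightarrow> det (\<gamma> y) \<noteq> 0"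
    and \<gamma>_sym: "\<And>y. y \<in> U \<Longrightarrow> transpose (\<gamma> y) = \<gamma> y"
    and \<theta>_diff: "\<And>k y. y \<in> U \<Longrightarrow> \<theta> k differentiable (at y)"
    and metric: "\<And>k y. y \<in> U \<Longrightarrow> pd k \<gamma> y = \<theta> k y + transpose (\<theta> k y)"
    and torsion: "\<And>m i j y. y \<in> U \<Longrightarrow>
      (\<Sum>l\<in>UNIV. \<theta> l y $ m $ j * \<gamma> y $ l $ i) = (\<Sum>l\<in>UNIV. \<theta> l y $ i $ j * \<gamma> y $ l $ m)"
    and curvature: "\<And>i j m c y. y \<in> U \<Longrightarrow>
      (\<Sum>d\<in>UNIV. (pd d (\<theta> c) y - pd c (\<theta> d) y) $ i $ j * \<gamma> y $ d $ m
         + \<theta> d y $ m $ j * \<theta> c y $ d $ i - \<theta> d y $ m $ i * \<theta> c y $ d $ j) = 0"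
begin

definition h :: "real^'n \<Rightarrow> real^'n^'n" where "h y = matrix_inv (\<gamma> y)"

definition N :: "'n \<Rightarrow> real^'n \<Rightarrow> real^'n^'n" where "N k y = - (h y ** \<theta> k y)"

lemma h_smooth: "smooth_on U h"
  unfolding h_def [abs_def] by (rule smooth_on_matrix_inv[OF U \<gamma>_smooth \<gamma>_det])

lemma
  assumes y: "y \<in> U"
  shows h_\<gamma>: "h y ** \<gamma> y = mat 1" and \<gamma>_h: "\<gamma> y ** h y = mat 1"
    and h_sym: "transpose (h y) = h y" and inv_h: "matrix_inv (h y) = \<gamma> y"
    and h_diff: "h differentiable (at y)" and \<gamma>_diff: "\<gamma> differentiable (at y)"
  using matrix_inv_inverse[OF \<gamma>_det[OF y]] transpose_matrix_inv[OF \<gamma>_det[OF y] \<gamma>_sym[OF y]]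
    matrix_inv_inv[OF \<gamma>_det[OF y]] smooth_on_differentiable[OF h_smooth U y]
    smooth_on_differentiable[OF \<gamma>_smooth U y]
  by (simp_all add: h_def [abs_def])

lemma \<theta>_N: "y \<in> U \<Longrightarrow> \<theta> k y = - (\<gamma> y ** N k y)"
  unfolding N_def by (simp add: matrix_distrib matrix_mul_assoc \<gamma>_h)

text \<open>Lowering the indices \<open>i\<close> and \<open>m\<close> in the torsion condition gives the symmetry of \<open>\<Gamma>\<^sup>j\<^sub>s\<^sub>k\<close> in its lower
  indices.\<close>

lemma N_torsion:
  assumes y: "y \<in> U"
  shows "N k y $ s $ j = N s y $ k $ j"
proof -
  define M where "M m i = (\<Sum>l\<in>UNIV. \<theta> l y $ m $ j * \<gamma> y $ l $ i)" for m i
  have M: "M m i = M i m" for m i unfolding M_def by (rule torsion[OF y])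
  have th: "\<theta> k y $ m $ j = (\<Sum>i\<in>UNIV. M m i * h y $ i $ k)" for m k
  proof -
    have "(\<Sum>i\<in>UNIV. M m i * h y $ i $ k) = (\<Sum>l\<in>UNIV. \<theta> l y $ m $ j * (\<gamma> y ** h y) $ l $ k)"
      unfolding M_def matrix_nth sum_distrib_left sum_distrib_right
      by (subst sum.swap) (simp add: mult_ac)
    also have "\<dots> = (\<Sum>l\<in>UNIV. if l = k then \<theta> l y $ m $ j else 0)"
      unfolding \<gamma>_h[OF y] by (intro sum.cong) (auto simp: mat_def)
    finally show ?thesis by simp
  qed
  have N: "N k y $ s $ j = - (\<Sum>m\<in>UNIV. \<Sum>i\<in>UNIV. h y $ s $ m * M m i * h y $ i $ k)" for k s
    unfolding N_def by (simp add: matrix_nth th sum_distrib_left mult_ac)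
  have hs: "h y $ a $ b = h y $ b $ a" for a b using h_sym[OF y] by (metis transpose_nth)
  show ?thesis unfolding N
    by (subst sum.swap, intro arg_cong[where f = uminus] sum.cong refl)
      (metis (no_types, lifting) M hs mult.commute mult.assoc)
qed

lemma pd_h:
  assumes y: "y \<in> U"
  shows "pd k h y = N k y ** h y + h y ** transpose (N k y)"
proof -
  have "pd k (\<lambda>y. h y ** \<gamma> y) y = pd k (\<lambda>y. mat 1) y"
    by (rule pd_cong[OF U y h_\<gamma>])
  then have "pd k h y ** \<gamma> y = - (h y ** (\<theta> k y + transpose (\<theta> k y)))"
    unfolding pd_matrix_mult[OF h_diff[OF y] \<gamma>_diff[OF y]] metric[OF y]
    by (simp add: eq_neg_iff_add_eq_0)
  then have "(pd k h y ** \<gamma> y) ** h y = - (h y ** (\<theta> k y + transpose (\<theta> k y))) ** h y" by simp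
  then have "pd k h y = - (h y ** \<theta> k y) ** h y - h y ** (transpose (\<theta> k y) ** h y)"
    unfolding matrix_mul_assoc[symmetric] \<gamma>_h[OF y]
    by (simp add: matrix_distrib matrix_mul_assoc)
  moreover have "transpose (N k y) = - (transpose (\<theta> k y) ** h y)"
    unfolding N_def by (simp add: transpose_uminus matrix_transpose_mul h_sym[OF y])
  ultimately show ?thesis by (simp add: N_def matrix_distrib)
qed

text \<open>Uniqueness of the Levi-Civita connection: \<open>N\<close> is symmetric and compatible with \<open>h\<close>, so in the
  Christoffel formula all terms cancel except for two equal ones.\<close>

lemma christoffel_h:
  assumes y: "y \<in> U"
  shows "christoffel h k i j y = N i y $ j $ k"
proof -
  define L where "L i j l = (N i y ** h y) $ j $ l" for i j l
  have hs: "h y $ a $ b = h y $ b $ a" for a b using h_sym[OF y] by (metis transpose_nth)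
  have L1: "L i j l = L j i l" for i j l
    unfolding L_def matrix_nth N_torsion[OF y, of i j] ..
  have pdh: "pd i (\<lambda>y. h y $ j $ l) y = L i j l + L i l j" for i j l
    unfolding pd_matrix_nth[OF h_diff[OF y]] pd_h[OF y] L_def
    by (simp add: matrix_nth mult.commute hs)
  have "christoffel h k i j y = (\<Sum>l\<in>UNIV. \<gamma> y $ k $ l * (2 * L i j l)) / 2"
    unfolding christoffel_def inv_h[OF y] pdh
    using L1 by (intro arg_cong[where f = "\<lambda>x. x / 2"] sum.cong refl arg_cong2[where f = "(*)"])
      (simp add: L1[of l] L1[of j i])
  also have "\<dots> = (\<Sum>l\<in>UNIV. L i j l * \<gamma> y $ l $ k)"
  proof -
    have "\<gamma> y $ k $ l = \<gamma> y $ l $ k" for l using \<gamma>_sym[OF y] by (metis transpose_nth)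
    then show ?thesis by (simp add: sum_divide_distrib mult_ac)
  qed
  also have "\<dots> = ((N i y ** h y) ** \<gamma> y) $ j $ k" unfolding L_def by (simp only: matrix_nth[of "N i y ** h y"])
  finally show ?thesis by (simp add: matrix_mul_assoc[symmetric] h_\<gamma>[OF y])
qed

lemma N_diff: "y \<in> U \<Longrightarrow> N k differentiable (at y)"
  and pd_N: "y \<in> U \<Longrightarrow> pd i (N k) y = - (pd i h y ** \<theta> k y + h y ** pd i (\<theta> k) y)"
proof -
  assume y: "y \<in> U"
  have p: "(\<lambda>y. h y ** \<theta> k y) differentiable (at y)"
    using bounded_bilinear.FDERIV[OF bounded_bilinear_matrix_mult has_derivative_pd has_derivative_pd, OF h_diff[OF y] \<theta>_diff[OF y]]
    by (rule differentiableI)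
  show "N k differentiable (at y)" unfolding N_def [abs_def] by (rule differentiable_minus[OF p])
  show "pd i (N k) y = - (pd i h y ** \<theta> k y + h y ** pd i (\<theta> k) y)"
    unfolding N_def [abs_def]
    using pd_linear(1)[OF bounded_linear_minus[OF bounded_linear_ident] p]
    by (simp add: pd_matrix_mult[OF h_diff[OF y] \<theta>_diff[OF y]])
qed

text \<open>The curvature condition with the index \<open>m\<close> lowered.\<close>

lemma curl_\<theta>:
  assumes y: "y \<in> U"
  shows "pd r (\<theta> c) y - pd c (\<theta> r) y = transpose (transpose (N r y) ** \<theta> c y) - transpose (N r y) ** \<theta> c y"
proof -
  have "(pd r (\<theta> c) y - pd c (\<theta> r) y) $ i $ j
      = (transpose (transpose (N r y) ** \<theta> c y) - transpose (N r y) ** \<theta> c y) $ i $ j" for i j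
  proof -
    let ?D = "\<lambda>d. (pd d (\<theta> c) y - pd c (\<theta> d) y) $ i $ j"
    have NN: "(\<Sum>m\<in>UNIV. h y $ r $ m * \<theta> d y $ m $ a) = - N r y $ d $ a" for d a
      using N_torsion[OF y, of r d a] by (simp add: N_def matrix_nth)
    have D: "(\<Sum>m\<in>UNIV. h y $ r $ m * \<gamma> y $ d $ m) = (if d = r then 1 else 0)" for d
    proof -
      have "\<gamma> y $ d $ m = \<gamma> y $ m $ d" for m using \<gamma>_sym[OF y] by (metis transpose_nth)
      then have "(\<Sum>m\<in>UNIV. h y $ r $ m * \<gamma> y $ d $ m) = (h y ** \<gamma> y) $ r $ d" by (simp add: matrix_nth)
      then show ?thesis unfolding h_\<gamma>[OF y] by (simp add: mat_def)
    qed
    have "0 = (\<Sum>m\<in>UNIV. h y $ r $ m * (\<Sum>d\<in>UNIV. ?D d * \<gamma> y $ d $ m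
         + \<theta> d y $ m $ j * \<theta> c y $ d $ i - \<theta> d y $ m $ i * \<theta> c y $ d $ j))"
      by (simp only: curvature[OF y]) simp
    also have "\<dots> = (\<Sum>d\<in>UNIV. \<Sum>m\<in>UNIV. h y $ r $ m * (?D d * \<gamma> y $ d $ m
         + \<theta> d y $ m $ j * \<theta> c y $ d $ i - \<theta> d y $ m $ i * \<theta> c y $ d $ j))"
      unfolding sum_distrib_left by (rule sum.swap)
    also have "\<dots> = (\<Sum>d\<in>UNIV. ?D d * (\<Sum>m\<in>UNIV. h y $ r $ m * \<gamma> y $ d $ m)
        + (\<Sum>m\<in>UNIV. h y $ r $ m * \<theta> d y $ m $ j) * \<theta> c y $ d $ i
        - (\<Sum>m\<in>UNIV. h y $ r $ m * \<theta> d y $ m $ i) * \<theta> c y $ d $ j)"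
      by (intro sum.cong refl)
        (simp add: sum_distrib_left sum_distrib_right algebra_simps sum.distrib sum_subtractf)
    also have "\<dots> = (\<Sum>d\<in>UNIV. (if d = r then ?D d else 0) - N r y $ d $ j * \<theta> c y $ d $ i
        + N r y $ d $ i * \<theta> c y $ d $ j)"
      unfolding NN D by (intro sum.cong refl) simp
    also have "\<dots> = ?D r - (\<Sum>d\<in>UNIV. N r y $ d $ j * \<theta> c y $ d $ i) + (\<Sum>d\<in>UNIV. N r y $ d $ i * \<theta> c y $ d $ j)"
      by (simp add: sum.distrib sum_subtractf)
    finally show ?thesis by (simp add: matrix_nth)
  qed
  then show ?thesis by (simp add: vec_eq_iff)
qed

text \<open>The Riemann tensor is the matrix \<open>\<partial>\<^sub>iN\<^sub>j - \<partial>\<^sub>jN\<^sub>i + N\<^sub>jN\<^sub>i - N\<^sub>iN\<^sub>j\<close>.  Differentiating \<open>N = - h \<theta>\<close> and inserting the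
  formulas for the derivatives of \<open>h\<close> and \<open>\<theta>\<close> makes it vanish identically.\<close>

lemma riemann_h:
  assumes y: "y \<in> U"
  shows "riemann h l k i j y = 0"
proof -
  let ?N = "\<lambda>k. N k y" and ?t = "\<lambda>k. \<theta> k y" and ?h = "h y"
  have ch: "christoffel h l a b y = ?N a $ b $ l" for l a b by (rule christoffel_h[OF y])
  have "pd a (christoffel h l b k) y = pd a (\<lambda>y. N b y $ k $ l) y" for a b
    by (rule pd_cong[OF U y christoffel_h])
  then have pch: "pd a (christoffel h l b k) y = pd a (N b) y $ k $ l" for a b
    by (simp add: pd_matrix_nth[OF N_diff[OF y]])
  have "riemann h l k i j y
      = (pd i (N j) y - pd j (N i) y + ?N j ** ?N i - ?N i ** ?N j) $ k $ l"
    unfolding riemann_def pch ch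
    by (simp add: matrix_nth sum_subtractf N_torsion[OF y, of i] N_torsion[OF y, of j] mult.commute)
  also have "pd i (N j) y - pd j (N i) y + ?N j ** ?N i - ?N i ** ?N j = 0"
  proof -
    have hN: "?h ** ?t a = - ?N a" for a by (simp add: N_def)
    have "pd i (N j) y - pd j (N i) y
      = ?N i ** ?N j - ?N j ** ?N i - ?h ** (transpose (?N i) ** ?t j - transpose (?N j) ** ?t i)
        - ?h ** (pd i (\<theta> j) y - pd j (\<theta> i) y)"
      unfolding pd_N[OF y] pd_h[OF y]
      by (simp add: matrix_mul_assoc[symmetric] hN matrix_distrib)
    also have "\<dots> = ?N i ** ?N j - ?N j ** ?N i
       - ?h ** (transpose (transpose (?N i) ** ?t j) - transpose (?N j) ** ?t i)"
      unfolding curl_\<theta>[OF y] by (simp add: matrix_distrib)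
    also have "transpose (transpose (?N i) ** ?t j) = transpose (?N j) ** ?t i"
      unfolding \<theta>_N[OF y]
      by (simp add: matrix_transpose_mul transpose_uminus matrix_distrib \<gamma>_sym[OF y] matrix_mul_assoc)
    finally show ?thesis by (simp add: matrix_distrib)
  qed
  finally show ?thesis by simp
qed

lemma flat_h: "flat_metric_on U h"
  unfolding flat_metric_on_def
  using h_smooth h_sym riemann_h det_matrix_inv[OF \<gamma>_det] by (simp add: h_def)

end

section \<open>Hamiltonian operators have flat leading coefficients\<close>

context hamiltonian_operator
begin

text \<open>In \<open>jacobi_identity\<close> the function \<open>p\<close> is replaced by \<open>p\<^sup>2\<close>, and \<open>2 p\<close> times the original identity is
  subtracted.  The terms that contain \<open>\<beta>(p,q)\<^sub>k\<close> cancel by the symmetry of \<open>G\<close>; there remains \<open>2 \<partial>\<^sub>kp\<close> times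
  the difference of the two sides.\<close>

lemma torsion_free:
  assumes sym: "\<And>u i j. u \<in> W \<Longrightarrow> G u $ i $ j = G u $ j $ i"
    and p: "smooth_on W p" and q: "smooth_on W q" and s: "smooth_on W s" and u: "u \<in> W"
    and nz: "pd k p u \<noteq> 0"
  shows "(\<Sum>l\<in>UNIV. \<beta> s q l u * X p l u) = (\<Sum>l\<in>UNIV. \<beta> p q l u * X s l u)"
proof -
  let ?pp = "\<lambda>v. p v * p v"
  have pp: "smooth_on W ?pp" by (rule smooth_on_mult[OF W p p])
  note dp = smooth_diff[OF p] and dpd = smooth_diff[OF smooth_on_pd[OF p]]
    and d\<beta> = smooth_diff[OF bform_smooth[OF p q]]
  have pd_pp: "pd i ?pp v = 2 * p v * pd i p v" if "v \<in> W" for i v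
    by (simp add: pd_mult[OF dp dp] that)
  have pd2_pp: "pd i (pd j ?pp) u = 2 * pd i p u * pd j p u + 2 * p u * pd i (pd j p) u" for i j
  proof -
    have "pd i (pd j ?pp) u = pd i (\<lambda>v. 2 * (p v * pd j p v)) u"
      by (rule pd_cong[OF W u]) (simp add: pd_pp)
    also have "\<dots> = 2 * pd i (\<lambda>v. p v * pd j p v) u"
      by (rule pd_cmult[OF smooth_diff[OF smooth_on_mult[OF W p smooth_on_pd[OF p]] u]])
    finally show ?thesis by (simp add: pd_mult[OF dp[OF u] dpd[OF u]] algebra_simps)
  qed
  have \<beta>_pp: "\<beta> ?pp q i v = 2 * (p v * \<beta> p q i v)" if "v \<in> W" for i v
    unfolding bform_def pd_pp[OF that] by (simp add: sum_distrib_left mult_ac)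
  have pd_\<beta>: "pd l (\<beta> ?pp q i) u = 2 * (pd l p u * \<beta> p q i u + p u * pd l (\<beta> p q i) u)" for l i
  proof -
    have "pd l (\<beta> ?pp q i) u = pd l (\<lambda>v. 2 * (p v * \<beta> p q i v)) u"
      by (rule pd_cong[OF W u \<beta>_pp])
    also have "\<dots> = 2 * pd l (\<lambda>v. p v * \<beta> p q i v) u"
      by (rule pd_cmult[OF smooth_diff[OF smooth_on_mult[OF W p bform_smooth[OF p q]] u]])
    finally show ?thesis by (simp add: pd_mult[OF dp[OF u] d\<beta>[OF u]])
  qed
  have b1_pp: "\<omega> ?pp i l u = 2 * p u * \<omega> p i l u + 2 * pd l p u * X p i u" for i l
    unfolding ham_con_def ham_vec_def pd2_pp pd_pp[OF u]
    by (simp add: sum_distrib_left algebra_simps sum.distrib)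
  have \<beta>s_pp: "\<beta> s ?pp l u = 2 * p u * \<beta> s p l u + 2 * pd l p u * g s p u" for l
    unfolding bform_def pairing_def b1_pp
    by (simp add: sum_distrib_left algebra_simps sum.distrib)
  have c_pp: "curl ?pp q l k u = 2 * (pd l p u * \<beta> p q k u - pd k p u * \<beta> p q l u) + 2 * p u * curl p q l k u" for l
    unfolding curl_def pd_\<beta> by (simp add: algebra_simps)
  have gsym: "g s p u = (\<Sum>l\<in>UNIV. pd l p u * X s l u)"
    unfolding pairing_def ham_vec_def sum_distrib_left
    by (subst sum.swap) (simp add: mult_ac sym[OF u])
  have "0 = (\<Sum>l\<in>UNIV. curl ?pp q l k u * X s l u + \<beta> s q l u * \<omega> ?pp l k u - \<beta> s ?pp l u * \<omega> q l k u)
     - 2 * p u * (\<Sum>l\<in>UNIV. curl p q l k u * X s l u + \<beta> s q l u * \<omega> p l k u - \<beta> s p l u * \<omega> q l k u)"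
    by (simp add: jacobi_identity[OF pp q s u] jacobi_identity[OF p q s u])
  also have "\<dots> = (\<Sum>l\<in>UNIV. 2 * (pd l p u * X s l u) * \<beta> p q k u - 2 * pd k p u * (\<beta> p q l u * X s l u)
      + 2 * pd k p u * (\<beta> s q l u * X p l u) - 2 * g s p u * (pd l p u * \<omega> q l k u))"
    unfolding sum_distrib_left sum_subtractf[symmetric] c_pp b1_pp \<beta>s_pp
    by (intro sum.cong refl) (simp add: algebra_simps)
  also have "\<dots> = 2 * g s p u * \<beta> p q k u - 2 * pd k p u * (\<Sum>l\<in>UNIV. \<beta> p q l u * X s l u)
      + 2 * pd k p u * (\<Sum>l\<in>UNIV. \<beta> s q l u * X p l u) - 2 * g s p u * \<beta> p q k u"
  proof -
    have 1: "(\<Sum>l\<in>UNIV. 2 * (pd l p u * X s l u) * \<beta> p q k u) = 2 * g s p u * \<beta> p q k u"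
      by (simp add: gsym sum_distrib_left sum_distrib_right)
    have 2: "(\<Sum>l\<in>UNIV. 2 * g s p u * (pd l p u * \<omega> q l k u)) = 2 * g s p u * \<beta> p q k u"
      by (simp add: bform_def sum_distrib_left)
    show ?thesis unfolding sum.distrib sum_subtractf 1 2 by (simp add: sum_distrib_left)
  qed
  finally show ?thesis using nz by simp
qed

text \<open>The matrices \<open>\<theta> c\<close> below are the components, in the coordinates \<open>R\<close>, of the one-forms \<open>\<beta>(R\<^sup>a,R\<^sup>b)\<close>.  Inserting the
  coordinate functions into \<open>pd_pairing\<close>, \<open>torsion_free\<close> and \<open>jacobi_identity\<close> gives the three conditions
  of \<open>flat_connection\<close>, after cancelling the invertible Jacobian.\<close>

lemma flat_in_coordinates:
  fixes R :: "real^'n \<Rightarrow> real^'n" and \<gamma> :: "real^'n \<Rightarrow> real^'n^'n"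
  assumes sym: "\<And>u i j. u \<in> W \<Longrightarrow> G u $ i $ j = G u $ j $ i"
    and R: "diffeo_on W U R"
    and \<gamma>_smooth: "smooth_on U \<gamma>" and \<gamma>_det: "\<And>y. y \<in> U \<Longrightarrow> det (\<gamma> y) \<noteq> 0"
    and \<gamma>: "\<And>u a b. u \<in> W \<Longrightarrow> \<gamma> (R u) $ a $ b = g (\<lambda>u. R u $ a) (\<lambda>u. R u $ b) u"
  shows "flat_metric_on U (\<lambda>y. matrix_inv (\<gamma> y))"
proof -
  define Q where "Q = inv_into W R"
  define r where "r a u = R u $ a" for a u
  have U: "open U" and bij: "bij_betw R W U" and R_smooth: "smooth_on W R" and Q_smooth: "smooth_on U Q"
    using R unfolding diffeo_on_def Q_def by auto
  have QW: "Q y \<in> W" and RQ: "R (Q y) = y" if "y \<in> U" for y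
    using bij that unfolding Q_def by (auto simp: bij_betw_def inv_into_into f_inv_into_f)
  have QR: "Q (R u) = u" and RU: "R u \<in> U" if "u \<in> W" for u
    using bij that unfolding Q_def by (auto simp: bij_betw_def inv_into_f_f)
  have r_smooth: "smooth_on W (r a)" for a
    unfolding r_def [abs_def] by (rule smooth_on_nth[OF W R_smooth])
  have Q_nth: "smooth_on U (\<lambda>y. Q y $ k)" for k by (rule smooth_on_nth[OF U Q_smooth])
  note dR = smooth_diff[OF R_smooth] and dQ = smooth_on_differentiable[OF Q_smooth U]
    and dr = smooth_diff[OF r_smooth] and dQn = smooth_on_differentiable[OF Q_nth U]
  have chain: "pd k (\<lambda>u. f (R u)) u = (\<Sum>a\<in>UNIV. pd a f (R u) * pd k (r a) u)"
    if "f differentiable (at (R u))" "u \<in> W" for f k u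
    using pd_compose(1)[OF that(1) dR[OF that(2)]] by (simp add: r_def [abs_def])
  have JS: "(\<Sum>k\<in>UNIV. pd k (r a) (Q y) * pd c (\<lambda>y. Q y $ k) y) = (if a = c then 1 else 0)"
    if y: "y \<in> U" for a c y
  proof -
    have "(\<Sum>k\<in>UNIV. pd k (r a) (Q y) * pd c (\<lambda>y. Q y $ k) y) = pd c (\<lambda>y. r a (Q y)) y"
      using pd_compose(1)[OF dr[OF QW[OF y]] dQ[OF y]] by simp
    also have "\<dots> = pd c (\<lambda>y. y $ a) y"
      by (rule pd_cong[OF U y]) (simp add: r_def RQ)
    also have "\<dots> = axis c 1 $ a"
      by (rule pd_eqI[OF bounded_linear_imp_has_derivative[OF bounded_linear_vec_nth]])
    finally show ?thesis by (simp add: axis_def)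
  qed
  have SJ: "(\<Sum>c\<in>UNIV. pd c (\<lambda>y. Q y $ k) (R u) * pd l (r c) u) = (if k = l then 1 else 0)"
    if u: "u \<in> W" for k l u
  proof -
    have "(\<Sum>c\<in>UNIV. pd c (\<lambda>y. Q y $ k) (R u) * pd l (r c) u) = pd l (\<lambda>u. Q (R u) $ k) u"
      using chain[OF dQn[OF RU[OF u]] u] by simp
    also have "\<dots> = pd l (\<lambda>u. u $ k) u"
      by (rule pd_cong[OF W u]) (simp add: QR)
    also have "\<dots> = axis l 1 $ k"
      by (rule pd_eqI[OF bounded_linear_imp_has_derivative[OF bounded_linear_vec_nth]])
    finally show ?thesis by (simp add: axis_def)
  qed
  have cancel: "v d = 0" if y: "y \<in> U" and z: "\<And>k. (\<Sum>c\<in>UNIV. v c * pd k (r c) (Q y)) = 0" for v :: "'n \<Rightarrow> real" and d y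
  proof -
    have "0 = (\<Sum>k\<in>UNIV. (\<Sum>c\<in>UNIV. v c * pd k (r c) (Q y)) * pd d (\<lambda>y. Q y $ k) y)"
      by (simp add: z)
    also have "\<dots> = (\<Sum>c\<in>UNIV. v c * (\<Sum>k\<in>UNIV. pd k (r c) (Q y) * pd d (\<lambda>y. Q y $ k) y))"
      unfolding sum_distrib_left sum_distrib_right by (subst sum.swap) (simp add: mult_ac)
    also have "\<dots> = (\<Sum>c\<in>UNIV. if c = d then v c else 0)"
      unfolding JS[OF y] by (intro sum.cong) auto
    finally show ?thesis by simp
  qed
  \<comment> \<open>The one-forms \<open>\<beta>(R\<^sup>a,R\<^sup>b)\<close>, expressed in the basis \<open>dR\<^sup>c\<close> and moved to \<open>U\<close>.\<close>
  define \<theta> :: "'n \<Rightarrow> real^'n \<Rightarrow> real^'n^'n"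
    where "\<theta> c y = (\<chi> a b. \<Sum>k\<in>UNIV. \<beta> (r a) (r b) k (Q y) * pd c (\<lambda>y. Q y $ k) y)" for c y
  have \<gamma>_r: "g (r a) (r b) u = \<gamma> (R u) $ a $ b" if "u \<in> W" for u a b
    unfolding r_def [abs_def] by (rule \<gamma>[OF that, symmetric])
  have \<beta>_\<theta>: "\<beta> (r a) (r b) l u = (\<Sum>c\<in>UNIV. \<theta> c (R u) $ a $ b * pd l (r c) u)" if u: "u \<in> W" for a b l u
  proof -
    have "(\<Sum>c\<in>UNIV. \<theta> c (R u) $ a $ b * pd l (r c) u)
      = (\<Sum>k\<in>UNIV. \<beta> (r a) (r b) k u * (\<Sum>c\<in>UNIV. pd c (\<lambda>y. Q y $ k) (R u) * pd l (r c) u))"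
      unfolding \<theta>_def sum_distrib_left sum_distrib_right
      by (subst sum.swap) (simp add: mult_ac QR[OF u] sum_distrib_left sum_distrib_right)
    also have "\<dots> = (\<Sum>k\<in>UNIV. if k = l then \<beta> (r a) (r b) k u else 0)"
      unfolding SJ[OF u] by (intro sum.cong) auto
    finally show ?thesis by simp
  qed
  have d\<theta>: "(\<lambda>y. \<theta> c y $ a $ b) differentiable (at y)" if y: "y \<in> U" for a b c y
    unfolding \<theta>_def vec_lambda_beta
    by (intro differentiable_sum finite ballI)
      (rule differentiable_mult[OF
        pd_compose(2)[OF smooth_diff[OF bform_smooth[OF r_smooth r_smooth] QW[OF y]] dQ[OF y]]
        smooth_on_differentiable[OF smooth_on_pd[OF Q_nth] U y]])
  interpret flat_connection U \<gamma> \<theta>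
  proof
    show "open U" by (rule U)
    show "smooth_on U \<gamma>" by (rule \<gamma>_smooth)
    fix y assume y: "y \<in> U"
    note u = QW[OF y] and Ru = RQ[OF y]
    have gs: "\<gamma> y $ a $ b = g (r a) (r b) (Q y)" for a b
      using \<gamma>_r[OF u, of a b] Ru by simp
    have \<gamma>s: "\<gamma> y $ a $ b = \<gamma> y $ b $ a" for a b
      unfolding gs pairing_def ham_vec_def sum_distrib_left
      by (subst sum.swap) (simp add: mult_ac sym[OF u])
    have th: "\<beta> (r a) (r b) l (Q y) = (\<Sum>c\<in>UNIV. \<theta> c y $ a $ b * pd l (r c) (Q y))" for a b l
      using \<beta>_\<theta>[OF u, of a b l] Ru by simp
    show "det (\<gamma> y) \<noteq> 0" by (rule \<gamma>_det[OF y])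
    show "transpose (\<gamma> y) = \<gamma> y" using \<gamma>s by (simp add: vec_eq_iff)
    show \<theta>_diff: "\<theta> k differentiable (at y)" for k
      by (intro differentiable_vecI d\<theta> y)
    have d\<gamma>: "\<gamma> differentiable (at y)" by (rule smooth_on_differentiable[OF \<gamma>_smooth U y])
    have d\<gamma>n: "(\<lambda>y. \<gamma> y $ a $ b) differentiable (at (R (Q y)))" for a b
      unfolding Ru by (intro pd_linear(2)[OF bounded_linear_vec_nth] d\<gamma>)
    show "pd k \<gamma> y = \<theta> k y + transpose (\<theta> k y)" for k
    proof -
      have "pd k \<gamma> y $ a $ b - (\<theta> k y $ a $ b + \<theta> k y $ b $ a) = 0" for a b
      proof (rule cancel[OF y, where v = "\<lambda>c. pd c \<gamma> y $ a $ b - (\<theta> c y $ a $ b + \<theta> c y $ b $ a)"])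
        fix l
        have "pd l (\<lambda>u. \<gamma> (R u) $ a $ b) (Q y) = pd l (g (r a) (r b)) (Q y)"
          by (rule pd_cong[OF W u]) (rule \<gamma>_r[symmetric])
        then have "(\<Sum>c\<in>UNIV. pd c \<gamma> y $ a $ b * pd l (r c) (Q y)) = \<beta> (r a) (r b) l (Q y) + \<beta> (r b) (r a) l (Q y)"
          unfolding pd_pairing[OF r_smooth r_smooth u] chain[OF d\<gamma>n u] Ru pd_matrix_nth[OF d\<gamma>] .
        then show "(\<Sum>c\<in>UNIV. (pd c \<gamma> y $ a $ b - (\<theta> c y $ a $ b + \<theta> c y $ b $ a)) * pd l (r c) (Q y)) = 0"
          unfolding th by (simp add: algebra_simps sum_subtractf sum.distrib)
      qed
      then show ?thesis by (simp add: vec_eq_iff)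
    qed
    have X_r: "(\<Sum>l\<in>UNIV. pd l (r c) (Q y) * X (r i) l (Q y)) = \<gamma> y $ c $ i" for c i
      unfolding gs pairing_def ..
    show "(\<Sum>l\<in>UNIV. \<theta> l y $ m $ j * \<gamma> y $ l $ i) = (\<Sum>l\<in>UNIV. \<theta> l y $ i $ j * \<gamma> y $ l $ m)" for m i j
    proof -
      have e: "(\<Sum>l\<in>UNIV. \<beta> (r m) (r j) l (Q y) * X (r i) l (Q y)) = (\<Sum>l\<in>UNIV. \<theta> l y $ m $ j * \<gamma> y $ l $ i)" for m i
        unfolding th X_r[symmetric] sum_distrib_left sum_distrib_right
        by (subst sum.swap) (simp add: mult_ac)
      have "\<exists>k. pd k (r i) (Q y) \<noteq> 0"
      proof (rule ccontr)
        assume "\<not> ?thesis"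
        then show False using JS[OF y, of i i] by simp
      qed
      then obtain k where "pd k (r i) (Q y) \<noteq> 0" ..
      then show ?thesis
        using torsion_free[OF sym r_smooth r_smooth r_smooth u, of k i m j] unfolding e by blast
    qed
    show "(\<Sum>d\<in>UNIV. (pd d (\<theta> c) y - pd c (\<theta> d) y) $ i $ j * \<gamma> y $ d $ m
         + \<theta> d y $ m $ j * \<theta> c y $ d $ i - \<theta> d y $ m $ i * \<theta> c y $ d $ j) = 0" for i j m c
    proof (rule cancel[OF y, where v = "\<lambda>c. \<Sum>d\<in>UNIV. (pd d (\<theta> c) y - pd c (\<theta> d) y) $ i $ j * \<gamma> y $ d $ m
         + \<theta> d y $ m $ j * \<theta> c y $ d $ i - \<theta> d y $ m $ i * \<theta> c y $ d $ j"])
      fix k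
      have dth: "(\<lambda>y. \<theta> c y $ i $ j) differentiable (at (R (Q y)))" for c
        unfolding Ru by (rule d\<theta>[OF y])
      have dJ: "pd l (r c) differentiable (at (Q y))" for l c
        by (rule smooth_diff[OF smooth_on_pd[OF r_smooth] u])
      \<comment> \<open>The second derivatives of \<open>R\<^sup>c\<close> that appear here cancel in the curl.\<close>
      have pd\<beta>: "pd l (\<beta> (r i) (r j) k) (Q y) = (\<Sum>c\<in>UNIV. (\<Sum>d\<in>UNIV. pd d (\<theta> c) y $ i $ j * pd l (r d) (Q y)) * pd k (r c) (Q y)
          + \<theta> c y $ i $ j * pd l (pd k (r c)) (Q y))" for l k
      proof -
        have "pd l (\<beta> (r i) (r j) k) (Q y) = pd l (\<lambda>u. \<Sum>c\<in>UNIV. \<theta> c (R u) $ i $ j * pd k (r c) u) (Q y)"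
          by (rule pd_cong[OF W u \<beta>_\<theta>])
        also have "\<dots> = (\<Sum>c\<in>UNIV. pd l (\<lambda>u. \<theta> c (R u) $ i $ j * pd k (r c) u) (Q y))"
          by (intro pd_sum differentiable_mult pd_compose(2)[OF dth dR[OF u]] dJ)
        also have "\<dots> = (\<Sum>c\<in>UNIV. (\<Sum>d\<in>UNIV. pd d (\<theta> c) y $ i $ j * pd l (r d) (Q y)) * pd k (r c) (Q y)
          + \<theta> c y $ i $ j * pd l (pd k (r c)) (Q y))"
          unfolding pd_mult[OF pd_compose(2)[OF dth dR[OF u]] dJ] chain[OF dth u] Ru pd_matrix_nth[OF \<theta>_diff] ..
        finally show ?thesis .
      qed
      have 1: "(\<Sum>l\<in>UNIV. curl (r i) (r j) l k (Q y) * X (r m) l (Q y))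
        = (\<Sum>c\<in>UNIV. (\<Sum>d\<in>UNIV. (pd d (\<theta> c) y - pd c (\<theta> d) y) $ i $ j * \<gamma> y $ d $ m) * pd k (r c) (Q y))"
      proof -
        have A: "(\<Sum>c\<in>UNIV. (\<Sum>d\<in>UNIV. pd d (\<theta> c) y $ i $ j * pd k (r d) (Q y)) * pd l (r c) (Q y))
          = (\<Sum>c\<in>UNIV. (\<Sum>d\<in>UNIV. pd c (\<theta> d) y $ i $ j * pd l (r d) (Q y)) * pd k (r c) (Q y))" for l
          unfolding sum_distrib_right by (subst sum.swap) (simp add: mult_ac)
        have cu: "curl (r i) (r j) l k (Q y)
          = (\<Sum>c\<in>UNIV. (\<Sum>d\<in>UNIV. (pd d (\<theta> c) y - pd c (\<theta> d) y) $ i $ j * pd l (r d) (Q y)) * pd k (r c) (Q y))" for l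
          unfolding curl_def pd\<beta> sum.distrib A
          by (simp add: pd_commute_real[OF W r_smooth u, of l k] sum_subtractf left_diff_distrib)
        have "(\<Sum>l\<in>UNIV. curl (r i) (r j) l k (Q y) * X (r m) l (Q y))
          = (\<Sum>c\<in>UNIV. \<Sum>l\<in>UNIV. (\<Sum>d\<in>UNIV. (pd d (\<theta> c) y - pd c (\<theta> d) y) $ i $ j * pd l (r d) (Q y)) * pd k (r c) (Q y) * X (r m) l (Q y))"
          unfolding cu sum_distrib_right by (rule sum.swap)
        also have "\<dots> = (\<Sum>c\<in>UNIV. (\<Sum>d\<in>UNIV. (pd d (\<theta> c) y - pd c (\<theta> d) y) $ i $ j * (\<Sum>l\<in>UNIV. pd l (r d) (Q y) * X (r m) l (Q y))) * pd k (r c) (Q y))"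
          unfolding sum_distrib_left sum_distrib_right
          by (rule sum.cong[OF refl], subst sum.swap, simp add: mult_ac)
        finally show ?thesis unfolding X_r .
      qed
      have 2: "(\<Sum>l\<in>UNIV. \<beta> (r m) (r a) l (Q y) * \<omega> (r b) l k (Q y))
        = (\<Sum>c\<in>UNIV. (\<Sum>d\<in>UNIV. \<theta> d y $ m $ a * \<theta> c y $ d $ b) * pd k (r c) (Q y))" for a b
      proof -
        have "(\<Sum>l\<in>UNIV. \<beta> (r m) (r a) l (Q y) * \<omega> (r b) l k (Q y))
          = (\<Sum>d\<in>UNIV. \<theta> d y $ m $ a * \<beta> (r d) (r b) k (Q y))"
          unfolding th[of m a]
          unfolding bform_def sum_distrib_left sum_distrib_right
          by (subst sum.swap) (simp add: mult_ac)
        also have "\<dots> = (\<Sum>c\<in>UNIV. (\<Sum>d\<in>UNIV. \<theta> d y $ m $ a * \<theta> c y $ d $ b) * pd k (r c) (Q y))"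
          unfolding th sum_distrib_left sum_distrib_right by (subst sum.swap) (simp add: mult_ac)
        finally show ?thesis .
      qed
      show "(\<Sum>c\<in>UNIV. (\<Sum>d\<in>UNIV. (pd d (\<theta> c) y - pd c (\<theta> d) y) $ i $ j * \<gamma> y $ d $ m
         + \<theta> d y $ m $ j * \<theta> c y $ d $ i - \<theta> d y $ m $ i * \<theta> c y $ d $ j) * pd k (r c) (Q y)) = 0"
        using jacobi_identity[OF r_smooth r_smooth r_smooth u, of i j k m]
        unfolding sum.distrib sum_subtractf 1 2
        by (simp add: sum.distrib sum_subtractf left_diff_distrib distrib_right)
    qed
  qed
  show ?thesis using flat_h unfolding h_def [abs_def] .
qed

end

lemma smooth_on_id:
  assumes S: "open S" shows "smooth_on S (\<lambda>x :: real^'n::finite. x)"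
proof (rule smooth_on_class[OF S, where F = "insert (\<lambda>x. x) {f. \<exists>c. f = (\<lambda>x. c)}"])
  fix f :: "real^'n \<Rightarrow> real^'n" and i assume f: "f \<in> insert (\<lambda>x. x) {f. \<exists>c. f = (\<lambda>x. c)}"
  have "pd i (\<lambda>x. x) x = (axis i 1 :: real^'n)" for x by (rule pd_eqI[OF has_derivative_ident])
  then have "\<exists>c. \<forall>x\<in>S. pd i f x = c" using f by auto
  then obtain c where "\<forall>x\<in>S. pd i f x = c" by (rule exE)
  then show "\<exists>h\<in>insert (\<lambda>x. x) {f. \<exists>c. f = (\<lambda>x. c)}. \<forall>x\<in>S. pd i f x = h x"
    by (intro bexI[where x = "\<lambda>x. c"]) auto
next
  fix f :: "real^'n \<Rightarrow> real^'n" and x assume "f \<in> insert (\<lambda>x. x) {f. \<exists>c. f = (\<lambda>x. c)}"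
  then show "f differentiable (at x)" by (elim insertE CollectE exE) simp_all
qed simp

lemma diffeo_on_id:
  assumes W: "open W" shows "diffeo_on W W (\<lambda>x :: real^'n::finite. x)"
  unfolding diffeo_on_def
proof (intro conjI W smooth_on_id)
  show "bij_betw (\<lambda>x. x) W W" by (simp add: bij_betw_def)
  show "smooth_on W (inv_into W (\<lambda>x. x))"
    by (rule smooth_on_cong[OF W _ smooth_on_id[OF W]]) (metis inv_into_f_eq inj_on_def)
qed

lemma diag_mat_nth [simp]: "diag_mat d $ i $ j = (if i = j then d i else 0)"
  by (simp add: diag_mat_def)

lemma diag_mat_mult: "diag_mat d ** diag_mat e = diag_mat (\<lambda>i. d i * e i)"
proof -
  have "(\<Sum>k\<in>UNIV. (if i = k then d i else 0) * (if k = j then e k else 0))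
      = (\<Sum>k\<in>UNIV. if k = i then (if i = j then d i * e i else 0) else 0)" for i j
    by (intro sum.cong) auto
  then show ?thesis by (simp add: vec_eq_iff matrix_nth)
qed

lemma det_diag_mat: "det (diag_mat d) = (\<Prod>i\<in>UNIV. d i)"
  by (simp add: det_diagonal)

lemma matrix_inv_diag_mat:
  assumes "\<And>i. d i \<noteq> 0"
  shows "matrix_inv (diag_mat d) = diag_mat (\<lambda>i. inverse (d i))"
  by (rule matrix_inv_unique) (simp_all add: diag_mat_mult assms, simp_all add: vec_eq_iff mat_def)

lemma christoffel_cong:
  assumes "open S" "x \<in> S" "\<And>y. y \<in> S \<Longrightarrow> G y = G' y"
  shows "christoffel G k i j x = christoffel G' k i j x"
proof -
  have "pd i (\<lambda>y. G y $ j $ l) x = pd i (\<lambda>y. G' y $ j $ l) x" for i j l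
    by (rule pd_cong[OF assms(1,2)]) (simp add: assms(3))
  then show ?thesis by (simp add: christoffel_def assms(2,3))
qed

lemma flat_metric_on_cong:
  assumes S: "open S" and eq: "\<And>y. y \<in> S \<Longrightarrow> G y = G' y" and flat: "flat_metric_on S G"
  shows "flat_metric_on S G'"
proof -
  have ch: "christoffel G k i j x = christoffel G' k i j x" if "x \<in> S" for k i j x
    by (rule christoffel_cong[OF S that eq])
  have "pd a (christoffel G k i j) x = pd a (christoffel G' k i j) x" if "x \<in> S" for a k i j x
    by (rule pd_cong[OF S that ch])
  then have "riemann G l k i j x = riemann G' l k i j x" if "x \<in> S" for l k i j x
    unfolding riemann_def using that by (simp add: ch)
  then show ?thesis
    using flat smooth_on_cong[OF S eq] unfolding flat_metric_on_def by (simp add: eq)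
qed

lemma jacobian_nth:
  fixes R :: "real^'n::finite \<Rightarrow> real^'m::finite"
  assumes "R differentiable (at u)"
  shows "jacobian R (at u) $ a $ k = pd k (\<lambda>u. R u $ a) u"
  unfolding pd_nth[OF assms] by (simp add: jacobian_def matrix_def pd_def)

lemma contra_transform_nth:
  fixes R :: "real^'n::finite \<Rightarrow> real^'n"
  assumes "R differentiable (at u)"
  shows "contra_transform R G u $ a $ b = pairing G (\<lambda>u. R u $ a) (\<lambda>u. R u $ b) u"
  unfolding contra_transform_def pairing_def ham_vec_def matrix_nth transpose_nth jacobian_nth[OF assms]
    sum_distrib_left sum_distrib_right
  by (subst sum.swap) (simp add: mult_ac)

text \<open>A diagonal form in one frame makes the matrix symmetric and invertible in every frame.  In this way the
  diagonal coordinates provide the symmetry of \<open>G\<close> that \<open>torsion_free\<close> uses.\<close>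

lemma contra_transform_diag:
  fixes R :: "real^'n::finite \<Rightarrow> real^'n"
  assumes diag: "contra_transform R G u = diag_mat d" and d: "\<And>i. d i \<noteq> 0"
  shows "det (G u) \<noteq> 0" "transpose (G u) = G u"
proof -
  let ?J = "jacobian R (at u)"
  have eq: "?J ** G u ** transpose ?J = diag_mat d" using diag by (simp add: contra_transform_def)
  have "det (?J ** G u ** transpose ?J) \<noteq> 0" unfolding eq det_diag_mat using d by simp
  then have J: "det ?J \<noteq> 0" and "det (G u) \<noteq> 0" by (auto simp: det_mul)
  then show "det (G u) \<noteq> 0" by simp
  let ?K = "matrix_inv ?J"
  have KJ: "?K ** ?J = mat 1" and JK: "transpose ?J ** transpose ?K = mat 1"
    using matrix_inv_inverse(2)[OF J] by (simp_all add: matrix_transpose_mul[symmetric])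
  have "?K ** diag_mat d ** transpose ?K = (?K ** ?J) ** G u ** (transpose ?J ** transpose ?K)"
    unfolding eq[symmetric] by (simp only: matrix_mul_assoc)
  then have G: "G u = ?K ** diag_mat d ** transpose ?K" unfolding KJ JK by simp
  have "transpose (diag_mat d) = diag_mat d" by (auto simp: vec_eq_iff)
  then show "transpose (G u) = G u"
    unfolding G by (simp add: matrix_transpose_mul matrix_mul_assoc)
qed

text \<open>\<open>flat_in_coordinates\<close> is used twice: with the identity, for the coordinates \<open>u\<close>, and with \<open>R\<close>.\<close>

lemma hamiltonian_diagonal_flat:
  fixes W U :: "(real^'n::finite) set"
  assumes R: "diffeo_on W U R" and ham: "hamiltonian W G B"
    and G: "smooth_on W G" and B: "\<And>i j k. smooth_on W (\<lambda>u. B u i j k)"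
    and diag: "\<And>u. u \<in> W \<Longrightarrow> contra_transform R G u = diag_mat (\<lambda>i. d i (R u))"
    and d: "\<And>i y. y \<in> U \<Longrightarrow> d i y \<noteq> 0" and d_smooth: "\<And>i. smooth_on U (d i)"
  shows "flat_metric_on W (\<lambda>u. matrix_inv (G u))"
    and "flat_metric_on U (\<lambda>y. diag_mat (\<lambda>i. inverse (d i y)))"
proof -
  have W: "open W" and U: "open U" and R_smooth: "smooth_on W R" and bij: "bij_betw R W U"
    using R by (auto simp: diffeo_on_def)
  have RU: "R u \<in> U" if "u \<in> W" for u using bij that by (auto simp: bij_betw_def)
  interpret hamiltonian_operator W G B
    by unfold_locales (intro W smooth_on_nth G B ham)+
  have G_props: "det (G u) \<noteq> 0" "transpose (G u) = G u" if "u \<in> W" for u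
    using contra_transform_diag[of R G u "\<lambda>i. d i (R u)", OF diag[OF that] d[OF RU[OF that]]] by auto
  have sym: "G u $ i $ j = G u $ j $ i" if "u \<in> W" for u i j
    using G_props(2)[OF that] by (metis transpose_nth)
  have p: "pd k (\<lambda>u. u $ a) u = axis k 1 $ a" for k a and u :: "real^'n"
    by (rule pd_eqI[OF bounded_linear_imp_has_derivative[OF bounded_linear_vec_nth]])
  have ax: "axis k (1::real) $ a = axis a 1 $ k" for k a :: 'n by (simp add: axis_def)
  show "flat_metric_on W (\<lambda>u. matrix_inv (G u))"
  proof (rule flat_in_coordinates[OF sym diffeo_on_id[OF W] G G_props(1)])
    show "G u $ a $ b = g (\<lambda>u. u $ a) (\<lambda>u. u $ b) u" for u a b
      unfolding pairing_def ham_vec_def p ax[of _ a] ax[of _ b] by simp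
  qed
  let ?\<gamma> = "\<lambda>y. diag_mat (\<lambda>i. d i y)"
  have "flat_metric_on U (\<lambda>y. matrix_inv (?\<gamma> y))"
  proof (rule flat_in_coordinates[OF sym R])
    have "smooth_on U (\<lambda>y. ?\<gamma> y $ i $ j)" for i j
      by (cases "i = j") (simp_all add: d_smooth U)
    then show "smooth_on U ?\<gamma>" by (intro smooth_on_vecI U)
    show "det (?\<gamma> y) \<noteq> 0" if "y \<in> U" for y using d[OF that] by (simp add: det_diag_mat)
    show "?\<gamma> (R u) $ a $ b = g (\<lambda>u. R u $ a) (\<lambda>u. R u $ b) u" if "u \<in> W" for u a b
      unfolding contra_transform_nth[OF smooth_on_differentiable[OF R_smooth W that], symmetric] diag[OF that] ..
  qed
  then show "flat_metric_on U (\<lambda>y. diag_mat (\<lambda>i. inverse (d i y)))"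
    by (rule flat_metric_on_cong[OF U, rotated]) (simp add: matrix_inv_diag_mat d)
qed

section \<open>Orthogonal coordinate systems in Euclidean space\<close>

lemma pd_other_coordinate:
  fixes f :: "real \<Rightarrow> real"
  assumes "(\<lambda>x :: real^'n::finite. f (x $ i)) differentiable (at x)" "m \<noteq> i"
  shows "pd m (\<lambda>x. f (x $ i)) x = 0"
proof -
  have "((\<lambda>t. f ((x + t *\<^sub>R axis m 1) $ i)) has_real_derivative pd m (\<lambda>x. f (x $ i)) x) (at 0)"
    by (rule pd_line_real[OF assms(1)])
  moreover have "(\<lambda>t. f ((x + t *\<^sub>R axis m 1) $ i)) = (\<lambda>t. f (x $ i))"
    using assms(2) by (simp add: axis_def)
  ultimately have "((\<lambda>t. f (x $ i)) has_real_derivative pd m (\<lambda>x. f (x $ i)) x) (at (0::real))"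
    by (simp only:)
  then show ?thesis using DERIV_unique DERIV_const by blast
qed

lemma differentiable_sqrt:
  assumes "f differentiable (at x)" "f x > 0"
  shows "(\<lambda>x. sqrt (f x)) differentiable (at x)"
  using assms has_derivative_real_sqrt unfolding differentiable_def by blast

text \<open>A rigid motion preserves the lengths of tangent vectors of curves.  It is used along coordinate lines,
  which stay inside the hypersurface.\<close>

lemma rigid_motion_vector_derivative:
  assumes T: "rigid_motion T"
    and a: "(a has_vector_derivative a') (at 0)" and b: "(b has_vector_derivative b') (at (0::real))"
    and eq: "\<forall>\<^sub>F t in nhds 0. b t = T (a t)"
  shows "norm b' = norm a'"
proof -
  obtain Q v where Q: "orthogonal_transformation Q" and TQ: "\<And>p. T p = Q p + v"
    using T unfolding rigid_motion_def by auto
  have bl: "bounded_linear Q"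
    using orthogonal_transformation_linear[OF Q] linear_conv_bounded_linear by auto
  have "((\<lambda>t. Q (a t) + v) has_vector_derivative Q a' + 0) (at 0)"
    by (intro has_vector_derivative_add bounded_linear.has_vector_derivative[OF bl a] has_vector_derivative_const)
  moreover have "((\<lambda>t. Q (a t) + v) has_vector_derivative b') (at 0)"
  proof -
    have "\<forall>\<^sub>F t in nhds 0. b t = Q (a t) + v" using eq by (simp add: TQ)
    then have "(b has_vector_derivative b') (at 0) = ((\<lambda>t. Q (a t) + v) has_vector_derivative b') (at 0)"
      by (intro has_vector_derivative_cong_ev) (auto dest: eventually_nhds_x_imp_x)
    then show ?thesis using b by simp
  qed
  ultimately have "b' = Q a'" using vector_derivative_unique_at by fastforce
  then show ?thesis using orthogonal_transformation_norm[OF Q] by simp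
qed

locale lame_frame =
  fixes U :: "(real^'n::finite) set" and r :: "real^'n \<Rightarrow> real^'n" and h :: "'n \<Rightarrow> real^'n \<Rightarrow> real"
  assumes U: "open U" and r_smooth: "smooth_on U r"
    and h_diff: "\<And>i x. x \<in> U \<Longrightarrow> h i differentiable (at x)"
    and h_pos: "\<And>i x. x \<in> U \<Longrightarrow> h i x > 0"
    and metric: "\<And>i j x. x \<in> U \<Longrightarrow> pd i r x \<bullet> pd j r x = (if i = j then (h i x)\<^sup>2 else 0)"
begin

definition N :: "'n \<Rightarrow> real^'n \<Rightarrow> real^'n" where "N m x = (1 / h m x) *\<^sub>R pd m r x"

lemma r_diff: "x \<in> U \<Longrightarrow> r differentiable (at x)"
  by (rule smooth_on_differentiable[OF r_smooth U])

lemma E_diff: "x \<in> U \<Longrightarrow> pd i r differentiable (at x)"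
  by (rule smooth_on_differentiable[OF smooth_on_pd[OF r_smooth] U])

lemma N_diff: "x \<in> U \<Longrightarrow> N m differentiable (at x)"
  unfolding N_def [abs_def] divide_inverse
  by (intro differentiable_scaleR differentiable_mult differentiable_const differentiable_inverse h_diff E_diff)
    (use h_pos[of x m] in auto)

text \<open>The matrix with rows \<open>\<partial>\<^sub>jr\<close> is invertible, since its Gram matrix is diagonal with positive entries.\<close>

lemma frame_complete:
  assumes x: "x \<in> U" and v: "\<And>j. v \<bullet> pd j r x = 0"
  shows "v = 0"
proof -
  define A :: "real^'n^'n" where "A = (\<chi> j. pd j r x)"
  have "A ** transpose A = (\<chi> i j. if i = j then (h i x)\<^sup>2 else 0)"
    unfolding vec_eq_iff by (simp add: matrix_nth A_def metric[OF x, symmetric] inner_vec_def)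
  then have "det (A ** transpose A) = (\<Prod>i\<in>UNIV. (h i x)\<^sup>2)"
    by (simp add: det_diagonal)
  then have "det A \<noteq> 0" using h_pos[OF x] by (auto simp: det_mul) (metis less_irrefl)
  moreover have "A *v v = 0"
    using v by (simp add: vec_eq_iff matrix_vector_mul_component A_def inner_commute)
  ultimately show ?thesis
    by (metis matrix_inv_inverse(2) matrix_vector_mul_assoc matrix_vector_mul_lid matrix_vector_mult_0_right)
qed

lemma frame_independent:
  assumes x: "x \<in> U" and a: "(\<Sum>i\<in>UNIV. a i *\<^sub>R pd i r x) = 0"
  shows "a j = 0"
proof -
  have "0 = (\<Sum>i\<in>UNIV. a i *\<^sub>R pd i r x) \<bullet> pd j r x" by (simp add: a)
  also have "\<dots> = (\<Sum>i\<in>UNIV. if i = j then a i * (h i x)\<^sup>2 else 0)"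
    unfolding inner_sum_left by (intro sum.cong) (auto simp: metric[OF x])
  finally show ?thesis using h_pos[OF x, of j] by simp
qed

text \<open>For pairwise distinct indices \<open>\<partial>\<^sub>mr \<bullet> \<partial>\<^sub>i\<partial>\<^sub>jr\<close> is symmetric in the last two indices and, by orthogonality,
  antisymmetric in the outer two; three such exchanges return the expression with the opposite sign.\<close>

lemma gauss:
  assumes x: "x \<in> U" and im: "i \<noteq> m" and jm: "j \<noteq> m"
  shows "pd m r x \<bullet> pd i (pd j r) x = (if j = i then - (h i x * pd m (h i) x) else 0)"
proof -
  let ?E = "\<lambda>i. pd i r x" and ?F = "\<lambda>i j. pd i (pd j r) x"
  have F: "?F a b = ?F b a" for a b by (rule pd_commute[OF U r_smooth x])
  have anti: "?F b a \<bullet> ?E c + ?E a \<bullet> ?F b c = 0" if "a \<noteq> c" for a b c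
  proof -
    have "pd b (\<lambda>x. pd a r x \<bullet> pd c r x) x = pd b (\<lambda>x. 0) x"
      by (rule pd_cong[OF U x]) (simp add: metric that)
    then show ?thesis by (simp add: pd_inner E_diff x)
  qed
  show ?thesis
  proof (cases "j = i")
    case True
    have "pd m (\<lambda>x. pd i r x \<bullet> pd i r x) x = pd m (\<lambda>x. h i x * h i x) x"
      by (rule pd_cong[OF U x]) (simp add: metric power2_eq_square)
    then have "2 * (?F m i \<bullet> ?E i) = 2 * (h i x * pd m (h i) x)"
      by (simp add: pd_inner pd_mult E_diff h_diff x inner_commute)
    then show ?thesis using anti[of m i i] im F[of i m] True by simp
  next
    case False
    have "?E m \<bullet> ?F i j = - (?E j \<bullet> ?F m i)" using anti[of m j i] jm F[of i m] by (simp add: inner_commute)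
    also have "\<dots> = ?E i \<bullet> ?F j m" using anti[of j i m] False F[of m j] by (simp add: inner_commute)
    also have "\<dots> = - (?E m \<bullet> ?F i j)" using anti[of i m j] im F[of i j] by (simp add: inner_commute)
    finally show ?thesis using False by simp
  qed
qed

text \<open>The components of \<open>\<partial>\<^sub>iN\<^sub>m\<close> in the orthogonal frame follow by differentiating \<open>N\<^sub>m \<bullet> N\<^sub>m = 1\<close> and
  \<open>N\<^sub>m \<bullet> \<partial>\<^sub>jr = 0\<close>.\<close>

lemma weingarten:
  assumes x: "x \<in> U" and im: "i \<noteq> m"
  shows "pd i (N m) x = (pd m (h i) x / (h i x * h m x)) *\<^sub>R pd i r x"
proof -
  let ?k = "pd m (h i) x / (h i x * h m x)"
  have hm: "h m x \<noteq> 0" and hi: "h i x \<noteq> 0" using h_pos[OF x] by (metis less_irrefl)+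
  have "pd i (N m) x \<bullet> pd j r x = ?k * (if i = j then (h i x)\<^sup>2 else 0)" for j
  proof (cases "j = m")
    case True
    have "pd i (\<lambda>x. N m x \<bullet> N m x) x = pd i (\<lambda>x. 1) x"
    proof (rule pd_cong[OF U x])
      show "N m y \<bullet> N m y = 1" if "y \<in> U" for y
        using h_pos[OF that, of m] by (simp add: N_def metric[OF that] power2_eq_square)
    qed
    then have "pd i (N m) x \<bullet> N m x = 0" by (simp add: pd_inner N_diff x inner_commute)
    then show ?thesis using True im hm by (simp add: N_def)
  next
    case False
    have "pd i (\<lambda>x. N m x \<bullet> pd j r x) x = pd i (\<lambda>x. 0) x"
      by (rule pd_cong[OF U x]) (use False in \<open>simp add: N_def metric\<close>)
    then have "pd i (N m) x \<bullet> pd j r x = - (N m x \<bullet> pd i (pd j r) x)"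
      by (simp add: pd_inner N_diff E_diff x)
    also have "\<dots> = - ((1 / h m x) * (if j = i then - (h i x * pd m (h i) x) else 0))"
      by (simp add: N_def gauss[OF x im False])
    finally show ?thesis using hm hi by (simp add: power2_eq_square)
  qed
  then have "(pd i (N m) x - ?k *\<^sub>R pd i r x) \<bullet> pd j r x = 0" for j
    by (simp add: inner_diff_left metric[OF x])
  then have "pd i (N m) x - ?k *\<^sub>R pd i r x = 0" by (rule frame_complete[OF x])
  then show ?thesis by simp
qed

definition curv :: "'n \<Rightarrow> 'n \<Rightarrow> real^'n \<Rightarrow> real" where
  "curv m i x = pd m (h i) x / (h i x * h m x)"

text \<open>The scale \<open>c\<close> anticipates the homothety: \<open>c r\<close> has the same unit normals as \<open>r\<close>, so its curvatures are divided
  by \<open>c\<close>.  With \<open>c = 1\<close> the lemmas of this context concern the original hypersurface.\<close>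

context
  fixes m :: 'n and c :: real and x :: "real^'n"
  assumes x: "x \<in> U" and c: "c > 0"
begin

lemma pd_scaled: "pd i (\<lambda>x. c *\<^sub>R r x) x = c *\<^sub>R pd i r x"
  by (rule pd_linear(1)[OF bounded_linear_scaleR_right r_diff[OF x]])

lemma frechet_scaled:
  "frechet_derivative (\<lambda>x. c *\<^sub>R r x) (at x) \<xi> = (\<Sum>i\<in>UNIV. (\<xi> $ i * c) *\<^sub>R pd i r x)"
  by (subst frechet_expand[OF pd_linear(2)[OF bounded_linear_scaleR_right r_diff[OF x]]])
    (simp add: pd_scaled)

lemma frechet_normal:
  assumes "\<xi> $ m = 0"
  shows "frechet_derivative (N m) (at x) \<xi> = (\<Sum>i\<in>UNIV. (\<xi> $ i * curv m i x) *\<^sub>R pd i r x)"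
  unfolding frechet_expand[OF N_diff[OF x]]
proof (intro sum.cong refl)
  fix i show "\<xi> $ i *\<^sub>R pd i (N m) x = (\<xi> $ i * curv m i x) *\<^sub>R pd i r x"
    using assms weingarten[OF x, of i m] by (cases "i = m") (simp_all add: curv_def)
qed

lemma frame_eq:
  assumes "(\<Sum>i\<in>UNIV. a i *\<^sub>R pd i r x) = (\<Sum>i\<in>UNIV. b i *\<^sub>R pd i r x)"
  shows "a j = b j"
proof -
  have "(\<Sum>i\<in>UNIV. (a i - b i) *\<^sub>R pd i r x) = 0"
    using assms by (simp add: scaleR_diff_left sum_subtractf)
  from frame_independent[OF x this, of j] show ?thesis by simp
qed

lemma immersed_scaled: "immersed_at m (\<lambda>x. c *\<^sub>R r x) x"
  unfolding immersed_at_def frechet_scaled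
proof (intro allI impI, elim conjE)
  fix \<xi> :: "real^'n" assume "(\<Sum>i\<in>UNIV. (\<xi> $ i * c) *\<^sub>R pd i r x) = 0"
  then have "\<xi> $ j * c = 0" for j by (rule frame_independent[OF x, where a = "\<lambda>i. \<xi> $ i * c"])
  then show "\<xi> = 0" using c by (simp add: vec_eq_iff)
qed

lemma unit_normal_scaled: "unit_normal_at m (\<lambda>x. c *\<^sub>R r x) (N m) x"
  unfolding unit_normal_at_def pd_scaled
  using h_pos[OF x, of m] by (auto simp: N_def metric[OF x] norm_eq_sqrt_inner real_sqrt_mult real_sqrt_divide power2_eq_square)

lemma principal_scaled:
  "is_principal m (\<lambda>x. c *\<^sub>R r x) (N m) x \<kappa> \<xi> \<longleftrightarrow>
    \<xi> \<noteq> 0 \<and> \<xi> $ m = 0 \<and> (\<forall>i. i \<noteq> m \<longrightarrow> \<xi> $ i = 0 \<or> curv m i x = c * \<kappa>)"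
proof -
  have "(\<Sum>i\<in>UNIV. (\<xi> $ i * curv m i x) *\<^sub>R pd i r x) = (\<Sum>i\<in>UNIV. (\<xi> $ i * (c * \<kappa>)) *\<^sub>R pd i r x)
     \<longleftrightarrow> (\<forall>i. i \<noteq> m \<longrightarrow> \<xi> $ i = 0 \<or> curv m i x = c * \<kappa>)" if m: "\<xi> $ m = 0"
  proof
    assume "(\<Sum>i\<in>UNIV. (\<xi> $ i * curv m i x) *\<^sub>R pd i r x) = (\<Sum>i\<in>UNIV. (\<xi> $ i * (c * \<kappa>)) *\<^sub>R pd i r x)"
    from frame_eq[where a = "\<lambda>i. \<xi> $ i * curv m i x" and b = "\<lambda>i. \<xi> $ i * (c * \<kappa>)", OF this]
    show "\<forall>i. i \<noteq> m \<longrightarrow> \<xi> $ i = 0 \<or> curv m i x = c * \<kappa>" by simp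
  next
    assume "\<forall>i. i \<noteq> m \<longrightarrow> \<xi> $ i = 0 \<or> curv m i x = c * \<kappa>"
    then have "\<xi> $ i * curv m i x = \<xi> $ i * (c * \<kappa>)" for i using m by (cases "i = m") auto
    then show "(\<Sum>i\<in>UNIV. (\<xi> $ i * curv m i x) *\<^sub>R pd i r x) = (\<Sum>i\<in>UNIV. (\<xi> $ i * (c * \<kappa>)) *\<^sub>R pd i r x)"
      by (simp only:)
  qed
  moreover have "\<kappa> *\<^sub>R (\<Sum>i\<in>UNIV. (\<xi> $ i * c) *\<^sub>R pd i r x) = (\<Sum>i\<in>UNIV. (\<xi> $ i * (c * \<kappa>)) *\<^sub>R pd i r x)"
    by (simp add: scaleR_sum_right mult_ac)
  ultimately show ?thesis
    unfolding is_principal_def frechet_scaled by (auto simp: frechet_normal)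
qed

lemma curvature_lines_scaled: "curvature_line_coords_at m (\<lambda>x. c *\<^sub>R r x) (N m) x"
  unfolding curvature_line_coords_at_def pd_scaled principal_scaled
proof (intro conjI allI impI)
  fix i assume "i \<noteq> m"
  then show "\<exists>k. axis i 1 \<noteq> (0::real^'n) \<and> axis i (1::real) $ m = 0 \<and>
      (\<forall>j. j \<noteq> m \<longrightarrow> axis i (1::real) $ j = 0 \<or> curv m j x = c * k)"
    using c by (intro exI[of _ "curv m i x / c"]) (auto simp: axis_def vec_eq_iff)
qed (use metric[OF x] in auto)

lemma shape_operator_scaled:
  "is_shape_operator m (\<lambda>x. c *\<^sub>R r x) (N m) x (\<lambda>\<xi>. \<chi> i. if i = m then 0 else curv m i x / c * \<xi> $ i)"
  unfolding is_shape_operator_def frechet_scaled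
proof (intro allI impI conjI)
  fix \<xi> :: "real^'n" assume m: "\<xi> $ m = 0"
  show "frechet_derivative (N m) (at x) \<xi>
    = (\<Sum>i\<in>UNIV. ((\<chi> i. if i = m then 0 else curv m i x / c * \<xi> $ i) $ i * c) *\<^sub>R pd i r x)"
    unfolding frechet_normal[OF m] using m c by (intro sum.cong refl) auto
qed simp

end

end

section \<open>The family of coordinate hypersurfaces\<close>

locale pencil_family =
  fixes U :: "(real^'n::finite) set" and H :: "'n \<Rightarrow> real^'n \<Rightarrow> real" and \<eta> :: "'n \<Rightarrow> real \<Rightarrow> real"
    and \<Lambda> :: "real set" and r :: "real \<Rightarrow> real^'n \<Rightarrow> real^'n"
  assumes U: "open U"
    and H_smooth: "\<And>i. smooth_on U (H i)"
    and H_pos: "\<And>i x. x \<in> U \<Longrightarrow> H i x > 0"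
    and eta_smooth: "\<And>i. smooth_on U (\<lambda>x. \<eta> i (x $ i))"
    and spectrum: "\<And>x i j. x \<in> U \<Longrightarrow> i \<noteq> j \<Longrightarrow> \<eta> i (x $ i) \<noteq> \<eta> j (x $ j)"
    and pos: "\<And>\<mu> x i. \<mu> \<in> \<Lambda> \<Longrightarrow> x \<in> U \<Longrightarrow> \<mu> + \<eta> i (x $ i) > 0"
    and realizes: "\<And>\<mu>. \<mu> \<in> \<Lambda> \<Longrightarrow> realizes_metric U (pencil_metric H \<eta> \<mu>) (r \<mu>)"
begin

definition lame :: "real \<Rightarrow> 'n \<Rightarrow> real^'n \<Rightarrow> real" where
  "lame \<mu> i x = H i x / sqrt (\<mu> + \<eta> i (x $ i))"

definition curvature :: "real \<Rightarrow> 'n \<Rightarrow> 'n \<Rightarrow> real^'n \<Rightarrow> real" where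
  "curvature \<mu> m i x = rot_coeff H m i x / H i x * sqrt (\<mu> + \<eta> m (x $ m))"

lemma root_factor_diff:
  assumes "\<mu> \<in> \<Lambda>" "x \<in> U"
  shows "(\<lambda>x. inverse (sqrt (\<mu> + \<eta> i (x $ i)))) differentiable (at x)"
proof -
  have "(\<lambda>x. \<mu> + \<eta> i (x $ i)) differentiable (at x)"
    by (intro differentiable_add differentiable_const smooth_on_differentiable[OF eta_smooth U] assms)
  from differentiable_sqrt[OF this pos[OF assms]] show ?thesis
    by (rule differentiable_inverse) (use pos[OF assms, of i] in simp)
qed

lemma frame:
  assumes \<mu>: "\<mu> \<in> \<Lambda>"
  shows "lame_frame U (r \<mu>) (lame \<mu>)"
proof
  show "open U" by (rule U)
  show "smooth_on U (r \<mu>)" using realizes[OF \<mu>] by (simp add: realizes_metric_def)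
  fix x assume x: "x \<in> U"
  show "lame \<mu> i differentiable (at x)" for i
    unfolding lame_def [abs_def] divide_inverse
    by (intro differentiable_mult smooth_on_differentiable[OF H_smooth U x] root_factor_diff[OF \<mu> x])
  show "lame \<mu> i x > 0" for i using H_pos[OF x] pos[OF \<mu> x] by (simp add: lame_def)
  show "pd i (r \<mu>) x \<bullet> pd j (r \<mu>) x = (if i = j then (lame \<mu> i x)\<^sup>2 else 0)" for i j
    using realizes[OF \<mu>] x pos[OF \<mu> x, of i]
    by (auto simp: realizes_metric_def pencil_metric_def lame_def power_divide)
qed

lemma frame_N: 
  assumes \<mu>: "\<mu> \<in> \<Lambda>"
  shows "lame_frame.N (r \<mu>) (lame \<mu>) m = unit_tangent H \<eta> r \<mu> m"
  by (rule ext) (simp add: lame_frame.N_def[OF frame[OF \<mu>]] lame_def unit_tangent_def)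

text \<open>The step on which the theorem rests: for \<open>i \<noteq> m\<close> the factor \<open>1 / sqrt (\<mu> + \<eta>\<^sub>i)\<close> of the Lame coefficient \<open>h\<^sub>i\<close> is
  constant along the \<open>m\<close>-th coordinate line, so it cancels in \<open>\<partial>\<^sub>mh\<^sub>i / h\<^sub>i\<close>.\<close>

lemma frame_curv:
  assumes \<mu>: "\<mu> \<in> \<Lambda>" and x: "x \<in> U" and im: "i \<noteq> m"
  shows "lame_frame.curv (lame \<mu>) m i x = curvature \<mu> m i x"
proof -
  note d = root_factor_diff[OF \<mu> x, of i]
  have "pd m (lame \<mu> i) x = pd m (H i) x / sqrt (\<mu> + \<eta> i (x $ i))"
    unfolding lame_def [abs_def] divide_inverse
      pd_mult[OF smooth_on_differentiable[OF H_smooth U x] d]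
    using pd_other_coordinate[of "\<lambda>s. inverse (sqrt (\<mu> + \<eta> i s))", OF d im[symmetric]] by simp
  then show ?thesis
    using H_pos[OF x, of i] H_pos[OF x, of m] pos[OF \<mu> x, of i] pos[OF \<mu> x, of m]
    unfolding lame_frame.curv_def[OF frame[OF \<mu>]]
    by (simp add: lame_def curvature_def rot_coeff_def field_simps)
qed

lemma scaled_hypersurface:
  fixes m :: 'n
  assumes \<mu>: "\<mu> \<in> \<Lambda>" and x: "x \<in> U" and c: "c > 0"
  defines "f \<equiv> (\<lambda>x. c *\<^sub>R r \<mu> x)" and "\<phi> \<equiv> unit_tangent H \<eta> r \<mu> m"
  shows "immersed_at m f x" "unit_normal_at m f \<phi> x" "curvature_line_coords_at m f \<phi> x"
    "is_principal m f \<phi> x \<kappa> \<xi> \<longleftrightarrow>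
      \<xi> \<noteq> 0 \<and> \<xi> $ m = 0 \<and> (\<forall>i. i \<noteq> m \<longrightarrow> \<xi> $ i = 0 \<or> curvature \<mu> m i x = c * \<kappa>)"
    "is_shape_operator m f \<phi> x (\<lambda>\<xi>. \<chi> i. if i = m then 0 else curvature \<mu> m i x / c * \<xi> $ i)"
proof -
  interpret lame_frame U "r \<mu>" "lame \<mu>" by (rule frame[OF \<mu>])
  note N = frame_N[OF \<mu>, of m, folded \<phi>_def] and k = frame_curv[OF \<mu> x]
  show "immersed_at m f x" "unit_normal_at m f \<phi> x" "curvature_line_coords_at m f \<phi> x"
    using immersed_scaled[OF x c] unit_normal_scaled[OF x c, of m] curvature_lines_scaled[OF x c, of m]
    unfolding f_def N by auto
  show "is_principal m f \<phi> x \<kappa> \<xi> \<longleftrightarrow>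
      \<xi> \<noteq> 0 \<and> \<xi> $ m = 0 \<and> (\<forall>i. i \<noteq> m \<longrightarrow> \<xi> $ i = 0 \<or> curvature \<mu> m i x = c * \<kappa>)"
    using principal_scaled[OF x c, of m \<kappa> \<xi>] unfolding f_def N by (simp add: k)
  have "(if i = m then 0 else curv m i x / c * \<xi> $ i) = (if i = m then 0 else curvature \<mu> m i x / c * \<xi> $ i)" for i and \<xi> :: "real^'n"
    by (simp add: k)
  then show "is_shape_operator m f \<phi> x (\<lambda>\<xi>. \<chi> i. if i = m then 0 else curvature \<mu> m i x / c * \<xi> $ i)"
    using shape_operator_scaled[OF x c, of m] unfolding f_def N by (simp only:)
qed

lemma pd_unit_tangent:
  assumes \<mu>: "\<mu> \<in> \<Lambda>" and x: "x \<in> U" and im: "i \<noteq> m"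
  shows "pd i (unit_tangent H \<eta> r \<mu> m) x = curvature \<mu> m i x *\<^sub>R pd i (r \<mu>) x"
  using lame_frame.weingarten[OF frame[OF \<mu>] x im] frame_curv[OF \<mu> x im]
  unfolding frame_N[OF \<mu>] lame_frame.curv_def[OF frame[OF \<mu>]] by simp

lemma principal_curvatures:
  assumes \<mu>: "\<mu> \<in> \<Lambda>" and x: "x \<in> U"
  shows "{\<kappa>. \<exists>\<xi>. is_principal m (r \<mu>) (unit_tangent H \<eta> r \<mu> m) x \<kappa> \<xi>} = {curvature \<mu> m i x |i. i \<noteq> m}"
proof -
  have P: "is_principal m (r \<mu>) (unit_tangent H \<eta> r \<mu> m) x \<kappa> \<xi> \<longleftrightarrow>
      \<xi> \<noteq> 0 \<and> \<xi> $ m = 0 \<and> (\<forall>i. i \<noteq> m \<longrightarrow> \<xi> $ i = 0 \<or> curvature \<mu> m i x = \<kappa>)" for \<kappa> \<xi>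
    using scaled_hypersurface(4)[OF \<mu> x, of 1 m \<kappa> \<xi>] by simp
  show ?thesis
  proof (intro subset_antisym subsetI)
    fix \<kappa> assume "\<kappa> \<in> {\<kappa>. \<exists>\<xi>. is_principal m (r \<mu>) (unit_tangent H \<eta> r \<mu> m) x \<kappa> \<xi>}"
    then obtain \<xi> :: "real^'n" where \<xi>: "\<xi> \<noteq> 0" "\<xi> $ m = 0" "\<forall>i. i \<noteq> m \<longrightarrow> \<xi> $ i = 0 \<or> curvature \<mu> m i x = \<kappa>"
      unfolding P by auto
    obtain i where "\<xi> $ i \<noteq> 0" using \<xi>(1) by (auto simp: vec_eq_iff)
    then show "\<kappa> \<in> {curvature \<mu> m i x |i. i \<noteq> m}" using \<xi>(2,3) by auto
  next
    fix \<kappa> assume "\<kappa> \<in> {curvature \<mu> m i x |i. i \<noteq> m}"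
    then obtain i where i: "i \<noteq> m" "\<kappa> = curvature \<mu> m i x" by auto
    have "(axis i 1 :: real^'n) \<noteq> 0" by simp
    then show "\<kappa> \<in> {\<kappa>. \<exists>\<xi>. is_principal m (r \<mu>) (unit_tangent H \<eta> r \<mu> m) x \<kappa> \<xi>}"
      unfolding P using i by (intro CollectI exI[of _ "axis i 1"]) (auto simp: axis_def)
  qed
qed

text \<open>A rigid motion between two members of the family equates the lengths of their tangents to the \<open>i\<close>-th
  coordinate line, that is, \<open>(\<mu> + \<eta>\<^sub>m) / (\<mu> + \<eta>\<^sub>i)\<close> takes the same value for \<open>\<mu>\<close> and \<open>\<nu>\<close>.  As
  \<open>\<eta>\<^sub>i \<noteq> \<eta>\<^sub>m\<close>, this quotient is injective.\<close>

lemma rigidly_equivalent_imp_eq: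
  assumes dim: "CARD('n) \<ge> 2"
    and D: "openin (top_of_set (coord_slice U m c)) D" "D \<noteq> {}"
    and \<mu>: "\<mu> \<in> \<Lambda>" and \<nu>: "\<nu> \<in> \<Lambda>" and T: "rigid_motion T"
    and eq: "\<And>x. x \<in> D \<Longrightarrow> sqrt (\<nu> + \<eta> m c) *\<^sub>R r \<nu> x = T (sqrt (\<mu> + \<eta> m c) *\<^sub>R r \<mu> x)"
  shows "\<mu> = \<nu>"
proof -
  obtain x where xD: "x \<in> D" using D(2) by auto
  obtain V where V: "open V" "D = coord_slice U m c \<inter> V" using D(1) unfolding openin_open by auto
  have x: "x \<in> U" "x $ m = c" "x \<in> V" using xD V by (auto simp: coord_slice_def)
  \<comment> \<open>A tangential direction; this is where the dimension is at least two.\<close>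
  obtain i where i: "i \<noteq> m"
    using dim by (metis card_2_iff' card_le_Suc0_iff_eq finite numeral_2_eq_2 not_less_eq_eq UNIV_I)
  have line: "\<forall>\<^sub>F t in nhds 0. x + t *\<^sub>R axis i 1 \<in> D"
  proof -
    have "\<forall>\<^sub>F t in nhds (0::real). x + t *\<^sub>R axis i 1 \<in> U \<inter> V"
      by (rule eventually_line_in) (use x U V in auto)
    then show ?thesis
      by eventually_elim (use i x(2) in \<open>simp add: V(2) coord_slice_def axis_def\<close>)
  qed
  have vd: "((\<lambda>t. sqrt (\<tau> + \<eta> m c) *\<^sub>R r \<tau> (x + t *\<^sub>R axis i 1)) has_vector_derivative
      sqrt (\<tau> + \<eta> m c) *\<^sub>R pd i (r \<tau>) x) (at 0)" if "\<tau> \<in> \<Lambda>" for \<tau>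
    by (intro bounded_linear.has_vector_derivative[OF bounded_linear_scaleR_right] pd_line
        lame_frame.r_diff[OF frame[OF that]] x)
  have "norm (sqrt (\<nu> + \<eta> m c) *\<^sub>R pd i (r \<nu>) x) = norm (sqrt (\<mu> + \<eta> m c) *\<^sub>R pd i (r \<mu>) x)"
    by (rule rigid_motion_vector_derivative[OF T vd[OF \<mu>] vd[OF \<nu>]], rule eventually_mono[OF line], rule eq)
  then have sq: "(norm (sqrt (\<nu> + \<eta> m c) *\<^sub>R pd i (r \<nu>) x))\<^sup>2 = (norm (sqrt (\<mu> + \<eta> m c) *\<^sub>R pd i (r \<mu>) x))\<^sup>2"
    by simp
  have norm: "(norm (sqrt (\<tau> + \<eta> m c) *\<^sub>R pd i (r \<tau>) x))\<^sup>2
      = (\<tau> + \<eta> m c) * ((H i x)\<^sup>2 / (\<tau> + \<eta> i (x $ i)))" if "\<tau> \<in> \<Lambda>" for \<tau>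
  proof -
    have "pd i (r \<tau>) x \<bullet> pd i (r \<tau>) x = (H i x)\<^sup>2 / (\<tau> + \<eta> i (x $ i))"
      using realizes[OF that] x by (simp add: realizes_metric_def pencil_metric_def)
    then show ?thesis using pos[OF that x(1), of m] x(2)
      by (simp add: power_mult_distrib flip: power2_norm_eq_inner)
  qed
  have "(\<nu> + \<eta> m c) * ((H i x)\<^sup>2 / (\<nu> + \<eta> i (x $ i))) = (\<mu> + \<eta> m c) * ((H i x)\<^sup>2 / (\<mu> + \<eta> i (x $ i)))"
    using sq unfolding norm[OF \<mu>] norm[OF \<nu>] .
  then have "(H i x)\<^sup>2 * ((\<nu> + \<eta> m c) / (\<nu> + \<eta> i (x $ i)))
      = (H i x)\<^sup>2 * ((\<mu> + \<eta> m c) / (\<mu> + \<eta> i (x $ i)))"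
    by (simp only: times_divide_eq_right mult.commute)
  then have "(\<nu> + \<eta> m c) / (\<nu> + \<eta> i (x $ i)) = (\<mu> + \<eta> m c) / (\<mu> + \<eta> i (x $ i))"
    using H_pos[OF x(1), of i] by (simp del: times_divide_eq_right)
  then have "(\<nu> + \<eta> m c) * (\<mu> + \<eta> i (x $ i)) = (\<mu> + \<eta> m c) * (\<nu> + \<eta> i (x $ i))"
    using pos[OF \<mu> x(1), of i] pos[OF \<nu> x(1), of i] by (simp add: frac_eq_eq)
  then have "(\<mu> - \<nu>) * (\<eta> m c - \<eta> i (x $ i)) = 0" by (simp add: algebra_simps)
  moreover have "\<eta> m c \<noteq> \<eta> i (x $ i)" using spectrum[OF x(1), of m i] i x(2) by auto
  ultimately show ?thesis by simp
qed

end

theorem mainTheorem1: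
  fixes W U :: "(real^'n::finite) set"
    and g g' :: "real^'n \<Rightarrow> real^'n^'n"
    and b b' :: "real^'n \<Rightarrow> 'n \<Rightarrow> 'n \<Rightarrow> 'n \<Rightarrow> real"
    and R :: "real^'n \<Rightarrow> real^'n"
    and H :: "'n \<Rightarrow> real^'n \<Rightarrow> real"
    and \<eta> :: "'n \<Rightarrow> real \<Rightarrow> real"
    and \<Lambda> :: "real set"
  assumes dim: "CARD('n) \<ge> 2"
    and A: "nondegenerate_hyd_op W g b" "hamiltonian W g b"
    and A': "nondegenerate_hyd_op W g' b'" "hamiltonian W g' b'"
    and compat: "compatible W g' b' g b"
    and U: "connected U" "simply_connected U"
    and R: "diffeo_on W U R"
    and H_smooth: "\<And>i. smooth_on U (H i)"
    and H_pos: "\<And>i x. x \<in> U \<Longrightarrow> H i x > 0"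
    and eta_smooth: "\<And>i. smooth_on U (\<lambda>x. \<eta> i (x $ i))"
    and g_diag: "\<And>u. u \<in> W \<Longrightarrow>
      contra_transform R g u = diag_mat (\<lambda>i. 1 / (H i (R u))\<^sup>2)"
    and g'_diag: "\<And>u. u \<in> W \<Longrightarrow>
      contra_transform R g' u = diag_mat (\<lambda>i. \<eta> i (R u $ i) / (H i (R u))\<^sup>2)"
    and simple_spectrum: "\<And>x i j. x \<in> U \<Longrightarrow> i \<noteq> j \<Longrightarrow> \<eta> i (x $ i) \<noteq> \<eta> j (x $ j)"
    and Lam: "open \<Lambda>" "is_interval \<Lambda>"
    and Lam_pos: "\<And>\<mu> x i. \<mu> \<in> \<Lambda> \<Longrightarrow> x \<in> U \<Longrightarrow> \<mu> + \<eta> i (x $ i) > 0"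
  shows
    "(\<forall>\<mu>\<in>\<Lambda>. flat_metric_on W (\<lambda>u. matrix_inv (g' u + \<mu> *\<^sub>R g u)) \<and>
            flat_metric_on U (pencil_metric H \<eta> \<mu>)) \<and>
     (\<forall>r. (\<forall>\<mu>\<in>\<Lambda>. realizes_metric U (pencil_metric H \<eta> \<mu>) (r \<mu>)) \<longrightarrow>
       (let \<phi> = unit_tangent H \<eta> r in
         (\<forall>m. \<forall>\<mu>\<in>\<Lambda>. \<forall>x\<in>U.
            immersed_at m (r \<mu>) x \<and>
            unit_normal_at m (r \<mu>) (\<phi> \<mu> m) x \<and>
            curvature_line_coords_at m (r \<mu>) (\<phi> \<mu> m) x \<and>
            (let k = (\<lambda>i. rot_coeff H m i x / H i x * sqrt (\<mu> + \<eta> m (x $ m))) in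
              (\<forall>i. i \<noteq> m \<longrightarrow> pd i (\<phi> \<mu> m) x = k i *\<^sub>R pd i (r \<mu>) x) \<and>
              {\<kappa>. \<exists>\<xi>. is_principal m (r \<mu>) (\<phi> \<mu> m) x \<kappa> \<xi>} = {k i | i. i \<noteq> m})) \<and>
         (\<forall>m. \<exists>S. \<forall>\<mu>\<in>\<Lambda>. \<forall>x\<in>U.
            is_shape_operator m (r \<mu>) (\<phi> \<mu> m) x
              (\<lambda>\<xi>. sqrt (\<mu> + \<eta> m (x $ m)) *\<^sub>R S x \<xi>)) \<and>
         (\<forall>m c D. openin (top_of_set (coord_slice U m c)) D \<and> D \<noteq> {} \<longrightarrow>
            (let \<rho> = (\<lambda>\<mu> x. sqrt (\<mu> + \<eta> m c) *\<^sub>R r \<mu> x) in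
              (\<forall>\<mu>\<in>\<Lambda>. \<forall>x\<in>D. immersed_at m (\<rho> \<mu>) x \<and>
                 unit_normal_at m (\<rho> \<mu>) (\<phi> \<mu> m) x \<and>
                 curvature_line_coords_at m (\<rho> \<mu>) (\<phi> \<mu> m) x) \<and>
              (\<exists>S. \<forall>\<mu>\<in>\<Lambda>. \<forall>x\<in>D. is_shape_operator m (\<rho> \<mu>) (\<phi> \<mu> m) x (S x)) \<and>
              (\<forall>\<mu>\<in>\<Lambda>. \<forall>\<nu>\<in>\<Lambda>. \<forall>x\<in>D. \<forall>\<kappa> \<xi>.
                 is_principal m (\<rho> \<mu>) (\<phi> \<mu> m) x \<kappa> \<xi> \<longleftrightarrow>
                 is_principal m (\<rho> \<nu>) (\<phi> \<nu> m) x \<kappa> \<xi>) \<and>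
              nontrivial_deformation \<Lambda> D \<rho>))))"
proof -
  have W: "open W" and oU: "open U" using R by (auto simp: diffeo_on_def)
  have flat: "flat_metric_on W (\<lambda>u. matrix_inv (g' u + \<mu> *\<^sub>R g u)) \<and> flat_metric_on U (pencil_metric H \<eta> \<mu>)"
    if \<mu>: "\<mu> \<in> \<Lambda>" for \<mu>
  proof -
    let ?G = "\<lambda>u. g' u + \<mu> *\<^sub>R g u" and ?B = "\<lambda>u i j k. b' u i j k + \<mu> * b u i j k"
    let ?d = "\<lambda>i y. (\<mu> + \<eta> i (y $ i)) / (H i y)\<^sup>2"
    have ham: "hamiltonian W ?G ?B" using compat by (simp add: compatible_def)
    have G: "smooth_on W ?G"
      using A(1) A'(1) unfolding nondegenerate_hyd_op_def
      by (intro smooth_on_add smooth_on_linear[OF W bounded_linear_scaleR_right] W) auto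
    have B: "smooth_on W (\<lambda>u. ?B u i j k)" for i j k
      using A(1) A'(1) unfolding nondegenerate_hyd_op_def
      by (intro smooth_on_add smooth_on_mult smooth_on_const W) auto
    have diag: "contra_transform R ?G u = diag_mat (\<lambda>i. ?d i (R u))" if u: "u \<in> W" for u
    proof -
      have "contra_transform R ?G u = contra_transform R g' u + \<mu> *\<^sub>R contra_transform R g u"
        unfolding contra_transform_def
        by (simp add: matrix_distrib)
      also have "\<dots> = diag_mat (\<lambda>i. ?d i (R u))"
        unfolding g_diag[OF u] g'_diag[OF u] by (simp add: vec_eq_iff add_divide_distrib)
      finally show ?thesis .
    qed
    have d: "?d i y \<noteq> 0" if "y \<in> U" for i y
      using Lam_pos[OF \<mu> that, of i] H_pos[OF that, of i] by simp
    have d_smooth: "smooth_on U (?d i)" for i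
      unfolding power2_eq_square
      by (intro smooth_on_divide smooth_on_add smooth_on_mult smooth_on_const oU eta_smooth H_smooth)
        (use H_pos[of _ i] in \<open>simp add: less_imp_neq[symmetric]\<close>)
    have "pencil_metric H \<eta> \<mu> = (\<lambda>y. diag_mat (\<lambda>i. inverse (?d i y)))"
      by (simp add: fun_eq_iff pencil_metric_def inverse_eq_divide)
    then show ?thesis
      using hamiltonian_diagonal_flat[OF R ham G B diag d d_smooth] by simp
  qed
  show ?thesis
  proof (intro conjI ballI allI impI)
    fix r assume r: "\<forall>\<mu>\<in>\<Lambda>. realizes_metric U (pencil_metric H \<eta> \<mu>) (r \<mu>)"
    interpret pencil_family U H \<eta> \<Lambda> r
      by unfold_locales (use oU H_smooth H_pos eta_smooth simple_spectrum Lam_pos r in auto)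
    show "let \<phi> = unit_tangent H \<eta> r in
         (\<forall>m. \<forall>\<mu>\<in>\<Lambda>. \<forall>x\<in>U.
            immersed_at m (r \<mu>) x \<and>
            unit_normal_at m (r \<mu>) (\<phi> \<mu> m) x \<and>
            curvature_line_coords_at m (r \<mu>) (\<phi> \<mu> m) x \<and>
            (let k = (\<lambda>i. rot_coeff H m i x / H i x * sqrt (\<mu> + \<eta> m (x $ m))) in
              (\<forall>i. i \<noteq> m \<longrightarrow> pd i (\<phi> \<mu> m) x = k i *\<^sub>R pd i (r \<mu>) x) \<and>
              {\<kappa>. \<exists>\<xi>. is_principal m (r \<mu>) (\<phi> \<mu> m) x \<kappa> \<xi>} = {k i | i. i \<noteq> m})) \<and>
         (\<forall>m. \<exists>S. \<forall>\<mu>\<in>\<Lambda>. \<forall>x\<in>U.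
            is_shape_operator m (r \<mu>) (\<phi> \<mu> m) x
              (\<lambda>\<xi>. sqrt (\<mu> + \<eta> m (x $ m)) *\<^sub>R S x \<xi>)) \<and>
         (\<forall>m c D. openin (top_of_set (coord_slice U m c)) D \<and> D \<noteq> {} \<longrightarrow>
            (let \<rho> = (\<lambda>\<mu> x. sqrt (\<mu> + \<eta> m c) *\<^sub>R r \<mu> x) in
              (\<forall>\<mu>\<in>\<Lambda>. \<forall>x\<in>D. immersed_at m (\<rho> \<mu>) x \<and>
                 unit_normal_at m (\<rho> \<mu>) (\<phi> \<mu> m) x \<and>
                 curvature_line_coords_at m (\<rho> \<mu>) (\<phi> \<mu> m) x) \<and>
              (\<exists>S. \<forall>\<mu>\<in>\<Lambda>. \<forall>x\<in>D. is_shape_operator m (\<rho> \<mu>) (\<phi> \<mu> m) x (S x)) \<and>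
              (\<forall>\<mu>\<in>\<Lambda>. \<forall>\<nu>\<in>\<Lambda>. \<forall>x\<in>D. \<forall>\<kappa> \<xi>.
                 is_principal m (\<rho> \<mu>) (\<phi> \<mu> m) x \<kappa> \<xi> \<longleftrightarrow>
                 is_principal m (\<rho> \<nu>) (\<phi> \<nu> m) x \<kappa> \<xi>) \<and>
              nontrivial_deformation \<Lambda> D \<rho>))"
      unfolding Let_def curvature_def[symmetric]
    proof (intro conjI ballI allI impI)
      fix m \<mu> x assume \<mu>: "\<mu> \<in> \<Lambda>" and x: "x \<in> U"
      show "immersed_at m (r \<mu>) x" "unit_normal_at m (r \<mu>) (unit_tangent H \<eta> r \<mu> m) x"
        "curvature_line_coords_at m (r \<mu>) (unit_tangent H \<eta> r \<mu> m) x"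
        using scaled_hypersurface(1-3)[OF \<mu> x, of 1 m] by simp_all
      show "{\<kappa>. \<exists>\<xi>. is_principal m (r \<mu>) (unit_tangent H \<eta> r \<mu> m) x \<kappa> \<xi>} = {curvature \<mu> m i x |i. i \<noteq> m}"
        by (rule principal_curvatures[OF \<mu> x])
      fix i assume "i \<noteq> m"
      then show "pd i (unit_tangent H \<eta> r \<mu> m) x = curvature \<mu> m i x *\<^sub>R pd i (r \<mu>) x"
        by (rule pd_unit_tangent[OF \<mu> x])
    next
      fix m
      define S where "S x \<xi> = (\<chi> i. if i = m then 0 else rot_coeff H m i x / H i x * \<xi> $ i)" for x \<xi> :: "real^'n"
      have "is_shape_operator m (r \<mu>) (unit_tangent H \<eta> r \<mu> m) x (\<lambda>\<xi>. sqrt (\<mu> + \<eta> m (x $ m)) *\<^sub>R S x \<xi>)"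
        if \<mu>: "\<mu> \<in> \<Lambda>" and x: "x \<in> U" for \<mu> x
      proof -
        have "(\<lambda>\<xi>. sqrt (\<mu> + \<eta> m (x $ m)) *\<^sub>R S x \<xi>)
            = (\<lambda>\<xi>. \<chi> i. if i = m then 0 else curvature \<mu> m i x / 1 * \<xi> $ i)"
          by (simp add: fun_eq_iff vec_eq_iff S_def curvature_def)
        then show ?thesis using scaled_hypersurface(5)[OF \<mu> x, of 1 m] by simp
      qed
      then show "\<exists>S. \<forall>\<mu>\<in>\<Lambda>. \<forall>x\<in>U. is_shape_operator m (r \<mu>) (unit_tangent H \<eta> r \<mu> m) x
              (\<lambda>\<xi>. sqrt (\<mu> + \<eta> m (x $ m)) *\<^sub>R S x \<xi>)"
        by (intro exI[of _ S]) simp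
    next
      fix m c D assume D: "openin (top_of_set (coord_slice U m c)) D \<and> D \<noteq> {}"
      then have DU: "x \<in> U" and Dc: "x $ m = c" if "x \<in> D" for x
        using that openin_imp_subset[OF conjunct1[OF D]] by (auto simp: coord_slice_def)
      let ?c = "\<lambda>\<mu>. sqrt (\<mu> + \<eta> m c)" and ?\<phi> = "\<lambda>\<mu>. unit_tangent H \<eta> r \<mu> m"
      have c: "?c \<mu> > 0" if "\<mu> \<in> \<Lambda>" "x \<in> D" for \<mu> x
        using pos[OF that(1) DU[OF that(2)], of m] Dc[OF that(2)] by simp
      have k: "curvature \<mu> m i x = ?c \<mu> * (rot_coeff H m i x / H i x)" if "x \<in> D" for \<mu> x i
        using Dc[OF that] by (simp add: curvature_def)
      {
        fix \<mu> x assume \<mu>: "\<mu> \<in> \<Lambda>" and x: "x \<in> D"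
        show "immersed_at m (\<lambda>x. ?c \<mu> *\<^sub>R r \<mu> x) x" "unit_normal_at m (\<lambda>x. ?c \<mu> *\<^sub>R r \<mu> x) (?\<phi> \<mu>) x"
          "curvature_line_coords_at m (\<lambda>x. ?c \<mu> *\<^sub>R r \<mu> x) (?\<phi> \<mu>) x"
          by (rule scaled_hypersurface(1-3)[OF \<mu> DU[OF x] c[OF \<mu> x]])+
        fix \<nu> \<kappa> \<xi> assume \<nu>: "\<nu> \<in> \<Lambda>"
        show "is_principal m (\<lambda>x. ?c \<mu> *\<^sub>R r \<mu> x) (?\<phi> \<mu>) x \<kappa> \<xi> \<longleftrightarrow> is_principal m (\<lambda>x. ?c \<nu> *\<^sub>R r \<nu> x) (?\<phi> \<nu>) x \<kappa> \<xi>"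
          unfolding scaled_hypersurface(4)[OF \<mu> DU[OF x] c[OF \<mu> x]] scaled_hypersurface(4)[OF \<nu> DU[OF x] c[OF \<nu> x]]
            k[OF x] using c[OF \<mu> x] c[OF \<nu> x] by (simp del: times_divide_eq_right)
      }
      define S where "S x \<xi> = (\<chi> i. if i = m then 0 else rot_coeff H m i x / H i x * \<xi> $ i)" for x \<xi> :: "real^'n"
      have "is_shape_operator m (\<lambda>x. ?c \<mu> *\<^sub>R r \<mu> x) (?\<phi> \<mu>) x (S x)" if \<mu>: "\<mu> \<in> \<Lambda>" and x: "x \<in> D" for \<mu> x
      proof -
        have q: "curvature \<mu> m i x / ?c \<mu> = rot_coeff H m i x / H i x" for i
          unfolding k[OF x] using c[OF \<mu> x] by simp
        show ?thesis
          using scaled_hypersurface(5)[OF \<mu> DU[OF x] c[OF \<mu> x], of m] unfolding q S_def [abs_def] .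
      qed
      then show "\<exists>S. \<forall>\<mu>\<in>\<Lambda>. \<forall>x\<in>D. is_shape_operator m (\<lambda>x. ?c \<mu> *\<^sub>R r \<mu> x) (?\<phi> \<mu>) x (S x)"
        by (intro exI[of _ S]) simp
      show "nontrivial_deformation \<Lambda> D (\<lambda>\<mu> x. ?c \<mu> *\<^sub>R r \<mu> x)"
        unfolding nontrivial_deformation_def
        using rigidly_equivalent_imp_eq[OF dim conjunct1[OF D] conjunct2[OF D]] by blast
    qed
  qed (use flat in auto)
qed

end
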